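(* For $|q|<1$, $$\mathrm{C}\Phi_5(q)=\frac{1}{(q;q)_\infty^5}\left(1+25\sum_{j=1}^\infty\Big(\frac{j}{5}\Big)\frac{q^j}{(1-q^j)^2}-5\sum_{j=1}^\infty\Big(\frac j5\Big)\frac{jq^j}{1-q^j}\right)=\frac{1}{(q^5;q^5)_\infty}+25q\frac{(q^5;q^5)_\infty^5}{(q;q)_\infty^6}=\frac{1}{(q^5;q^5)_\infty}+5\sum_{j=1}^\infty p(5j-1)q^j.$$
   Context: A $k$-colored generalized Frobenius symbol is a two-row array with $d\ge 0$ columns whose entries are colored nonnegative integers $\ell_c$ ($\ell\ge 0$, color $c\in\{1,\dots,k\}$), each row strictly decreasing with respect to the total order $0_1\prec 0_2\prec\cdots\prec 0_k\prec 1_1\prec\cdots\prec 1_k\prec 2_1\prec\cdots$. It is a $k$-colored generalized Frobenius partition of $n=d+\sum(\text{integer values of all entries})$. $c\phi_k(n)$ is the number of such partitions of $n$ (with $c\phi_k(0)=1$), and $\mathrm{C}\Phi_k(q)=\sum_{n\ge0}c\phi_k(n)q^n$. $(a;q)_\infty=\prod_{j\ge1}(1-aq^{j-1})$, $p(n)$ is the number of ordinary partitions of $n$, and $\left(\frac{j}{5}\right)$ is the Legendre symbol. *)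

theory Defs
  imports
    "HOL-Analysis.Analysis"
    "HOL-Number_Theory.Number_Theory"
    "HOL-Library.Multiset"
begin

text \<open>The colored integer $\ell_c$ is encoded as the pair \<open>(l, c)\<close>.\<close>

type_synonym colored = "nat \<times> nat"

definition colored_less :: "colored \<Rightarrow> colored \<Rightarrow> bool" where
  "colored_less x y \<longleftrightarrow> fst x < fst y \<or> (fst x = fst y \<and> snd x < snd y)"

definition frobenius_row :: "nat \<Rightarrow> colored list \<Rightarrow> bool" where
  "frobenius_row k xs \<longleftrightarrow>
     snd ` set xs \<subseteq> {1..k} \<and> sorted_wrt (\<lambda>x y. colored_less y x) xs"

definition frobenius_symbol :: "nat \<Rightarrow> colored list \<times> colored list \<Rightarrow> bool" where
  "frobenius_symbol k F \<longleftrightarrow>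
     frobenius_row k (fst F) \<and> frobenius_row k (snd F) \<and> length (fst F) = length (snd F)"

definition frobenius_weight :: "colored list \<times> colored list \<Rightarrow> nat" where
  "frobenius_weight F =
     length (fst F) + sum_list (map fst (fst F)) + sum_list (map fst (snd F))"

definition frobenius_partitions :: "nat \<Rightarrow> nat \<Rightarrow> (colored list \<times> colored list) set" where
  "frobenius_partitions k n = {F. frobenius_symbol k F \<and> frobenius_weight F = n}"

definition cphi :: "nat \<Rightarrow> nat \<Rightarrow> nat" where
  "cphi k n = card (frobenius_partitions k n)"

definition CPhi :: "nat \<Rightarrow> complex \<Rightarrow> complex" where
  "CPhi k q = (\<Sum>n. of_nat (cphi k n) * q ^ n)"

lemma finite_frobenius_partitions: "finite (frobenius_partitions k n)"
proof -
  let ?L = "{xs. set xs \<subseteq> {..n} \<times> {1..k} \<and> length xs \<le> n}"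
  have row: "xs \<in> ?L"
    if "frobenius_row k xs" "length xs \<le> n" "sum_list (map fst xs) \<le> n" for xs
  proof -
    have "x \<in> {..n} \<times> {1..k}" if "x \<in> set xs" for x
    proof -
      have "fst x \<le> sum_list (map fst xs)"
        using that by (intro member_le_sum_list) simp_all
      moreover have "snd x \<in> {1..k}"
        using that \<open>frobenius_row k xs\<close> unfolding frobenius_row_def by blast
      ultimately show ?thesis
        using \<open>sum_list (map fst xs) \<le> n\<close> by (simp add: mem_Times_iff)
    qed
    with \<open>length xs \<le> n\<close> show ?thesis by blast
  qed
  have "frobenius_partitions k n \<subseteq> ?L \<times> ?L"
  proof
    fix F assume "F \<in> frobenius_partitions k n"
    then have "frobenius_row k (fst F)" "frobenius_row k (snd F)"
      "length (fst F) = length (snd F)" "frobenius_weight F = n"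
      by (simp_all add: frobenius_partitions_def frobenius_symbol_def)
    then have "fst F \<in> ?L" "snd F \<in> ?L"
      by (intro row; simp add: frobenius_weight_def)+
    then show "F \<in> ?L \<times> ?L" by (simp only: mem_Times_iff)
  qed
  moreover have "finite (?L \<times> ?L)"
    by (intro finite_cartesian_product finite_lists_length_le) simp_all
  ultimately show ?thesis by (rule finite_subset)
qed

lemma cphi_0: "cphi k 0 = 1"
proof -
  have "frobenius_partitions k 0 = {([], [])}"
    by (auto simp: frobenius_partitions_def frobenius_symbol_def frobenius_weight_def
        frobenius_row_def)
  then show ?thesis by (simp add: cphi_def)
qed

definition partitions :: "nat \<Rightarrow> nat multiset set" where
  "partitions n = {P. 0 \<notin># P \<and> sum_mset P = n}"

definition partition_number :: "nat \<Rightarrow> nat" where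
  "partition_number n = card (partitions n)"

lemma finite_partitions: "finite (partitions n)"
proof -
  have size: "0 \<notin> set xs \<Longrightarrow> length xs \<le> sum_list xs" for xs :: "nat list"
    by (induction xs) auto
  have "partitions n \<subseteq> mset ` {xs. set xs \<subseteq> {..n} \<and> length xs \<le> n}"
  proof
    fix P assume P: "P \<in> partitions n"
    obtain xs where xs: "P = mset xs" by (metis ex_mset)
    have "0 \<notin> set xs" "sum_list xs = n"
      using P xs by (auto simp: partitions_def sum_mset_sum_list)
    then have "set xs \<subseteq> {..n} \<and> length xs \<le> n"
      using size[of xs] member_le_sum_list[of _ xs] by auto
    with xs show "P \<in> mset ` {xs. set xs \<subseteq> {..n} \<and> length xs \<le> n}" by blast
  qed
  then show ?thesis
    by (rule finite_subset) (intro finite_imageI finite_lists_length_le finite_atMost)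
qed

definition qpoch_inf :: "complex \<Rightarrow> complex \<Rightarrow> complex" where
  "qpoch_inf a q = (\<Prod>j. 1 - a * q ^ j)"

lemma convergent_prod_qpoch_inf:
  fixes a q :: complex
  assumes "norm q < 1"
  shows "convergent_prod (\<lambda>j. 1 - a * q ^ j)"
proof (rule abs_convergent_prod_imp_convergent_prod)
  have "summable (\<lambda>j. norm a * norm q ^ j)"
    using assms by (intro summable_mult summable_geometric) auto
  then show "abs_convergent_prod (\<lambda>j. 1 - a * q ^ j)"
    by (simp add: abs_convergent_prod_conv_summable norm_mult norm_power)
qed

end

theory Submission
  imports Defs "HOL-Complex_Analysis.Complex_Analysis"
begin

text \<open>
  The series \<open>CPhi 5 q\<close> is the constant term in \<open>t\<close> of the fifth power of
  \<open>qpoch_inf (t * q) q * qpoch_inf (1 / t) q\<close>. The Laurent coefficients of this power satisfy a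
  \<open>q\<close>-difference recursion of step 5, so averaging over \<open>t \<mapsto> zeta5 * t\<close> leaves
  \<open>CPhi 5 q\<close> times a theta function of nome \<open>q ^ 5\<close>. Differentiating at the common zero
  \<open>t = 1\<close> expresses \<open>CPhi 5 q\<close> by values of the theta function \<open>\<theta>\<close> and of its
  logarithmic derivative \<open>Z\<close> at fifth roots of unity.

  Two consequences of the Weierstrass three-term relation do the rest: the product formula for
  \<open>Z x + Z y + Z w - Z (x + y + w)\<close>, and the one for \<open>Z' a - Z' b\<close>. At fifth roots of
  unity (nome \<open>q\<close>) and at \<open>q, q ^ 2\<close> (nome \<open>q ^ 5\<close>) they turn the eta quotients
  \<open>E1 ^ 5 / E5\<close> and \<open>q * E5 ^ 5 / E1\<close> into the two Lambert series of the theorem, and also into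
  quadratic forms in two weight-one Lambert series that are the same for both nomes.
  The series \<open>CPhi 5 q * E1 ^ 5\<close> is such a quadratic form as well, and comparing coefficients gives the
  first two equalities. The last one follows by extracting the exponents divisible by 5 from
  \<open>q * E5 ^ 5 / E1 = E5 ^ 5 * (\<Sum>n. p n * q ^ Suc n)\<close>, because the coefficients of the Lambert
  series on the left are multiplied by 5 under \<open>n \<mapsto> 5 * n\<close>.
\<close>

subsection \<open>Colored Frobenius partitions as charge-zero pairs of finite sets\<close>

text \<open>Both families of evaluation points are 5-torsion points: \<open>omega5\<close> is a
  fifth of the period 2 pi i of \<open>theta q\<close> (a period up to sign), and \<open>l\<close>
  with \<open>q = exp l\<close> is a fifth of the quasi-period \<open>5 * l\<close> of
  \<open>theta (q ^ 5)\<close>. At such points three times a point is minus twice the point up to a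
  full (quasi-)period, so the product formula with three equal arguments closes on two theta values
  and two logarithmic derivatives. This is why the two computations run in parallel. The eta
  quotients arise because the product of the two theta values is, up to an elementary factor, a
  quotient of \<open>E1\<close> and \<open>E5\<close>. Sorting a Lambert series at a fifth root of
  unity by residues modulo 5 links the nomes: it makes all four logarithmic derivatives affine in
  the same two series \<open>\<alpha>\<close> and \<open>\<beta>\<close>. What would otherwise
  follow from the finite dimension of a space of modular forms becomes a polynomial identity in
  \<open>\<alpha>\<close>, \<open>\<beta>\<close> and \<open>gauss5\<close>. A logarithm
  \<open>l\<close> of \<open>q\<close> is carried along because \<open>theta\<close> contains
  half-arguments and its quasi-period is a logarithm of the nome.\<close>

lemma has_sum_product:
  fixes f :: "'a \<Rightarrow> complex" and g :: "'b \<Rightarrow> complex"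
  assumes "(f has_sum a) A" "(g has_sum b) B"
  shows "((\<lambda>(x, y). f x * g y) has_sum (a * b)) (A \<times> B)"
proof (rule has_sum_SigmaI)
  show "((\<lambda>y. case (x, y) of (x, y) \<Rightarrow> f x * g y) has_sum (f x * b)) B" for x
    using has_sum_cmult_right[OF assms(2), of "f x"] by simp
  show "((\<lambda>x. f x * b) has_sum (a * b)) A"
    by (rule has_sum_cmult_left[OF assms(1)])
  have f: "(\<lambda>x. norm (f x)) summable_on A" and g: "(\<lambda>x. norm (g x)) summable_on B"
    using assms has_sum_imp_summable summable_on_iff_abs_summable_on_complex by blast+
  have "(\<lambda>p. norm (case p of (x, y) \<Rightarrow> f x * g y)) summable_on A \<times> B"
  proof (subst Infinite_Sum.abs_summable_on_Sigma_iff, intro conjI ballI)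
    show "(\<lambda>y. norm (case (x, y) of (x, y) \<Rightarrow> f x * g y)) summable_on B" for x
      using summable_on_cmult_right[OF g, of "norm (f x)"] by (simp add: norm_mult)
    show "(\<lambda>x. norm (\<Sum>\<^sub>\<infinity>y\<in>B. norm (case (x, y) of (x, y) \<Rightarrow> f x * g y))) summable_on A"
      using summable_on_cmult_left[OF f, of "infsum (\<lambda>x. norm (g x)) B"]
      by (simp add: norm_mult infsum_cmult_right' infsum_nonneg abs_mult)
  qed
  then show "(\<lambda>(x, y). f x * g y) summable_on A \<times> B"
    by (rule abs_summable_summable)
qed

lemma sum_Pow_prod:
  fixes x :: "'a \<Rightarrow> 'b::comm_semiring_1"
  assumes "finite I"
  shows "(\<Sum>A\<in>Pow I. \<Prod>i\<in>A. x i) = (\<Prod>i\<in>I. 1 + x i)"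
  using prod_add[OF assms, of x "\<lambda>_. 1"] by (simp add: add.commute)

text \<open>A term of the expanded power selects, in each of the \<open>k\<close> copies of the
  product, the finitely many factors that contribute \<open>x n\<close>; the copy is the
  color.\<close>

lemma has_sum_finite_subsets_prod:
  fixes x :: "nat \<Rightarrow> complex"
  assumes x: "summable (\<lambda>n. norm (x n))"
  shows "((\<lambda>A. \<Prod>i\<in>A. x (fst i)) has_sum (\<Prod>n. 1 + x n) ^ k)
           {A. finite A \<and> A \<subseteq> UNIV \<times> {1..k}}" (is "(?f has_sum _) ?S")
proof -
  define I where "I N = {..<N} \<times> {1..k}" for N :: nat
  have finI: "finite (I N)" for N by (simp add: I_def)
  have prodI: "(\<Prod>i\<in>I N. g (fst i)) = (\<Prod>n<N. g n) ^ k" for N and g :: "nat \<Rightarrow> 'c::comm_semiring_1"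
    unfolding I_def using prod.cartesian_product[of "\<lambda>n _. g n" "{1..k}" "{..<N}"]
    by (simp add: case_prod_unfold prod_power_distrib)
  \<comment> \<open>The families \<open>Pow (I N)\<close> are cofinal among the finite families of
    finite sets. This gives both the bound for absolute summability and the value of the sum, since
    over \<open>Pow (I N)\<close> it is a finite product.\<close>
  have ex: "\<exists>N. \<forall>n\<ge>N. F \<subseteq> Pow (I n)" if "finite F" "F \<subseteq> ?S" for F
  proof -
    have "finite (fst ` \<Union>F)" using that by auto
    then obtain N where "\<forall>m\<in>fst ` \<Union>F. m < N"
      using finite_nat_set_iff_bounded by blast
    then have lt: "fst i < N" if "A \<in> F" "i \<in> A" for A i using that by blast
    have "A \<subseteq> I n" if "n \<ge> N" "A \<in> F" for n A
    proof
      fix i assume i: "i \<in> A"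
      then have "fst i < n" "snd i \<in> {1..k}"
        using lt[of A i] that \<open>F \<subseteq> ?S\<close> by force+
      then show "i \<in> I n" by (simp add: I_def mem_Times_iff)
    qed
    then have "\<forall>n\<ge>N. F \<subseteq> Pow (I n)" by blast
    then show ?thesis by blast
  qed
  have "(\<lambda>A. norm (?f A)) summable_on ?S"
    unfolding abs_summable_iff_bdd_above
  proof (rule bdd_aboveI2)
    fix F assume "F \<in> {F. F \<subseteq> ?S \<and> finite F}"
    then have "finite F" "F \<subseteq> ?S" by simp_all
    from ex[OF this] obtain N where "\<forall>n\<ge>N. F \<subseteq> Pow (I n)" ..
    then have N: "F \<subseteq> Pow (I N)" by simp
    have "(\<Sum>A\<in>F. norm (?f A)) \<le> (\<Sum>A\<in>Pow (I N). norm (?f A))"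
      using N finI by (intro sum_mono2) auto
    also have "\<dots> = (\<Prod>n<N. 1 + norm (x n)) ^ k"
      using sum_Pow_prod[OF finI, of "\<lambda>i. norm (x (fst i))" N] prodI[of "\<lambda>n. 1 + norm (x n)" N]
      by (simp add: prod_norm)
    also have "\<dots> \<le> exp (\<Sum>n. norm (x n)) ^ k"
    proof (intro power_mono)
      have "(\<Prod>n<N. 1 + norm (x n)) \<le> (\<Prod>n<N. exp (norm (x n)))"
        by (intro prod_mono) (auto simp: exp_ge_add_one_self)
      also have "\<dots> = exp (\<Sum>n<N. norm (x n))" by (simp add: exp_sum)
      also have "\<dots> \<le> exp (\<Sum>n. norm (x n))" using x by (simp add: sum_le_suminf)
      finally show "(\<Prod>n<N. 1 + norm (x n)) \<le> exp (\<Sum>n. norm (x n))" .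
    qed (auto intro: prod_nonneg)
    finally show "(\<Sum>A\<in>F. norm (?f A)) \<le> exp (\<Sum>n. norm (x n)) ^ k" .
  qed
  then obtain s where s: "(?f has_sum s) ?S"
    using abs_summable_summable summable_on_def by blast
  have "filterlim (\<lambda>N. Pow (I N)) (finite_subsets_at_top ?S) sequentially"
    unfolding filterlim_iff eventually_finite_subsets_at_top
  proof safe
    fix P X assume X: "finite X" "X \<subseteq> ?S"
      and P: "\<forall>Y. finite Y \<and> X \<subseteq> Y \<and> Y \<subseteq> ?S \<longrightarrow> P Y"
    from ex[OF X] obtain N where N: "\<forall>n\<ge>N. X \<subseteq> Pow (I n)" ..
    show "\<forall>\<^sub>F n in sequentially. P (Pow (I n))"
      using eventually_ge_at_top[of N]
    proof eventually_elim
      case (elim n)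
      have "Pow (I n) \<subseteq> ?S" using finI[of n] finite_subset unfolding I_def by auto
      then show ?case using P N elim finI[of n] by simp
    qed
  qed
  with s have "(\<lambda>N. sum ?f (Pow (I N))) \<longlonglongrightarrow> s"
    unfolding has_sum_def by (rule filterlim_compose)
  moreover have "sum ?f (Pow (I N)) = (\<Prod>n<N. 1 + x n) ^ k" for N
    using sum_Pow_prod[OF finI, of "\<lambda>i. x (fst i)" N] prodI[of "\<lambda>n. 1 + x n" N] by simp
  ultimately have "(\<lambda>N. (\<Prod>n<N. 1 + x n) ^ k) \<longlonglongrightarrow> s" by simp
  moreover have "(\<lambda>N. (\<Prod>n<N. 1 + x n) ^ k) \<longlonglongrightarrow> (\<Prod>n. 1 + x n) ^ k"
  proof (intro tendsto_power)
    have "convergent_prod (\<lambda>n. 1 + x n)"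
      using x by (intro abs_convergent_prod_imp_convergent_prod)
        (simp add: abs_convergent_prod_conv_summable)
    then show "(\<lambda>N. \<Prod>n<N. 1 + x n) \<longlonglongrightarrow> (\<Prod>n. 1 + x n)"
      by (subst LIMSEQ_lessThan_iff_atMost) (rule convergent_prod_LIMSEQ)
  qed
  ultimately have "s = (\<Prod>n. 1 + x n) ^ k" by (rule LIMSEQ_unique)
  with s show ?thesis by simp
qed


definition finite_colored_sets :: "nat \<Rightarrow> colored set set" where
  "finite_colored_sets k = {A. finite A \<and> A \<subseteq> UNIV \<times> {1..k}}"

text \<open>The two rows of a symbol are modelled by two finite sets. A shift by one per entry of the
  first row accounts for the column count in the weight; the charge is the difference of the row lengths.\<close>

definition pair_weight :: "colored set \<times> colored set \<Rightarrow> nat" where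
  "pair_weight P = (\<Sum>i\<in>fst P. Suc (fst i)) + (\<Sum>i\<in>snd P. fst i)"

definition charge_pairs :: "nat \<Rightarrow> int \<Rightarrow> (colored set \<times> colored set) set" where
  "charge_pairs k n = {P \<in> finite_colored_sets k \<times> finite_colored_sets k.
     int (card (fst P)) - int (card (snd P)) = n}"

text \<open>This is the coefficient of \<open>z powi n\<close> in the \<open>k\<close>-th power of
  the two products (\<open>has_sum_charge_coeff\<close>); at charge 0 it is the generating series of
  \<open>cphi k\<close> (\<open>sums_cphi\<close>).\<close>

definition charge_coeff :: "nat \<Rightarrow> complex \<Rightarrow> int \<Rightarrow> complex" where
  "charge_coeff k q n = (\<Sum>\<^sub>\<infinity>P\<in>charge_pairs k n. q ^ pair_weight P)"

lemma summable_norm_geometric: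
  fixes q :: complex
  assumes "norm q < 1"
  shows "summable (\<lambda>n. norm (a * q ^ n))"
  using assms by (auto simp: norm_mult norm_power intro!: summable_mult summable_geometric)

lemma has_sum_colored_pairs:
  assumes q: "norm q < 1" and z: "z \<noteq> 0"
  shows "((\<lambda>P. z powi (int (card (fst P)) - int (card (snd P))) * q ^ pair_weight P) has_sum
           (qpoch_inf (- z * q) q * qpoch_inf (- 1 / z) q) ^ k)
           (finite_colored_sets k \<times> finite_colored_sets k)"
proof -
  let ?S = "finite_colored_sets k"
  have 1: "((\<lambda>A. \<Prod>i\<in>A. (z * q) * q ^ fst i) has_sum qpoch_inf (- z * q) q ^ k) ?S"
    using has_sum_finite_subsets_prod[OF summable_norm_geometric[OF q, of "z * q"], of k]
    by (simp add: finite_colored_sets_def qpoch_inf_def)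
  have 2: "((\<lambda>A. \<Prod>i\<in>A. (1 / z) * q ^ fst i) has_sum qpoch_inf (- 1 / z) q ^ k) ?S"
    using has_sum_finite_subsets_prod[OF summable_norm_geometric[OF q, of "1 / z"], of k]
    by (simp add: finite_colored_sets_def qpoch_inf_def)
  have "((\<lambda>(A, B). (\<Prod>i\<in>A. (z * q) * q ^ fst i) * (\<Prod>i\<in>B. (1 / z) * q ^ fst i)) has_sum
      (qpoch_inf (- z * q) q ^ k * qpoch_inf (- 1 / z) q ^ k)) (?S \<times> ?S)"
    by (rule has_sum_product[OF 1 2])
  moreover have "(\<Prod>i\<in>A. (z * q) * q ^ fst i) * (\<Prod>i\<in>B. (1 / z) * q ^ fst i)
      = z powi (int (card A) - int (card B)) * q ^ pair_weight (A, B)" for A B :: "colored set"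
  proof -
    have "(\<Prod>i\<in>A. (z * q) * q ^ fst i) = z ^ card A * q ^ (\<Sum>i\<in>A. Suc (fst i))"
      by (simp add: prod.distrib power_sum mult.assoc)
    moreover have "(\<Prod>i\<in>B. (1 / z) * q ^ fst i) = (1 / z) ^ card B * q ^ (\<Sum>i\<in>B. fst i)"
      by (simp only: prod.distrib power_sum prod_constant)
    ultimately show ?thesis
      using z by (simp add: pair_weight_def power_add power_int_diff field_simps)
  qed
  ultimately show ?thesis
    by (simp add: case_prod_unfold power_mult_distrib)
qed

lemma has_sum_charge_pairs:
  assumes q: "norm q < 1"
  shows "((\<lambda>P. q ^ pair_weight P) has_sum charge_coeff k q n) (charge_pairs k n)"
proof -
  have "(\<lambda>P. q ^ pair_weight P) summable_on finite_colored_sets k \<times> finite_colored_sets k"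
    using has_sum_imp_summable[OF has_sum_colored_pairs[OF q, of 1 k]] by simp
  then have "(\<lambda>P. q ^ pair_weight P) summable_on charge_pairs k n"
    by (rule summable_on_subset) (auto simp: charge_pairs_def)
  then show ?thesis unfolding charge_coeff_def by (rule has_sum_infsum)
qed

lemma has_sum_charge_coeff:
  assumes q: "norm q < 1" and z: "z \<noteq> 0"
  shows "((\<lambda>n. charge_coeff k q n * z powi n) has_sum
           (qpoch_inf (- z * q) q * qpoch_inf (- 1 / z) q) ^ k) UNIV"
proof (rule has_sum_SigmaD)
  let ?f = "\<lambda>P. z powi (int (card (fst P)) - int (card (snd P))) * q ^ pair_weight P"
  have "bij_betw snd (Sigma UNIV (charge_pairs k)) (finite_colored_sets k \<times> finite_colored_sets k)"
    by (rule bij_betwI[where g = "\<lambda>P. (int (card (fst P)) - int (card (snd P)), P)"])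
      (auto simp: charge_pairs_def)
  from has_sum_reindex_bij_betw[OF this, of ?f] has_sum_colored_pairs[OF q z, of k]
  show "((\<lambda>x. ?f (snd x)) has_sum (qpoch_inf (- z * q) q * qpoch_inf (- 1 / z) q) ^ k)
      (Sigma UNIV (charge_pairs k))" by simp
  fix n :: int
  have "((\<lambda>P. z powi n * q ^ pair_weight P) has_sum (z powi n * charge_coeff k q n)) (charge_pairs k n)"
    by (rule has_sum_cmult_right[OF has_sum_charge_pairs[OF q]])
  then show "((\<lambda>P. ?f (snd (n, P))) has_sum charge_coeff k q n * z powi n) (charge_pairs k n)"
    by (subst has_sum_cong[where g = "\<lambda>P. z powi n * q ^ pair_weight P"])
      (auto simp: charge_pairs_def mult.commute)
qed

text \<open>A strictly decreasing row read backwards is the unique strictly sorted list of its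
  entries, so it carries no more information than its set.\<close>

lemma bij_betw_set_frobenius_row:
  "bij_betw set {xs. frobenius_row k xs} (finite_colored_sets k)"
proof -
  interpret colored: linorder "\<lambda>x y. colored_less x y \<or> x = y" colored_less
    by unfold_locales (auto simp: colored_less_def prod_eq_iff)
  have row: "frobenius_row k xs \<longleftrightarrow> snd ` set xs \<subseteq> {1..k} \<and> sorted_wrt colored_less (rev xs)" for xs
    by (simp add: frobenius_row_def sorted_wrt_rev)
  show ?thesis
    unfolding bij_betw_def
  proof
    show "inj_on set {xs. frobenius_row k xs}"
    proof (rule inj_onI)
      fix xs ys assume "xs \<in> {xs. frobenius_row k xs}" "ys \<in> {xs. frobenius_row k xs}" "set xs = set ys"
      then have "rev xs = rev ys" by (intro colored.strict_sorted_equal) (auto simp: row)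
      then show "xs = ys" by simp
    qed
    show "set ` {xs. frobenius_row k xs} = finite_colored_sets k"
    proof safe
      fix xs assume "frobenius_row k xs"
      then show "set xs \<in> finite_colored_sets k"
        by (force simp: frobenius_row_def finite_colored_sets_def)
    next
      fix A assume A: "A \<in> finite_colored_sets k"
      define xs where "xs = rev (colored.sorted_list_of_set A)"
      have fin: "finite A" using A by (simp add: finite_colored_sets_def)
      have "set xs = A" unfolding xs_def by (simp add: colored.set_sorted_list_of_set fin)
      moreover have "frobenius_row k xs" 
        using A by (auto simp: row \<open>set xs = A\<close> finite_colored_sets_def)
          (simp add: xs_def colored.strict_sorted_list_of_set)
      ultimately show "A \<in> set ` {xs. frobenius_row k xs}" by blast
    qed
  qed
qed

lemma distinct_frobenius_row: "frobenius_row k xs \<Longrightarrow> distinct xs"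
  unfolding frobenius_row_def by (induction xs) (auto simp: colored_less_def)

lemma bij_betw_frobenius_partitions_charge_pairs:
  "bij_betw (map_prod set set) (frobenius_partitions k n) {P \<in> charge_pairs k 0. pair_weight P = n}"
proof -
  let ?R = "{xs. frobenius_row k xs}"
  have "bij_betw (map_prod set set) (?R \<times> ?R) (finite_colored_sets k \<times> finite_colored_sets k)"
    by (intro bij_betw_map_prod bij_betw_set_frobenius_row)
  then have "bij_betw (map_prod set set) {F \<in> ?R \<times> ?R. frobenius_weight F = n \<and> length (fst F) = length (snd F)}
     {P \<in> finite_colored_sets k \<times> finite_colored_sets k. pair_weight P = n \<and> card (fst P) = card (snd P)}"
  proof (rule bij_betw_Collect)
    fix F assume "F \<in> ?R \<times> ?R"
    then have "distinct (fst F)" "distinct (snd F)" by (auto intro: distinct_frobenius_row)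
    then show "(pair_weight (map_prod set set F) = n \<and> card (fst (map_prod set set F)) = card (snd (map_prod set set F)))
       = (frobenius_weight F = n \<and> length (fst F) = length (snd F))"
      by (auto simp: pair_weight_def frobenius_weight_def distinct_card sum_Suc sum_list_distinct_conv_sum_set)
  qed
  moreover have "{F \<in> ?R \<times> ?R. frobenius_weight F = n \<and> length (fst F) = length (snd F)} = frobenius_partitions k n"
    by (auto simp: frobenius_partitions_def frobenius_symbol_def)
  moreover have "{P \<in> finite_colored_sets k \<times> finite_colored_sets k. pair_weight P = n \<and> card (fst P) = card (snd P)}
     = {P \<in> charge_pairs k 0. pair_weight P = n}"
    by (auto simp: charge_pairs_def)
  ultimately show ?thesis by simp
qed

lemma sums_cphi:
  assumes q: "norm q < 1"
  shows "(\<lambda>n. of_nat (cphi k n) * q ^ n) sums charge_coeff k q 0"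
proof -
  let ?B = "\<lambda>n. {P \<in> charge_pairs k 0. pair_weight P = n}"
  have "((\<lambda>n. of_nat (cphi k n) * q ^ n) has_sum charge_coeff k q 0) UNIV"
  proof (rule has_sum_SigmaD)
    have "bij_betw snd (Sigma UNIV ?B) (charge_pairs k 0)"
      by (rule bij_betwI[where g = "\<lambda>P. (pair_weight P, P)"]) auto
    from has_sum_reindex_bij_betw[OF this, of "\<lambda>P. q ^ pair_weight P"] has_sum_charge_pairs[OF q, of k 0]
    show "((\<lambda>x. q ^ pair_weight (snd x)) has_sum charge_coeff k q 0) (Sigma UNIV ?B)" by simp
    fix n
    have "finite (?B n)" "card (?B n) = cphi k n"
      using bij_betw_frobenius_partitions_charge_pairs[of k n] finite_frobenius_partitions[of k n]
      by (simp_all add: bij_betw_finite bij_betw_same_card cphi_def)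
    then show "((\<lambda>P. q ^ pair_weight (snd (n, P))) has_sum of_nat (cphi k n) * q ^ n) (?B n)"
      by (intro has_sum_finiteI) auto
  qed
  then show ?thesis by (rule has_sum_imp_sums)
qed

section \<open>Filtering and uniqueness of Laurent coefficients\<close>

lemma summable_on_finite_tail:
  fixes f :: "'a \<Rightarrow> real"
  assumes f: "f summable_on A" and e: "e > 0"
  obtains F where "finite F" "F \<subseteq> A" "infsum f (A - F) < e"
proof -
  obtain F where F: "finite F" "F \<subseteq> A" "dist (sum f F) (infsum f A) \<le> e / 2"
    using infsum_finite_approximation[OF f, of "e / 2"] e by auto
  have "infsum f (A - F) = infsum f A - sum f F"
    using F f by (subst infsum_Diff) auto
  moreover have "infsum f A - sum f F \<le> e / 2"
    using F(3) unfolding dist_real_def by linarith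
  ultimately show ?thesis using that[of F] F e by simp
qed

lemma sum_roots_of_unity:
  fixes j :: int
  assumes "M > 0"
  shows "(\<Sum>k<M. (cis (2 * pi / M) ^ k) powi j) = (if int M dvd j then of_nat M else 0)"
proof -
  define x where "x = cis (2 * pi / M) powi j"
  have x: "x = exp (2 * pi * \<i> * (of_int j / of_nat M))"
    unfolding x_def cis_power_int by (simp add: cis_conv_exp mult_ac)
  have pow: "(cis (2 * pi / M) ^ k) powi j = x ^ k" for k
    unfolding x_def by (metis power_int_of_nat power_int_mult mult.commute)
  have x1: "x = 1 \<longleftrightarrow> int M dvd j"
  proof -
    have "x = 1 \<longleftrightarrow> (\<exists>n::int. 2 * pi * (of_int j / of_nat M) = of_int (2 * n) * pi)"
      unfolding x by (subst exp_eq_1) simp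
    also have "\<dots> \<longleftrightarrow> (\<exists>n::int. real_of_int j = of_int (n * int M))"
      using assms by (simp add: field_simps)
    also have "\<dots> \<longleftrightarrow> int M dvd j"
      unfolding of_int_eq_iff by (auto simp: dvd_def mult.commute)
    finally show ?thesis .
  qed
  have xM: "x ^ M = 1"
    unfolding x using assms by (simp add: exp_of_nat_mult[symmetric] exp_eq_1)
  show ?thesis
  proof (cases "int M dvd j")
    case True
    then show ?thesis using x1 by (simp add: pow)
  next
    case False
    then have "x \<noteq> 1" using x1 by simp
    then show ?thesis using False xM by (simp add: pow geometric_sum)
  qed
qed

lemma has_sum_sum_finite:
  fixes f :: "'i \<Rightarrow> 'a \<Rightarrow> complex"
  assumes "finite I" "\<And>i. i \<in> I \<Longrightarrow> (f i has_sum s i) A"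
  shows "((\<lambda>x. \<Sum>i\<in>I. f i x) has_sum (\<Sum>i\<in>I. s i)) A"
  using assms by (induction I rule: finite_induct) (auto intro: has_sum_add)

text \<open>Summing over the \<open>M\<close>-th roots of unity kills all exponents not divisible by
  \<open>M\<close>. A large \<open>M\<close> isolates a single coefficient; \<open>M = 5\<close> is
  applied to the fifth power of the product.\<close>

lemma laurent_coeff_filter:
  assumes M: "M > 0" and a: "\<And>k. k < M \<Longrightarrow> ((\<lambda>n. a n * (cis (2 * pi / M) ^ k * t) powi n) has_sum s k) UNIV"
  shows "((\<lambda>n. if int M dvd n then of_nat M * (a n * t powi n) else 0) has_sum (\<Sum>k<M. s k)) UNIV"
proof -
  have "((\<lambda>n. \<Sum>k<M. a n * (cis (2 * pi / M) ^ k * t) powi n) has_sum (\<Sum>k<M. s k)) UNIV"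
    using a by (intro has_sum_sum_finite) auto
  moreover have "(\<Sum>k<M. a n * (cis (2 * pi / M) ^ k * t) powi n)
     = (if int M dvd n then of_nat M * (a n * t powi n) else 0)" for n
  proof -
    have "(\<Sum>k<M. a n * (cis (2 * pi / M) ^ k * t) powi n)
       = (\<Sum>k<M. (cis (2 * pi / M) ^ k) powi n) * (a n * t powi n)"
      by (simp add: power_int_mult_distrib sum_distrib_right sum_distrib_left mult_ac)
    then show ?thesis using sum_roots_of_unity[OF M, of n] by simp
  qed
  ultimately show ?thesis by simp
qed

text \<open>A discrete substitute for the Cauchy integral: after averaging over \<open>M\<close>-th
  roots of unity only exponents congruent to \<open>m\<close> modulo \<open>M\<close> remain, and
  for large \<open>M\<close> all of them except \<open>m\<close> lie in a tail of small absolute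
  sum.\<close>

lemma laurent_coeff_eq_0:
  fixes a :: "int \<Rightarrow> complex"
  assumes a: "\<And>t. norm t = 1 \<Longrightarrow> ((\<lambda>n. a n * t powi n) has_sum 0) UNIV"
  shows "a m = 0"
proof -
  have summ: "(\<lambda>n. norm (a n)) summable_on UNIV"
    using has_sum_imp_summable[OF a[of 1]] by (simp add: summable_on_iff_abs_summable_on_complex)
  have "norm (a m) < e" if e: "e > 0" for e
  proof -
    obtain F where F: "finite F" "F \<subseteq> UNIV" "infsum (\<lambda>n. norm (a n)) (UNIV - F) < e"
      by (rule summable_on_finite_tail[OF summ e])
    \<comment> \<open>\<open>M\<close> exceeds the distance from \<open>m\<close> to each exponent
      in \<open>F\<close>, so no other exponent in \<open>F\<close> is congruent to \<open>m\<close>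
      modulo \<open>M\<close>.\<close>
    define M where "M = Suc (nat (\<Sum>n\<in>F. \<bar>n - m\<bar>))"
    have M: "\<not> int M dvd (n - m)" if "n \<in> F" "n \<noteq> m" for n
    proof
      assume "int M dvd n - m"
      then have "int M \<le> \<bar>n - m\<bar>" using that dvd_imp_le_int[of "n - m" "int M"] by simp
      moreover have "\<bar>n - m\<bar> \<le> (\<Sum>n\<in>F. \<bar>n - m\<bar>)" using that F by (intro member_le_sum) auto
      ultimately show False by (simp add: M_def)
    qed
    have Mnz: "(of_nat M :: complex) \<noteq> 0" by (simp add: M_def del: of_nat_Suc)
    define b where "b n = a (n + m)" for n
    have "((\<lambda>n. if int M dvd n then of_nat M * (b n * 1 powi n) else 0) has_sum (\<Sum>k<M. 0)) UNIV"
    proof (rule laurent_coeff_filter)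
      fix k
      let ?t = "cis (2 * pi / M) ^ k * 1"
      have t: "norm ?t = 1" by (simp add: norm_power)
      have "((\<lambda>n. a n * ?t powi n) has_sum 0) UNIV" by (rule a[OF t])
      then have "((\<lambda>n. a (n + m) * ?t powi (n + m)) has_sum 0) UNIV"
        by (subst has_sum_reindex_bij_witness[where i = "\<lambda>n. n - m" and j = "\<lambda>n. n + m"
              and h = "\<lambda>n. a n * ?t powi n"]) auto
      from has_sum_cmult_right[OF this, of "?t powi (- m)"] t
      show "((\<lambda>n. b n * ?t powi n) has_sum 0) UNIV"
        by (simp add: b_def power_int_add power_int_minus field_simps)
    qed (simp add: M_def)
    from has_sum_cmult_right[OF this, of "inverse (of_nat M)"]
    have "((\<lambda>n. inverse (of_nat M) * (if int M dvd n then of_nat M * b n else 0)) has_sum 0) UNIV"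
      by (simp cong: if_cong)
    moreover have "inverse (of_nat M) * (if int M dvd n then of_nat M * b n else 0)
        = (if int M dvd n then b n else 0)" for n
      using Mnz by simp
    ultimately have "((\<lambda>n. if int M dvd n then b n else 0) has_sum 0) UNIV" by simp
    then have "((\<lambda>n. if int M dvd (n - m) then a n else 0) has_sum 0) UNIV"
      by (subst has_sum_reindex_bij_witness[where i = "\<lambda>n. n + m" and j = "\<lambda>n. n - m"
              and h = "\<lambda>n. if int M dvd n then b n else 0"]) (auto simp: b_def)
    moreover have "((\<lambda>n. if int M dvd (n - m) then a n else 0) has_sum a m) {m}"
      by (intro has_sum_finiteI) auto
    ultimately have "((\<lambda>n. if int M dvd (n - m) then a n else 0) has_sum (0 - a m)) (UNIV - {m})"
      by (rule has_sum_Diff) simp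
    then have "((\<lambda>n. if int M dvd (n - m) then a n else 0) has_sum (- a m)) (UNIV - F - {m})"
      by (subst has_sum_cong_neutral[where g = "\<lambda>n. if int M dvd (n - m) then a n else 0" and T = "UNIV - {m}"])
       (use M in auto)
    moreover have "((\<lambda>n. norm (a n)) has_sum infsum (\<lambda>n. norm (a n)) (UNIV - F - {m})) (UNIV - F - {m})"
      by (intro has_sum_infsum summable_on_subset[OF summ]) auto
    ultimately have "norm (- a m) \<le> infsum (\<lambda>n. norm (a n)) (UNIV - F - {m})"
      by (rule norm_infsum_le) auto
    also have "\<dots> \<le> infsum (\<lambda>n. norm (a n)) (UNIV - F)"
      by (intro infsum_mono2 summable_on_subset[OF summ]) auto
    finally show ?thesis using F by simp
  qed
  then show ?thesis by (metis less_irrefl zero_less_norm_iff)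
qed

subsection \<open>Infinite products and the partition generating function\<close>

lemma qpoch_inf_LIMSEQ:
  assumes "norm q < 1"
  shows "(\<lambda>N. \<Prod>j<N. 1 - a * q ^ j) \<longlonglongrightarrow> qpoch_inf a q"
  unfolding qpoch_inf_def
  by (subst LIMSEQ_lessThan_iff_atMost)
    (rule convergent_prod_LIMSEQ[OF convergent_prod_qpoch_inf[OF assms]])

lemma qpoch_inf_step:
  assumes "norm q < 1"
  shows "qpoch_inf a q = (1 - a) * qpoch_inf (a * q) q"
proof (rule LIMSEQ_unique)
  show "(\<lambda>N. \<Prod>j<Suc N. 1 - a * q ^ j) \<longlonglongrightarrow> qpoch_inf a q"
    by (rule LIMSEQ_Suc[OF qpoch_inf_LIMSEQ[OF assms]])
  have "(\<lambda>N. (1 - a) * (\<Prod>j<N. 1 - (a * q) * q ^ j)) \<longlonglongrightarrow> (1 - a) * qpoch_inf (a * q) q"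
    by (intro tendsto_mult_left qpoch_inf_LIMSEQ[OF assms])
  then show "(\<lambda>N. \<Prod>j<Suc N. 1 - a * q ^ j) \<longlonglongrightarrow> (1 - a) * qpoch_inf (a * q) q"
    by (simp only: prod.lessThan_Suc_shift) (simp add: mult.assoc)
qed

lemma qpoch_inf_nonzero:
  assumes "norm q < 1" "\<And>j. a * q ^ j \<noteq> 1"
  shows "qpoch_inf a q \<noteq> 0"
  unfolding qpoch_inf_def
  by (rule prodinf_nonzero[OF convergent_prod_qpoch_inf[OF assms(1)]]) (use assms(2) in auto)

lemma qpoch_inf_nonzero':
  assumes "norm q < 1" "norm a < 1"
  shows "qpoch_inf a q \<noteq> 0"
proof (rule qpoch_inf_nonzero[OF assms(1)])
  fix j
  have "norm (a * q ^ j) \<le> norm a * 1"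
    unfolding norm_mult norm_power using assms by (intro mult_left_mono power_le_one) auto
  then show "a * q ^ j \<noteq> 1" using assms by auto
qed

lemma norm_power_less_one:
  fixes q :: complex
  assumes "norm q < 1" "m > 0"
  shows "norm (q ^ m) < 1"
  using assms power_less_one_iff[of "norm q" m] by (simp add: norm_power)

lemma qpoch_inf_split:
  assumes q: "norm q < 1" and m: "m > 0"
  shows "qpoch_inf a q = (\<Prod>r<m. qpoch_inf (a * q ^ r) (q ^ m))"
proof (rule LIMSEQ_unique)
  have "filterlim (\<lambda>N. N * m) at_top sequentially"
    using m by (intro filterlim_at_top_mono[OF filterlim_ident]) auto
  from filterlim_compose[OF qpoch_inf_LIMSEQ[OF q] this]
  show "(\<lambda>N. \<Prod>j<N * m. 1 - a * q ^ j) \<longlonglongrightarrow> qpoch_inf a q" .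
  have "(\<Prod>j<N * m. 1 - a * q ^ j) = (\<Prod>r<m. \<Prod>n<N. 1 - (a * q ^ r) * (q ^ m) ^ n)" for N
  proof -
    have "(\<Prod>j<N * m. 1 - a * q ^ j) = (\<Prod>n<N. \<Prod>j=n*m..<n*m+m. 1 - a * q ^ j)"
      by (rule prod.nat_group[symmetric])
    also have "\<dots> = (\<Prod>n<N. \<Prod>r<m. 1 - (a * q ^ r) * (q ^ m) ^ n)"
    proof (rule prod.cong[OF refl])
      fix n
      have "(\<Prod>j=0+n*m..<m+n*m. 1 - a * q ^ j) = (\<Prod>r=0..<m. 1 - a * q ^ (r + n * m))"
        by (rule prod.shift_bounds_nat_ivl)
      then show "(\<Prod>j=n*m..<n*m+m. 1 - a * q ^ j) = (\<Prod>r<m. 1 - (a * q ^ r) * (q ^ m) ^ n)"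
        by (simp add: add.commute atLeast0LessThan power_add power_mult mult_ac)
    qed
    also have "\<dots> = (\<Prod>r<m. \<Prod>n<N. 1 - (a * q ^ r) * (q ^ m) ^ n)"
      by (rule prod.swap)
    finally show ?thesis .
  qed
  then show "(\<lambda>N. \<Prod>j<N * m. 1 - a * q ^ j) \<longlonglongrightarrow> (\<Prod>r<m. qpoch_inf (a * q ^ r) (q ^ m))"
    by (simp only:) (intro tendsto_prod qpoch_inf_LIMSEQ norm_power_less_one q m)
qed

text \<open>The numbers \<open>c r\<close> stand for the \<open>m\<close>-th roots of unity, and the
  factorization of \<open>1 - x ^ m\<close> is applied factor by factor. It is used with signs for
  \<open>m = 2\<close> and with powers of \<open>zeta5\<close> for \<open>m = 5\<close>.\<close>

lemma qpoch_inf_prod_eq: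
  assumes q: "norm q < 1" and m: "m > 0" and c: "\<And>x. (\<Prod>r<n. 1 - c r * x) = 1 - x ^ m"
  shows "(\<Prod>r<n. qpoch_inf (c r * a) q) = qpoch_inf (a ^ m) (q ^ m)"
proof (rule LIMSEQ_unique)
  show "(\<lambda>N. \<Prod>r<n. \<Prod>j<N. 1 - (c r * a) * q ^ j) \<longlonglongrightarrow> (\<Prod>r<n. qpoch_inf (c r * a) q)"
    by (intro tendsto_prod qpoch_inf_LIMSEQ q)
  have "(\<Prod>r<n. \<Prod>j<N. 1 - (c r * a) * q ^ j) = (\<Prod>j<N. 1 - a ^ m * (q ^ m) ^ j)" for N
    by (subst prod.swap)
      (simp add: mult.assoc c power_mult_distrib flip: power_mult, simp add: mult.commute)
  then show "(\<lambda>N. \<Prod>r<n. \<Prod>j<N. 1 - (c r * a) * q ^ j) \<longlonglongrightarrow> qpoch_inf (a ^ m) (q ^ m)"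
    by (simp only:) (intro qpoch_inf_LIMSEQ norm_power_less_one q m)
qed

section \<open>Generating function of the partition numbers\<close>

lemma has_sum_geometric_complex:
  fixes x :: complex
  assumes "norm x < 1"
  shows "((\<lambda>n. x ^ n) has_sum (1 / (1 - x))) UNIV"
  using assms by (intro norm_summable_imp_has_sum geometric_sums)
    (auto simp: norm_power intro: summable_geometric)

text \<open>Euler's argument, one part size at a time: the multiplicity of the new part
  \<open>i\<close> is independent of the rest and contributes a geometric series.\<close>

lemma has_sum_multisets:
  fixes q :: complex
  assumes q: "norm q < 1" and "finite I" "0 \<notin> I"
  shows "((\<lambda>P. q ^ sum_mset P) has_sum (\<Prod>i\<in>I. 1 / (1 - q ^ i))) {P. set_mset P \<subseteq> I}"
  using assms(2,3)
proof (induction I rule: finite_induct)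
  case empty
  then show ?case by (intro has_sum_finiteI) auto
next
  case (insert i I)
  then have IH: "((\<lambda>P. q ^ sum_mset P) has_sum (\<Prod>i\<in>I. 1 / (1 - q ^ i))) {P. set_mset P \<subseteq> I}"
    and i: "i > 0" by auto
  have "norm (q ^ i) < 1" using q i by (rule norm_power_less_one)
  from has_sum_product[OF has_sum_geometric_complex[OF this] IH]
  have "((\<lambda>(n, P). (q ^ i) ^ n * q ^ sum_mset P) has_sum
      (1 / (1 - q ^ i) * (\<Prod>i\<in>I. 1 / (1 - q ^ i)))) (UNIV \<times> {P. set_mset P \<subseteq> I})" .
  moreover have "bij_betw (\<lambda>(n, P). replicate_mset n i + P) (UNIV \<times> {P. set_mset P \<subseteq> I})
     {P. set_mset P \<subseteq> insert i I}"
  proof (rule bij_betwI[where g = "\<lambda>P. (count P i, filter_mset (\<lambda>j. j \<noteq> i) P)"])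
    show "(\<lambda>(n, P). replicate_mset n i + P) \<in> UNIV \<times> {P. set_mset P \<subseteq> I} \<rightarrow> {P. set_mset P \<subseteq> insert i I}"
      by (auto split: if_splits)
    show "(\<lambda>P. (count P i, filter_mset (\<lambda>j. j \<noteq> i) P)) \<in> {P. set_mset P \<subseteq> insert i I} \<rightarrow> UNIV \<times> {P. set_mset P \<subseteq> I}"
      by auto
  next
    fix x :: "nat \<times> nat multiset" assume "x \<in> UNIV \<times> {P. set_mset P \<subseteq> I}"
    then obtain n P where x: "x = (n, P)" "set_mset P \<subseteq> I" by auto
    then have "count P i = 0" "i \<notin># P" using insert.hyps by (auto simp: count_eq_zero_iff)
    then have "filter_mset (\<lambda>j. j \<noteq> i) P = P" by (auto simp: filter_mset_eq_conv)
    moreover have "filter_mset (\<lambda>j. j \<noteq> i) (replicate_mset n i) = {#}"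
      by (induction n) auto
    ultimately show "(\<lambda>P. (count P i, filter_mset (\<lambda>j. j \<noteq> i) P)) ((\<lambda>(n, P). replicate_mset n i + P) x) = x"
      using \<open>count P i = 0\<close> x by simp
  next
    fix P
    show "(\<lambda>(n, P). replicate_mset n i + P) (count P i, filter_mset (\<lambda>j. j \<noteq> i) P) = P"
      by (rule multiset_eqI) auto
  qed
  moreover have "(\<lambda>(n, P). (q ^ i) ^ n * q ^ sum_mset P)
      = (\<lambda>x. q ^ sum_mset ((\<lambda>(n, P). replicate_mset n i + P) x))"
    by (auto simp: fun_eq_iff power_add sum_mset_replicate_mset mult.commute simp flip: power_mult)
  ultimately have "((\<lambda>P. q ^ sum_mset P) has_sum (1 / (1 - q ^ i) * (\<Prod>i\<in>I. 1 / (1 - q ^ i))))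
      {P. set_mset P \<subseteq> insert i I}"
    using has_sum_reindex_bij_betw[where f = "\<lambda>P. q ^ sum_mset P"] by metis
  then show ?case using insert by simp
qed

text \<open>Bounding the parts by \<open>N\<close> leaves a finite product. Absolute summability
  over all multisets comes from the same finite products at the real point \<open>norm q\<close>,
  which stay away from 0.\<close>

lemma partition_number_sums:
  assumes q: "norm q < 1"
  shows "(\<lambda>n. of_nat (partition_number n) * q ^ n) sums (1 / qpoch_inf q q)"
proof -
  let ?S = "{P. 0 \<notin># P} :: nat multiset set"
  let ?f = "\<lambda>P. q ^ sum_mset P"
  define S where "S N = {P. set_mset P \<subseteq> {1..N}}" for N :: nat
  define r where "r = norm q"
  have r: "0 \<le> r" "r < 1" using q by (auto simp: r_def)
  have S: "S N \<subseteq> ?S" for N by (auto simp: S_def)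
  have prodS: "((\<lambda>P. x ^ sum_mset P) has_sum (1 / (\<Prod>j<N. 1 - x * x ^ j))) (S N)" if "norm x < 1" for x :: complex and N
  proof -
    have "(\<Prod>i\<in>{1..N}. 1 / (1 - x ^ i)) = 1 / (\<Prod>j<N. 1 - x * x ^ j)"
      unfolding prod_dividef by (simp add: prod.atLeast1_atMost_eq)
    then show ?thesis using has_sum_multisets[OF that, of "{1..N}"] by (simp add: S_def)
  qed
  have ex: "\<exists>N. F \<subseteq> S N" if "finite F" "F \<subseteq> ?S" for F
  proof -
    define N where "N = (\<Sum>P\<in>F. sum_mset P)"
    have "i \<in> {1..N}" if P: "P \<in> F" "i \<in># P" for P i
    proof -
      have "P \<in> ?S" using P(1) \<open>F \<subseteq> ?S\<close> by (rule rev_subsetD)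
      then have "i \<noteq> 0" using P(2) by (intro notI) simp
      moreover have "i \<le> sum_mset P" using multi_member_split[OF P(2)] by auto
      moreover have "sum_mset P \<le> N" unfolding N_def using P \<open>finite F\<close> by (intro member_le_sum) auto
      ultimately show ?thesis by simp
    qed
    then have "F \<subseteq> S N" unfolding S_def by blast
    then show ?thesis ..
  qed
  \<comment> \<open>The real products decrease to the norm of \<open>qpoch_inf\<close> at
    \<open>norm q\<close>. This limit is nonzero and serves as \<open>c\<close>.\<close>
  obtain c where c: "c > 0" "\<And>N. c \<le> norm (\<Prod>j<N. 1 - complex_of_real r * of_real r ^ j)"
  proof -
    have nz: "qpoch_inf (of_real r) (of_real r) \<noteq> 0"
      using r by (intro qpoch_inf_nonzero') auto
    have pos: "0 < (\<Prod>j<N. 1 - r * r ^ j)" for N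
    proof (intro prod_pos)
      fix j
      have "r ^ Suc j < 1" using r by (subst power_less_one_iff) auto
      then show "0 < 1 - r * r ^ j" by simp
    qed
    have eq: "norm (\<Prod>j<N. 1 - complex_of_real r * of_real r ^ j) = (\<Prod>j<N. 1 - r * r ^ j)" for N
    proof -
      have "(\<Prod>j<N. 1 - complex_of_real r * of_real r ^ j) = of_real (\<Prod>j<N. 1 - r * r ^ j)" by simp
      then show ?thesis using pos[of N] by (simp only: norm_of_real)
    qed
    have "decseq (\<lambda>N. \<Prod>j<N. 1 - r * r ^ j)"
    proof (rule decseq_SucI)
      fix N
      have "(\<Prod>j<N. 1 - r * r ^ j) * (1 - r * r ^ N) \<le> (\<Prod>j<N. 1 - r * r ^ j) * 1"
        using pos[of N] r by (intro mult_left_mono) auto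
      then show "(\<Prod>j<Suc N. 1 - r * r ^ j) \<le> (\<Prod>j<N. 1 - r * r ^ j)" by simp
    qed
    moreover have "(\<lambda>N. \<Prod>j<N. 1 - r * r ^ j) \<longlonglongrightarrow> norm (qpoch_inf (complex_of_real r) (of_real r))"
      unfolding eq[symmetric] using r by (intro tendsto_norm qpoch_inf_LIMSEQ) auto
    ultimately have "norm (qpoch_inf (complex_of_real r) (of_real r)) \<le> (\<Prod>j<N. 1 - r * r ^ j)" for N
      by (rule decseq_ge)
    then show ?thesis using that[of "norm (qpoch_inf (complex_of_real r) (of_real r))"] nz eq by simp
  qed
  have summ: "(\<lambda>P. norm (?f P)) summable_on ?S"
    unfolding abs_summable_iff_bdd_above
  proof (rule bdd_aboveI2)
    fix F assume "F \<in> {F. F \<subseteq> ?S \<and> finite F}"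
    then have F: "finite F" "F \<subseteq> ?S" by auto
    from ex[OF F] obtain N where N: "F \<subseteq> S N" ..
    have "((\<lambda>P. complex_of_real r ^ sum_mset P) has_sum (1 / (\<Prod>j<N. 1 - of_real r * of_real r ^ j))) (S N)"
      using r by (intro prodS) auto
    from has_sum_Re[OF this]
    have "((\<lambda>P. r ^ sum_mset P) has_sum Re (1 / (\<Prod>j<N. 1 - of_real r * of_real r ^ j))) (S N)"
      by (simp flip: of_real_power)
    then have "(\<Sum>P\<in>F. r ^ sum_mset P) \<le> Re (1 / (\<Prod>j<N. 1 - of_real r * of_real r ^ j))"
      by (rule finite_sum_le_has_sum) (use N F r in auto)
    also have "\<dots> \<le> norm (1 / (\<Prod>j<N. 1 - complex_of_real r * of_real r ^ j))"
      by (rule complex_Re_le_cmod)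
    also have "\<dots> \<le> 1 / c"
      using c(1) c(2)[of N] by (simp add: norm_divide frac_le)
    finally show "(\<Sum>P\<in>F. norm (?f P)) \<le> 1 / c" by (simp add: norm_power r_def)
  qed
  then have summ': "?f summable_on ?S" by (rule abs_summable_summable)
  have "(\<lambda>N. 1 / (\<Prod>j<N. 1 - q * q ^ j)) \<longlonglongrightarrow> infsum ?f ?S"
  proof (rule LIMSEQ_I)
    fix e :: real assume e: "e > 0"
    obtain F where F: "finite F" "F \<subseteq> ?S" "infsum (\<lambda>P. norm (?f P)) (?S - F) < e"
      by (rule summable_on_finite_tail[OF summ e])
    from ex[OF F(1,2)] obtain N where N: "F \<subseteq> S N" ..
    have "norm (1 / (\<Prod>j<n. 1 - q * q ^ j) - infsum ?f ?S) < e" if "n \<ge> N" for n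
    proof -
      have "S N \<subseteq> S n" using that by (auto simp: S_def)
      with N have "F \<subseteq> S n" by (rule subset_trans)
      have sm: "?f summable_on S n" "(\<lambda>P. norm (?f P)) summable_on ?S - S n"
        "(\<lambda>P. norm (?f P)) summable_on ?S - F"
        by (rule summable_on_subset[OF summ' S])
           (rule summable_on_subset[OF summ], rule Diff_subset)+
      have "infsum ?f ?S - 1 / (\<Prod>j<n. 1 - q * q ^ j) = infsum ?f (?S - S n)"
        using infsum_Diff[OF summ' sm(1) S] infsumI[OF prodS[OF q, of n]] by simp
      then have "norm (1 / (\<Prod>j<n. 1 - q * q ^ j) - infsum ?f ?S) = norm (infsum ?f (?S - S n))"
        by (metis norm_minus_commute)
      also have "\<dots> \<le> infsum (\<lambda>P. norm (?f P)) (?S - S n)"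
        by (rule norm_infsum_bound[OF sm(2)])
      also have "\<dots> \<le> infsum (\<lambda>P. norm (?f P)) (?S - F)"
        using \<open>F \<subseteq> S n\<close> by (intro infsum_mono2 sm) auto
      finally show ?thesis using F by simp
    qed
    then show "\<exists>N. \<forall>n\<ge>N. norm (1 / (\<Prod>j<n. 1 - q * q ^ j) - infsum ?f ?S) < e" by blast
  qed
  moreover have "(\<lambda>N. 1 / (\<Prod>j<N. 1 - q * q ^ j)) \<longlonglongrightarrow> 1 / qpoch_inf q q"
    using q by (intro tendsto_divide tendsto_const qpoch_inf_LIMSEQ qpoch_inf_nonzero')
  ultimately have "infsum ?f ?S = 1 / qpoch_inf q q" by (rule LIMSEQ_unique)
  with summ' have total: "(?f has_sum (1 / qpoch_inf q q)) ?S"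
    using has_sum_infsum[OF summ'] by simp
  have "((\<lambda>n. of_nat (partition_number n) * q ^ n) has_sum (1 / qpoch_inf q q)) UNIV"
  proof (rule has_sum_SigmaD)
    have "bij_betw snd (Sigma UNIV partitions) ?S"
      by (rule bij_betwI[where g = "\<lambda>P. (sum_mset P, P)"]) (auto simp: partitions_def)
    from has_sum_reindex_bij_betw[OF this, of ?f] total
    show "((\<lambda>x. ?f (snd x)) has_sum (1 / qpoch_inf q q)) (Sigma UNIV partitions)" by simp
    fix n
    show "((\<lambda>P. ?f (snd (n, P))) has_sum of_nat (partition_number n) * q ^ n) (partitions n)"
      using finite_partitions[of n]
      by (intro has_sum_finiteI) (auto simp: partition_number_def partitions_def)
  qed
  then show ?thesis by (rule has_sum_imp_sums)
qed

subsection \<open>The Jacobi triple product\<close>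

text \<open>The product side of the triple product without its factor \<open>qpoch_inf q q\<close>.
  For \<open>0 < norm q < 1\<close> its zeros in \<open>t \<noteq> 0\<close> are the integer powers
  of \<open>q\<close>, in particular \<open>t = 1\<close>.\<close>

definition jacobi_prod :: "complex \<Rightarrow> complex \<Rightarrow> complex" where
  "jacobi_prod q t = qpoch_inf (t * q) q * qpoch_inf (1 / t) q"

lemma jacobi_prod_shift:
  assumes q: "norm q < 1" "q \<noteq> 0" and t: "t \<noteq> 0"
  shows "jacobi_prod q (q * t) * (q * t) = - jacobi_prod q t"
proof -
  have 1: "qpoch_inf (t * q) q = (1 - t * q) * qpoch_inf (q * t * q) q"
    using qpoch_inf_step[OF q(1), of "t * q"] by (simp add: mult_ac)
  have 2: "qpoch_inf (1 / (q * t)) q = (1 - 1 / (q * t)) * qpoch_inf (1 / t) q"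
    using qpoch_inf_step[OF q(1), of "1 / (q * t)"] q by simp
  show ?thesis unfolding jacobi_prod_def 1 2 using q t by (simp add: field_simps)
qed

lemma has_sum_charge_coeff_jacobi_prod:
  assumes "norm q < 1" "z \<noteq> 0"
  shows "((\<lambda>n. charge_coeff k q n * z powi n) has_sum jacobi_prod q (- z) ^ k) UNIV"
  using has_sum_charge_coeff[OF assms, of k] by (simp add: jacobi_prod_def)

text \<open>By \<open>jacobi_prod_shift\<close> the \<open>k\<close>-th power of
  \<open>jacobi_prod q (- t)\<close> changes by a monomial under \<open>t \<mapsto> q * t\<close>.
  Equating the Laurent coefficients of the two expansions on the unit circle gives the
  recursion.\<close>

lemma charge_coeff_shift:
  assumes q: "norm q < 1" "q \<noteq> 0"
  shows "charge_coeff k q (n + int k) = q powi (n + int k) * charge_coeff k q n"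
proof -
  define a where "a n = charge_coeff k q n - q powi n * charge_coeff k q (n - int k)" for n
  have "a (n + int k) = 0"
  proof (rule laurent_coeff_eq_0)
    fix t :: complex assume "norm t = 1"
    then have t: "t \<noteq> 0" by auto
    let ?z = "q * t"
    have "((\<lambda>n. ?z ^ k * (charge_coeff k q n * ?z powi n)) has_sum (?z ^ k * jacobi_prod q (- ?z) ^ k)) UNIV"
      using q t by (intro has_sum_cmult_right has_sum_charge_coeff_jacobi_prod) auto
    also have "?z ^ k * jacobi_prod q (- ?z) ^ k = jacobi_prod q (- t) ^ k"
      using jacobi_prod_shift[OF q, of "- t"] t by (simp flip: power_mult_distrib add: mult.commute)
    also have "((\<lambda>n. ?z ^ k * (charge_coeff k q n * ?z powi n)) has_sum jacobi_prod q (- t) ^ k) UNIV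
       \<longleftrightarrow> ((\<lambda>n. charge_coeff k q (n - int k) * ?z powi n) has_sum jacobi_prod q (- t) ^ k) UNIV"
      using q t by (intro has_sum_reindex_bij_witness[where i = "\<lambda>n. n - int k" and j = "\<lambda>n. n + int k"])
         (auto simp: power_int_add)
    finally have "((\<lambda>n. charge_coeff k q n * t powi n + - (charge_coeff k q (n - int k) * ?z powi n)) has_sum
       (jacobi_prod q (- t) ^ k + - (jacobi_prod q (- t) ^ k))) UNIV"
      using q t by (intro has_sum_add has_sum_charge_coeff_jacobi_prod) (auto simp: has_sum_uminus)
    then show "((\<lambda>n. a n * t powi n) has_sum 0) UNIV"
      by (simp add: a_def algebra_simps power_int_mult_distrib)
  qed
  then show ?thesis by (simp add: a_def)
qed

text \<open>Step \<open>i\<close> of the recursion contributes the exponent \<open>k * i\<close>,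
  and these add up to \<open>k * m * (m + 1) / 2\<close>; for negative \<open>m\<close> the
  recursion is run downwards.\<close>

lemma charge_coeff_mult:
  assumes l: "Re l < 0"
  shows "charge_coeff k (exp l) (int k * m)
    = charge_coeff k (exp l) 0 * exp (of_nat k * l * of_int m * (of_int m + 1) / 2)"
proof -
  have q: "norm (exp l) < 1" "exp l \<noteq> 0" using l by auto
  have shift: "charge_coeff k (exp l) (int k * (m + 1))
      = exp (of_nat k * l * (of_int m + 1)) * charge_coeff k (exp l) (int k * m)" for m
    using charge_coeff_shift[OF q, of k "int k * m"]
    by (simp add: algebra_simps exp_power_int)
  show ?thesis
  proof (induction m rule: int_induct[where k = 0])
    case base
    show ?case by simp
  next
    case (step1 i)
    then show ?case
      unfolding shift by (simp add: mult_ac flip: exp_add) (simp add: field_simps)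
  next
    case (step2 i)
    have "exp (of_nat k * l * of_int i) * charge_coeff k (exp l) (int k * (i - 1))
      = charge_coeff k (exp l) (int k * i)"
      using shift[of "i - 1"] by simp
    also have "\<dots> = exp (of_nat k * l * of_int i) * (charge_coeff k (exp l) 0 *
      exp (of_nat k * l * of_int (i - 1) * (of_int (i - 1) + 1) / 2))"
      unfolding step2 by (simp add: mult_ac flip: exp_add) (simp add: field_simps)
    finally show ?case by simp
  qed
qed

section \<open>The constant in the triple product\<close>

lemma has_sum_jacobi_prod_aux:
  assumes l: "Re l < 0"
  shows "((\<lambda>n::int. charge_coeff 1 (exp l) 0 * exp (l * of_int n * (of_int n + 1) / 2 + of_int n * w))
    has_sum jacobi_prod (exp l) (- exp w)) UNIV"
proof -
  have "((\<lambda>n. charge_coeff 1 (exp l) n * exp w powi n) has_sum jacobi_prod (exp l) (- exp w) ^ 1) UNIV"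
    using l by (intro has_sum_charge_coeff_jacobi_prod) auto
  moreover have "charge_coeff 1 (exp l) n * exp w powi n
      = charge_coeff 1 (exp l) 0 * exp (l * of_int n * (of_int n + 1) / 2 + of_int n * w)" for n
    using charge_coeff_mult[OF l, of 1 n] by (simp add: exp_power_int exp_add)
  ultimately show ?thesis by simp
qed

text \<open>Odd indices are written as \<open>- 1 - 2 * m\<close>, not \<open>2 * m + 1\<close>,
  because \<open>n * (n + 1) / 2\<close> is invariant under \<open>n \<mapsto> - 1 - n\<close>; the
  two halves of a theta series then match termwise.\<close>

lemma has_sum_int_parity:
  fixes f :: "int \<Rightarrow> complex"
  assumes f: "(f has_sum s) UNIV"
    and e: "((\<lambda>m. f (2 * m)) has_sum s1) UNIV" and o: "((\<lambda>m. f (- 1 - 2 * m)) has_sum s2) UNIV"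
  shows "s = s1 + s2"
proof -
  have "(f has_sum s1) {n. even n}"
    using e by (subst has_sum_reindex_bij_witness[where i = "\<lambda>m. 2 * m" and j = "\<lambda>n. n div 2" and T = UNIV
        and h = "\<lambda>m. f (2 * m)"]) auto
  moreover have "(f has_sum s2) {n. odd n}"
    using o by (subst has_sum_reindex_bij_witness[where i = "\<lambda>m. - 1 - 2 * m" and j = "\<lambda>n. (- 1 - n) div 2" and T = UNIV
        and h = "\<lambda>m. f (- 1 - 2 * m)"]) (auto elim!: oddE)
  ultimately have "(f has_sum (s1 + s2)) ({n. even n} \<union> {n. odd n})"
    by (intro has_sum_Un_disjoint) auto
  moreover have "{n. even n} \<union> {n. odd n} = (UNIV :: int set)" by auto
  ultimately show ?thesis using f has_sum_unique by metis
qed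

text \<open>At the argument \<open>\<i>\<close> the even and the odd terms of the theta series of
  nome \<open>q\<close> both become the series of nome \<open>q ^ 4\<close> at \<open>1 / q\<close>,
  the odd ones with an extra factor \<open>\<i>\<close>. Comparing with the two products leaves an
  expression invariant under \<open>q \<mapsto> q ^ 4\<close>.\<close>

lemma charge_coeff_1_quadruple:
  assumes l: "Re l < 0"
  defines "q \<equiv> exp l"
  shows "charge_coeff 1 q 0 * qpoch_inf q q = charge_coeff 1 (q ^ 4) 0 * qpoch_inf (q ^ 4) (q ^ 4)"
proof -
  define G where "G q = charge_coeff 1 q 0" for q
  have q: "norm q < 1" "q \<noteq> 0" using l by (auto simp: q_def)
  have q4: "q ^ 4 = exp (4 * l)" by (simp add: q_def exp_of_nat_mult[symmetric])
  have q2: "norm (q ^ 2) < 1" "norm (q ^ 4) < 1" using q by (auto intro: norm_power_less_one)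
  define w where "w = - \<i> * pi / 2"
  have w: "exp w = - \<i>" by (simp add: w_def exp_eq_polar cis.ctr complex_eq_iff)
  \<comment> \<open>\<open>exp w'\<close> is \<open>- (1 / q)\<close>: in nome \<open>q ^ 4\<close>
    it lowers the exponent \<open>2 * m * (m + 1)\<close> of \<open>q\<close> to
    \<open>m * (2 * m + 1)\<close>, as in the even terms, and supplies their sign.\<close>
  define w' where "w' = - l + \<i> * pi"
  have w': "exp w' = - (1 / q)"
    by (simp add: w'_def q_def exp_diff)
  let ?f = "\<lambda>n::int. G q * exp (l * of_int n * (of_int n + 1) / 2 + of_int n * w)"
  let ?h = "\<lambda>m::int. exp (4 * l * of_int m * (of_int m + 1) / 2 + of_int m * w')"
  have f: "(?f has_sum jacobi_prod q \<i>) UNIV"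
    using has_sum_jacobi_prod_aux[OF l, of w] by (simp add: G_def q_def w)
  have h: "((\<lambda>m. G (q ^ 4) * ?h m) has_sum jacobi_prod (q ^ 4) (1 / q)) UNIV"
    using has_sum_jacobi_prod_aux[of "4 * l" w'] l by (simp add: G_def q4 w')
  have h_eq: "?h m = exp (l * of_int m * (2 * of_int m + 1)) * exp (of_int m * (\<i> * pi))" for m
    by (simp add: w'_def flip: exp_add) (simp add: algebra_simps)
  have e1: "?f (2 * m) = G q * ?h m" for m
  proof -
    have "exp (of_int (2 * m) * w) = exp (of_int m * (\<i> * pi))"
    proof -
      have "exp (of_int (2 * m) * w) = exp w powi (2 * m)" by (simp add: exp_power_int)
      also have "\<dots> = (-1) powi m" by (simp add: w power_int_mult)
      also have "\<dots> = exp (of_int m * (\<i> * pi))" by (simp flip: exp_power_int)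
      finally show ?thesis .
    qed
    moreover have "l * of_int (2 * m) * (of_int (2 * m) + 1) / 2 = l * of_int m * (2 * of_int m + 1)"
      by simp
    ultimately show ?thesis unfolding h_eq unfolding exp_add by (simp add: mult.assoc)
  qed
  have e2: "?f (- 1 - 2 * m) = \<i> * (G q * ?h m)" for m
  proof -
    have "exp (of_int (- 1 - 2 * m) * w) = \<i> * exp (of_int m * (\<i> * pi))"
    proof -
      have "exp (of_int (- 1 - 2 * m) * w) = exp w powi (- 1 - 2 * m)" by (simp add: exp_power_int)
      also have "\<dots> = \<i> * (-1) powi m"
        by (simp add: w power_int_diff power_int_mult) (simp add: field_simps power_int_minus_one_mult_self)
      also have "\<dots> = \<i> * exp (of_int m * (\<i> * pi))" by (simp flip: exp_power_int)
      finally show ?thesis .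
    qed
    moreover have "l * of_int (- 1 - 2 * m) * (of_int (- 1 - 2 * m) + 1) / 2 = l * of_int m * (2 * of_int m + 1)"
      by (simp add: algebra_simps)
    ultimately show ?thesis unfolding h_eq unfolding exp_add by (simp add: mult.assoc)
  qed
  have "G (q ^ 4) * jacobi_prod q \<i> = G q * jacobi_prod (q ^ 4) (1 / q) + \<i> * (G q * jacobi_prod (q ^ 4) (1 / q))"
  proof (rule has_sum_int_parity)
    show "((\<lambda>n. G (q ^ 4) * ?f n) has_sum (G (q ^ 4) * jacobi_prod q \<i>)) UNIV"
      by (rule has_sum_cmult_right[OF f])
    show "((\<lambda>m. G (q ^ 4) * ?f (2 * m)) has_sum (G q * jacobi_prod (q ^ 4) (1 / q))) UNIV"
      unfolding e1 using has_sum_cmult_right[OF h, of "G q"] by (simp add: mult_ac)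
    show "((\<lambda>m. G (q ^ 4) * ?f (- 1 - 2 * m)) has_sum (\<i> * (G q * jacobi_prod (q ^ 4) (1 / q)))) UNIV"
      unfolding e2 using has_sum_cmult_right[OF h, of "\<i> * G q"] by (simp add: mult_ac)
  qed
  then have *: "G (q ^ 4) * jacobi_prod q \<i> = (1 + \<i>) * (G q * jacobi_prod (q ^ 4) (1 / q))"
    by (simp add: algebra_simps)
  have E1: "qpoch_inf q q = jacobi_prod (q ^ 4) (1 / q) * qpoch_inf (q ^ 2) (q ^ 2)"
  proof -
    have "qpoch_inf q q = qpoch_inf q (q ^ 4) * qpoch_inf (q ^ 2) (q ^ 4) * qpoch_inf (q ^ 3) (q ^ 4) * qpoch_inf (q ^ 4) (q ^ 4)"
      using qpoch_inf_split[OF q(1), of 4 q] by (simp add: eval_nat_numeral mult_ac)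
    moreover have "qpoch_inf (q ^ 2) (q ^ 2) = qpoch_inf (q ^ 2) (q ^ 4) * qpoch_inf (q ^ 4) (q ^ 4)"
      using qpoch_inf_split[OF q2(1), of 2 "q ^ 2"] by (simp add: eval_nat_numeral mult_ac)
    moreover have "jacobi_prod (q ^ 4) (1 / q) = qpoch_inf (q ^ 3) (q ^ 4) * qpoch_inf q (q ^ 4)"
      using q by (simp add: jacobi_prod_def eval_nat_numeral)
    ultimately show ?thesis by simp
  qed
  have E4: "jacobi_prod q \<i> * qpoch_inf (q ^ 2) (q ^ 2) = (1 + \<i>) * qpoch_inf (q ^ 4) (q ^ 4)"
  proof -
    have "jacobi_prod q \<i> = (1 + \<i>) * (qpoch_inf (\<i> * q) q * qpoch_inf (- \<i> * q) q)"
      using qpoch_inf_step[OF q(1), of "- \<i>"] by (simp add: jacobi_prod_def mult_ac divide_i)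
    also have "qpoch_inf (\<i> * q) q * qpoch_inf (- \<i> * q) q = qpoch_inf (- (q ^ 2)) (q ^ 2)"
    proof -
      have "(\<Prod>r<(2::nat). qpoch_inf ((if r = 0 then 1 else -1) * (\<i> * q)) q) = qpoch_inf ((\<i> * q) ^ 2) (q ^ 2)"
        using q by (intro qpoch_inf_prod_eq) (auto simp: eval_nat_numeral algebra_simps)
      moreover have "(\<i> * q) ^ 2 = - (q ^ 2)" by (simp add: power_mult_distrib)
      ultimately show ?thesis by (simp only:) (simp add: eval_nat_numeral)
    qed
    finally have "jacobi_prod q \<i> * qpoch_inf (q ^ 2) (q ^ 2)
       = (1 + \<i>) * (qpoch_inf (q ^ 2) (q ^ 2) * qpoch_inf (- (q ^ 2)) (q ^ 2))" by simp
    also have "qpoch_inf (q ^ 2) (q ^ 2) * qpoch_inf (- (q ^ 2)) (q ^ 2) = qpoch_inf (q ^ 4) (q ^ 4)"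
    proof -
      have "(\<Prod>r<(2::nat). qpoch_inf ((if r = 0 then 1 else -1) * q ^ 2) (q ^ 2)) = qpoch_inf ((q ^ 2) ^ 2) ((q ^ 2) ^ 2)"
        using q2 by (intro qpoch_inf_prod_eq) (auto simp: eval_nat_numeral algebra_simps)
      then show ?thesis by (simp add: eval_nat_numeral mult_ac)
    qed
    finally show ?thesis .
  qed
  have nz: "1 + \<i> \<noteq> 0" by (simp add: complex_eq_iff)
  have "(1 + \<i>) * (G (q ^ 4) * qpoch_inf (q ^ 4) (q ^ 4))
      = (G (q ^ 4) * jacobi_prod q \<i>) * qpoch_inf (q ^ 2) (q ^ 2)"
    unfolding mult.assoc E4 by (simp only: mult_ac)
  also have "\<dots> = (1 + \<i>) * (G q * qpoch_inf q q)"
    unfolding * E1 by (simp only: mult_ac)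
  finally show ?thesis using nz by (simp add: G_def)
qed

text \<open>The expression is invariant under \<open>q \<mapsto> q ^ 4\<close>, hence equal to its
  limit at 0. Combinatorially, one-colored Frobenius symbols are counted by the ordinary partition
  numbers.\<close>

lemma charge_coeff_1:
  assumes l: "Re l < 0"
  shows "charge_coeff 1 (exp l) 0 * qpoch_inf (exp l) (exp l) = 1"
proof -
  define r where "r q = charge_coeff 1 q 0 * qpoch_inf q q" for q
  have Re4: "Re (4 ^ n * l) = 4 ^ n * Re l" for n
  proof -
    have "Re (complex_of_real c * l) = c * Re l" for c by simp
    from this[of "4 ^ n"] show ?thesis by simp
  qed
  have neg: "Re (4 ^ n * l) < 0" for n
    unfolding Re4 using l by (simp add: mult_pos_neg)
  have iter: "r (exp (4 ^ n * l)) = r (exp l)" for n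
  proof (induction n)
    case (Suc n)
    have "exp (4 ^ Suc n * l) = exp (4 ^ n * l) ^ 4"
      by (simp add: mult_ac flip: exp_of_nat_mult)
    then show ?case using charge_coeff_1_quadruple[OF neg[of n]] Suc by (simp only: r_def)
  qed simp
  \<comment> \<open>Writing \<open>qpoch_inf q q\<close> as the inverse of the partition series
    makes \<open>r\<close> a quotient of power series, which is continuous at 0.\<close>
  have r: "r q = (\<Sum>n. of_nat (cphi 1 n) * q ^ n) / (\<Sum>n. of_nat (partition_number n) * q ^ n)" if "norm q < 1" for q
    unfolding sums_unique[OF sums_cphi[OF that, of 1], symmetric]
      sums_unique[OF partition_number_sums[OF that], symmetric] by (simp add: r_def)
  have c1: "isCont (\<lambda>q::complex. \<Sum>n. of_nat (cphi 1 n) * q ^ n) 0"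
    using sums_summable[OF sums_cphi[of "1/2" 1]] by (intro isCont_powser[of _ "1/2"]) auto
  have c2: "isCont (\<lambda>q::complex. \<Sum>n. of_nat (partition_number n) * q ^ n) 0"
    using sums_summable[OF partition_number_sums[of "1/2"]] by (intro isCont_powser[of _ "1/2"]) auto
  have p0: "partition_number 0 = 1"
  proof -
    have "partitions 0 = {{#}}" by (auto simp: partitions_def) (metis multiset_nonemptyE neq0_conv)
    then show ?thesis by (simp add: partition_number_def)
  qed
  have lim: "(\<lambda>n. exp (4 ^ n * l)) \<longlonglongrightarrow> 0"
  proof (rule tendsto_norm_zero_cancel)
    have A: "(\<lambda>n. exp (Re l) ^ n) \<longlonglongrightarrow> 0" using l by (intro LIMSEQ_power_zero) auto
    have B: "norm (exp (4 ^ n * l)) \<le> exp (Re l) ^ n" for n :: nat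
    proof -
      have "4 ^ n * Re l \<le> of_nat n * Re l"
      proof (rule mult_right_mono_neg)
        show "real n \<le> 4 ^ n"
        proof (induction n)
          case (Suc n)
          have "1 \<le> (4::real) ^ n" by simp
          then show ?case using Suc.IH unfolding power_Suc of_nat_Suc by linarith
        qed simp
      qed (use l in auto)
      then show ?thesis by (simp only: norm_exp_eq_Re Re4) (simp add: exp_of_nat_mult[symmetric])
    qed
    show "(\<lambda>n. norm (exp (4 ^ n * l))) \<longlonglongrightarrow> 0"
      by (rule tendsto_sandwich[OF always_eventually always_eventually tendsto_const A])
        (intro allI norm_ge_zero B)+
  qed
  let ?R = "\<lambda>q. (\<Sum>n. of_nat (cphi 1 n) * q ^ n) / (\<Sum>n. of_nat (partition_number n) * q ^ n) :: complex"
  have "isCont ?R 0" using c1 c2 p0 by (intro isCont_divide) (auto simp: powser_zero)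
  from isCont_tendsto_compose[OF this lim]
  have "(\<lambda>n. ?R (exp (4 ^ n * l))) \<longlonglongrightarrow> 1" by (simp add: powser_zero p0 cphi_0)
  moreover have "?R (exp (4 ^ n * l)) = r (exp l)" for n
  proof -
    have "norm (exp (4 ^ n * l)) < 1" using neg[of n] by (simp only: norm_exp_eq_Re exp_less_one_iff)
    from r[OF this] iter[of n] show ?thesis by simp
  qed
  ultimately show ?thesis by (simp add: LIMSEQ_const_iff r_def)
qed

theorem jacobi_triple_product:
  assumes l: "Re l < 0"
  shows "((\<lambda>n::int. exp (l * of_int n * (of_int n + 1) / 2 + of_int n * w))
    has_sum (qpoch_inf (exp l) (exp l) * jacobi_prod (exp l) (- exp w))) UNIV"
proof -
  have "qpoch_inf (exp l) (exp l) * (charge_coeff 1 (exp l) 0 * x) = x" for x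
  proof -
    have "qpoch_inf (exp l) (exp l) * (charge_coeff 1 (exp l) 0 * x)
        = (charge_coeff 1 (exp l) 0 * qpoch_inf (exp l) (exp l)) * x" by (simp only: mult_ac)
    then show ?thesis by (simp only: charge_coeff_1[OF l] mult_1)
  qed
  with has_sum_cmult_right[OF has_sum_jacobi_prod_aux[OF l, of w], of "qpoch_inf (exp l) (exp l)"]
  show ?thesis by (simp only:)
qed

text \<open>By \<open>charge_coeff_mult\<close> with \<open>k = 5\<close>, the coefficients
  surviving the filter are \<open>charge_coeff 5 q 0\<close> times those of the triple product of
  nome \<open>q ^ 5\<close> in the variable \<open>exp (5 * w)\<close>.\<close>

lemma sum_jacobi_prod_fifth_roots:
  assumes l: "Re l < 0"
  defines "q \<equiv> exp l"
  shows "(\<Sum>r<5. jacobi_prod q (- (cis (2 * pi / 5) ^ r * exp w)) ^ 5)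
     = 5 * charge_coeff 5 q 0 * (qpoch_inf (q ^ 5) (q ^ 5) * jacobi_prod (q ^ 5) (- exp (5 * w)))"
proof -
  have q: "norm q < 1" "q \<noteq> 0" using l by (auto simp: q_def)
  have q5: "q ^ 5 = exp (5 * l)" by (simp add: q_def exp_of_nat_mult[symmetric])
  have "((\<lambda>n. if int 5 dvd n then of_nat 5 * (charge_coeff 5 q n * exp w powi n) else 0) has_sum
      (\<Sum>r<5. jacobi_prod q (- (cis (2 * pi / 5) ^ r * exp w)) ^ 5)) UNIV"
    using laurent_coeff_filter[of 5 "charge_coeff 5 q" "exp w"
        "\<lambda>r. jacobi_prod q (- (cis (2 * pi / 5) ^ r * exp w)) ^ 5"]
      has_sum_charge_coeff_jacobi_prod[OF q(1)] by simp
  also have "?this \<longleftrightarrow> ((\<lambda>m. 5 * (charge_coeff 5 q (5 * m) * exp w powi (5 * m))) has_sum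
      (\<Sum>r<5. jacobi_prod q (- (cis (2 * pi / 5) ^ r * exp w)) ^ 5)) UNIV"
  proof -
    have "((\<lambda>n. if int 5 dvd n then of_nat 5 * (charge_coeff 5 q n * exp w powi n) else 0) has_sum s) UNIV
      \<longleftrightarrow> ((\<lambda>n. 5 * (charge_coeff 5 q n * exp w powi n)) has_sum s) {n. 5 dvd n}" for s
      by (intro has_sum_cong_neutral) auto
    also have "((\<lambda>n. 5 * (charge_coeff 5 q n * exp w powi n)) has_sum s) {n. 5 dvd n} \<longleftrightarrow>
       ((\<lambda>m. 5 * (charge_coeff 5 q (5 * m) * exp w powi (5 * m))) has_sum s) UNIV" for s
      by (rule has_sum_reindex_bij_witness[where j = "\<lambda>n. n div 5" and i = "\<lambda>m. 5 * m"]) auto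
    finally show ?thesis .
  qed
  also have "(\<lambda>m. 5 * (charge_coeff 5 q (5 * m) * exp w powi (5 * m)))
     = (\<lambda>m. 5 * charge_coeff 5 q 0 * exp (5 * l * of_int m * (of_int m + 1) / 2 + of_int m * (5 * w)))"
  proof
    fix m
    show "5 * (charge_coeff 5 q (5 * m) * exp w powi (5 * m))
     = 5 * charge_coeff 5 q 0 * exp (5 * l * of_int m * (of_int m + 1) / 2 + of_int m * (5 * w))"
      using charge_coeff_mult[OF l, of 5 m] by (simp add: q_def exp_power_int exp_add mult_ac)
  qed
  finally have 1: "((\<lambda>m. 5 * charge_coeff 5 q 0 * exp (5 * l * of_int m * (of_int m + 1) / 2 + of_int m * (5 * w)))
     has_sum (\<Sum>r<5. jacobi_prod q (- (cis (2 * pi / 5) ^ r * exp w)) ^ 5)) UNIV" .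
  have 2: "((\<lambda>m. 5 * charge_coeff 5 q 0 * exp (5 * l * of_int m * (of_int m + 1) / 2 + of_int m * (5 * w)))
     has_sum (5 * charge_coeff 5 q 0 * (qpoch_inf (q ^ 5) (q ^ 5) * jacobi_prod (q ^ 5) (- exp (5 * w))))) UNIV"
    unfolding q5 using l by (intro has_sum_cmult_right jacobi_triple_product) auto
  from has_sum_unique[OF 1 2] show ?thesis .
qed

subsection \<open>Theta functions and the Weierstrass relation\<close>

lemma uniform_limit_qpoch_inf:
  assumes q: "norm q < 1"
  shows "uniform_limit (cball 0 R) (\<lambda>N x. \<Prod>j<N. 1 - x * q ^ j) (\<lambda>x. qpoch_inf x q) sequentially"
proof -
  have "uniformly_convergent_on (cball 0 R) (\<lambda>N x. \<Prod>j<N. 1 - x * q ^ j)"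
  proof (rule uniformly_convergent_on_prod')
    show "uniformly_convergent_on (cball 0 R) (\<lambda>N x. \<Sum>n<N. norm (1 - x * q ^ n - 1))"
    proof (rule Weierstrass_m_test')
      show "summable (\<lambda>n. R * norm q ^ n)"
        using q by (intro summable_mult summable_geometric) auto
      fix n and x :: complex assume "x \<in> cball 0 R"
      then show "norm (norm (1 - x * q ^ n - 1)) \<le> R * norm q ^ n"
        by (auto simp: norm_mult norm_power intro!: mult_right_mono)
    qed
  qed (auto intro!: continuous_intros)
  then have *: "uniform_limit (cball 0 R) (\<lambda>N x. \<Prod>j<N. 1 - x * q ^ j)
      (\<lambda>x. lim (\<lambda>N. \<Prod>j<N. 1 - x * q ^ j)) sequentially"
    by (simp only: uniformly_convergent_uniform_limit_iff)
  have "lim (\<lambda>N. \<Prod>j<N. 1 - x * q ^ j) = qpoch_inf x q" for x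
    by (rule limI[OF qpoch_inf_LIMSEQ[OF q]])
  with * show ?thesis by (simp only:)
qed

lemma holomorphic_qpoch_inf:
  assumes q: "norm q < 1"
  shows "(\<lambda>x. qpoch_inf x q) holomorphic_on UNIV"
proof (rule holomorphic_uniform_sequence)
  show "(\<lambda>x. \<Prod>j<N. 1 - x * q ^ j) holomorphic_on UNIV" for N
    by (intro holomorphic_intros)
  fix x :: complex
  have "cball x 1 \<subseteq> cball 0 (norm x + 1)"
  proof
    fix y assume "y \<in> cball x 1"
    then have "norm (y - x) \<le> 1" by (simp add: dist_norm norm_minus_commute)
    then show "y \<in> cball 0 (norm x + 1)" using norm_triangle_ineq2[of y x] by simp
  qed
  then show "\<exists>d>0. cball x d \<subseteq> UNIV \<and>
      uniform_limit (cball x d) (\<lambda>N x. \<Prod>j<N. 1 - x * q ^ j) (\<lambda>x. qpoch_inf x q) sequentially"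
    by (intro exI[of _ 1] conjI uniform_limit_on_subset[OF uniform_limit_qpoch_inf[OF q]]) auto
qed simp

lemma logderiv_qpoch_inf:
  assumes q: "norm q < 1" and nz: "qpoch_inf x q \<noteq> 0"
  shows "(\<lambda>j. - (q ^ j / (1 - x * q ^ j))) sums (deriv (\<lambda>x. qpoch_inf x q) x / qpoch_inf x q)"
proof -
  have d: "deriv (\<lambda>x. 1 - x * q ^ j) x = - (q ^ j)" for j
    by (rule DERIV_imp_deriv) (auto intro!: derivative_eq_intros)
  have "(\<lambda>j. deriv (\<lambda>x. 1 - x * q ^ j) x / (1 - x * q ^ j)) sums (deriv (\<lambda>x. qpoch_inf x q) x / qpoch_inf x q)"
  proof (rule logderiv_prodinf_complex_uniform_limit)
    show "uniform_limit (ball 0 (norm x + 1)) (\<lambda>N x. \<Prod>j<N. 1 - x * q ^ j) (\<lambda>x. qpoch_inf x q) sequentially"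
      by (rule uniform_limit_on_subset[OF uniform_limit_qpoch_inf[OF q] ball_subset_cball])
    show "(\<lambda>x. 1 - x * q ^ k) holomorphic_on ball 0 (norm x + 1)" for k
      by (intro holomorphic_intros)
  qed (use nz in auto)
  then show ?thesis by (simp add: d)
qed

text \<open>The first Jacobi theta function in the additive variable, without its factor
  \<open>qpoch_inf q q\<close>.\<close>

definition theta :: "complex \<Rightarrow> complex \<Rightarrow> complex" where
  "theta q z = (exp (z / 2) - exp (- z / 2)) * (qpoch_inf (q * exp z) q * qpoch_inf (q * exp (- z)) q)"

lemma theta_minus: "theta q (- z) = - theta q z"
  by (simp add: theta_def algebra_simps)

lemma theta_0 [simp]: "theta q 0 = 0"
  by (simp add: theta_def)

lemma theta_eq_jacobi_prod:
  assumes "norm q < 1"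
  shows "theta q z = exp (z / 2) * jacobi_prod q (exp z)"
proof -
  have 1: "qpoch_inf (1 / exp z) q = (1 - exp (- z)) * qpoch_inf (q * exp (- z)) q"
    using qpoch_inf_step[OF assms, of "1 / exp z"] by (simp add: exp_minus field_simps)
  have 2: "exp (z / 2) - exp (- z / 2) = exp (z / 2) * (1 - exp (- z))"
    by (simp add: algebra_simps flip: exp_add)
  show ?thesis
    unfolding theta_def jacobi_prod_def 1 2 by (simp only: mult_ac)
qed

lemma theta_plus_2pi: "theta q (z + 2 * pi * \<i>) = - theta q z"
proof -
  have 1: "exp (z + 2 * pi * \<i>) = exp z" "exp (- (z + 2 * pi * \<i>)) = exp (- z)"
    by (simp_all add: exp_add exp_diff exp_minus exp_eq_1)
  have 2: "exp ((z + 2 * pi * \<i>) / 2) = - exp (z / 2)"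
    by (simp add: add_divide_distrib exp_add)
  have 3: "exp (- (z + 2 * pi * \<i>) / 2) = - exp (- z / 2)"
    unfolding minus_divide_left[symmetric] exp_minus 2 by simp
  show ?thesis unfolding theta_def 1 2 3 by (simp add: algebra_simps)
qed

lemma theta_plus_quasiperiod:
  assumes l: "Re l < 0"
  shows "theta (exp l) (z + l) = - (exp (- l / 2 - z) * theta (exp l) z)"
proof -
  have q: "norm (exp l) < 1" "exp l \<noteq> 0" using l by auto
  have "jacobi_prod (exp l) (exp l * exp z) = - (jacobi_prod (exp l) (exp z) / (exp l * exp z))"
    using jacobi_prod_shift[OF q, of "exp z"] by (simp add: field_simps)
  moreover have "exp ((z + l) / 2) / (exp l * exp z) = exp (- l / 2 - z) * exp (z / 2)"
    by (simp add: field_simps flip: exp_add exp_diff)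
  moreover have "exp ((z + l) / 2) * - (J / (exp l * exp z)) = - (exp ((z + l) / 2) / (exp l * exp z) * J)" for J
    by simp
  ultimately show ?thesis
    unfolding theta_eq_jacobi_prod[OF q(1)] exp_add[of z l] by (simp only: mult.commute[of "exp z"] mult.assoc)
qed

lemma holomorphic_theta:
  assumes "norm q < 1"
  shows "theta q holomorphic_on UNIV"
proof -
  have "((\<lambda>x. qpoch_inf x q) \<circ> (\<lambda>z. q * exp z)) holomorphic_on UNIV"
    "((\<lambda>x. qpoch_inf x q) \<circ> (\<lambda>z. q * exp (- z))) holomorphic_on UNIV"
    by (rule holomorphic_on_compose_gen[OF _ holomorphic_qpoch_inf[OF assms]];
        auto intro!: holomorphic_intros)+
  then show ?thesis
    unfolding theta_def[abs_def] comp_def by (intro holomorphic_intros) auto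
qed

lemma theta_has_field_derivative:
  assumes "norm q < 1"
  shows "(theta q has_field_derivative deriv (theta q) z) (at z)"
  by (rule holomorphic_derivI[OF holomorphic_theta[OF assms]]) auto

lemma deriv_theta_has_field_derivative:
  assumes "norm q < 1"
  shows "(deriv (theta q) has_field_derivative deriv (deriv (theta q)) z) (at z)"
  by (rule holomorphic_derivI[OF holomorphic_deriv[OF holomorphic_theta[OF assms]]]) auto

lemma has_sum_theta:
  assumes l: "Re l < 0"
  defines "q \<equiv> exp l"
  shows "((\<lambda>n::int. exp (l * of_int n * (of_int n + 1) / 2 + of_int n * (\<i> * pi) + (of_int n + 1 / 2) * z))
    has_sum (qpoch_inf q q * theta q z)) UNIV"
proof -
  have "norm q < 1" using l by (simp add: q_def)
  then have t: "qpoch_inf q q * theta q z = exp (z / 2) * (qpoch_inf q q * jacobi_prod q (- exp (z + \<i> * pi)))"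
    by (simp add: theta_eq_jacobi_prod exp_add)
  have "((\<lambda>n::int. exp (z / 2) * exp (l * of_int n * (of_int n + 1) / 2 + of_int n * (z + \<i> * pi)))
    has_sum (qpoch_inf q q * theta q z)) UNIV"
    unfolding t unfolding q_def by (rule has_sum_cmult_right[OF jacobi_triple_product[OF l]])
  moreover have "exp (z / 2) * exp (l * of_int n * (of_int n + 1) / 2 + of_int n * (z + \<i> * pi))
     = exp (l * of_int n * (of_int n + 1) / 2 + of_int n * (\<i> * pi) + (of_int n + 1 / 2) * z)" for n :: int
    by (simp add: algebra_simps flip: exp_add)
  ultimately show ?thesis by (simp only:)
qed

text \<open>Sorting the double series of \<open>theta (a + b) * theta (a - b)\<close> by the parity of the difference
  of the indices separates the variables, so the product is an alternating form of rank two in \<open>a\<close>, \<open>b\<close>.\<close>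

lemma theta_product_rank_two:
  assumes l: "Re l < 0"
  defines "q \<equiv> exp l"
  shows "\<exists>A B. \<forall>a b. theta q (a + b) * theta q (a - b) = A a * B b - B a * A b"
proof -
  define E where "E = qpoch_inf q q"
  have q: "norm q < 1" using l by (simp add: q_def)
  then have E: "E \<noteq> 0" unfolding E_def by (intro qpoch_inf_nonzero')
  define fA where "fA a j = exp (l * of_int j * (of_int j + 1) + (2 * of_int j + 1) * a)" for a and j :: int
  define fB where "fB b j = exp (l * of_int j * of_int j + 2 * of_int j * b)" for b and j :: int
  define A where "A a = infsum (fA a) UNIV" for a
  define B where "B b = infsum (fB b) UNIV" for b
  have l2: "Re (2 * l) < 0" using l by simp
  have A: "(fA a has_sum A a) UNIV" for a
  proof -
    have "((\<lambda>n::int. exp a * exp (2 * l * of_int n * (of_int n + 1) / 2 + of_int n * (2 * a))) has_sum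
       (exp a * (qpoch_inf (exp (2 * l)) (exp (2 * l)) * jacobi_prod (exp (2 * l)) (- exp (2 * a))))) UNIV"
      by (intro has_sum_cmult_right jacobi_triple_product l2)
    moreover have "exp a * exp (2 * l * of_int n * (of_int n + 1) / 2 + of_int n * (2 * a)) = fA a n" for n
      unfolding fA_def by (simp flip: exp_add) (simp add: field_simps)
    ultimately have "fA a summable_on UNIV" by (simp only: has_sum_imp_summable)
    then show ?thesis unfolding A_def by (rule has_sum_infsum)
  qed
  have B: "(fB b has_sum B b) UNIV" for b
  proof -
    \<comment> \<open>The argument \<open>2 * b - l\<close> turns \<open>l * n * (n + 1)\<close>
      into \<open>l * n ^ 2\<close>.\<close>
    have "((\<lambda>n::int. exp (2 * l * of_int n * (of_int n + 1) / 2 + of_int n * (2 * b - l))) has_sum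
       (qpoch_inf (exp (2 * l)) (exp (2 * l)) * jacobi_prod (exp (2 * l)) (- exp (2 * b - l)))) UNIV"
      by (intro jacobi_triple_product l2)
    moreover have "exp (2 * l * of_int n * (of_int n + 1) / 2 + of_int n * (2 * b - l)) = fB b n" for n
    proof -
      have "2 * l * of_int n * (of_int n + 1) / 2 + of_int n * (2 * b - l) = l * of_int n * of_int n + 2 * of_int n * b"
        by (simp add: field_simps)
      then show ?thesis by (simp only: fB_def)
    qed
    ultimately have "fB b summable_on UNIV" by (simp only: has_sum_imp_summable)
    then show ?thesis unfolding B_def by (rule has_sum_infsum)
  qed
  define f where "f z n = exp (l * of_int n * (of_int n + 1) / 2 + of_int n * (\<i> * pi) + (of_int n + 1 / 2) * z)"
    for z and n :: int
  have f: "(f z has_sum (E * theta q z)) UNIV" for z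
    using has_sum_theta[OF l, of z] by (simp only: f_def[abs_def] E_def q_def)
  have main: "(E * theta q (a + b)) * (E * theta q (a - b)) = A a * B b - B a * A b" for a b
  proof -
    define g where "g = (\<lambda>(m, n). f (a + b) m * f (a - b) n)"
    have g: "(g has_sum (E * theta q (a + b)) * (E * theta q (a - b))) (UNIV \<times> UNIV)"
      unfolding g_def by (rule has_sum_product[OF f f])
    \<comment> \<open>The index sum is \<open>2 * j\<close> here and \<open>2 * j - 1\<close> in
      \<open>g2\<close>, so the alternating signs of the two theta series multiply to 1 and to -1;
      the cross terms in \<open>j * k\<close> cancel in both cases.\<close>
    have g1: "g (j + k, j - k) = fA a j * fB b k" for j k
    proof -
      have "g (j + k, j - k) = exp (l * of_int j * (of_int j + 1) + (2 * of_int j + 1) * a +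
          (l * of_int k * of_int k + 2 * of_int k * b) + \<i> * (of_int j * (of_real pi * 2)))"
        unfolding g_def f_def case_prod_conv exp_add[symmetric]
        by (rule arg_cong[where f = exp]) (simp add: field_simps)
      then show ?thesis unfolding exp_plus_2pin fA_def fB_def by (simp only: exp_add)
    qed
    have g2: "g (j + k, j - k - 1) = - (fB a j * fA b k)" for j k
    proof -
      have "g (j + k, j - k - 1) = exp ((l * of_int j * of_int j + 2 * of_int j * a) +
          (l * of_int k * (of_int k + 1) + (2 * of_int k + 1) * b) - \<i> * pi + \<i> * (of_int j * (of_real pi * 2)))"
        unfolding g_def f_def case_prod_conv exp_add[symmetric]
        by (rule arg_cong[where f = exp]) (simp add: field_simps)
      then show ?thesis unfolding exp_plus_2pin fA_def fB_def by (simp add: exp_add exp_diff)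
    qed
    have "((\<lambda>(j, k). fA a j * fB b k) has_sum (A a * B b)) (UNIV \<times> UNIV)"
      by (rule has_sum_product[OF A B])
    also have "?this \<longleftrightarrow> (g has_sum (A a * B b)) {(m, n). even (m - n)}"
      by (rule has_sum_reindex_bij_witness[where j = "\<lambda>(j, k). (j + k, j - k)"
            and i = "\<lambda>(m, n). ((m + n) div 2, (m - n) div 2)"]) (auto simp: g1, presburger+)
    finally have s1: "(g has_sum (A a * B b)) {(m, n). even (m - n)}" .
    have "((\<lambda>(j, k). - (fB a j * fA b k)) has_sum - (B a * A b)) (UNIV \<times> UNIV)"
      using has_sum_product[OF B A, of a b] by (simp add: case_prod_unfold has_sum_uminus)
    also have "?this \<longleftrightarrow> (g has_sum - (B a * A b)) {(m, n). odd (m - n)}"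
      by (rule has_sum_reindex_bij_witness[where j = "\<lambda>(j, k). (j + k, j - k - 1)"
            and i = "\<lambda>(m, n). ((m + n + 1) div 2, (m - n - 1) div 2)"]) (auto simp: g2, presburger+)
    finally have s2: "(g has_sum - (B a * A b)) {(m, n). odd (m - n)}" .
    have "(g has_sum (A a * B b + - (B a * A b))) ({(m, n). even (m - n)} \<union> {(m, n). odd (m - n)})"
      by (rule has_sum_Un_disjoint[OF s1 s2]) auto
    moreover have "{(m, n). even (m - n)} \<union> {(m, n). odd (m - n)} = (UNIV \<times> UNIV :: (int \<times> int) set)" by auto
    ultimately have "(g has_sum (A a * B b + - (B a * A b))) (UNIV \<times> UNIV)" by (simp only:)
    from has_sum_unique[OF g this] show ?thesis by simp
  qed
  have "theta q (a + b) * theta q (a - b) = (A a / E ^ 2) * B b - B a * (A b / E ^ 2)" for a b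
    using main[of a b] E by (simp add: field_simps power2_eq_square)
  then show ?thesis by (intro exI[of _ "\<lambda>a. A a / E ^ 2"] exI[of _ B]) auto
qed

text \<open>Each product \<open>theta q (x + y) * theta q (x - y)\<close> is a 2 by 2 minor of the
  vectors with entries \<open>A\<close> and \<open>B\<close>, so this is the three-term Pluecker
  relation.\<close>

lemma theta_weierstrass:
  assumes l: "Re l < 0"
  defines "q \<equiv> exp l"
  shows "theta q (a + b) * theta q (a - b) * (theta q (c + d) * theta q (c - d))
       - theta q (a + c) * theta q (a - c) * (theta q (b + d) * theta q (b - d))
       + theta q (a + d) * theta q (a - d) * (theta q (b + c) * theta q (b - c)) = 0"
proof -
  obtain A B where "\<And>a b. theta q (a + b) * theta q (a - b) = A a * B b - B a * A b"
    using theta_product_rank_two[OF l] unfolding q_def by blast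
  then show ?thesis by (simp only:) (simp add: algebra_simps)
qed

section \<open>Differentiated forms of the Weierstrass relation\<close>

lemma has_field_derivative_affine:
  fixes f f' :: "complex \<Rightarrow> complex"
  assumes "\<And>z. (f has_field_derivative f' z) (at z)"
  shows "((\<lambda>s. f (c + k * s)) has_field_derivative f' (c + k * s) * k) (at s)"
proof (rule DERIV_chain2[OF assms])
  show "((\<lambda>s. c + k * s) has_field_derivative k) (at s)"
    by (auto intro!: derivative_eq_intros)
qed

text \<open>Divided by the four theta values, this is the product formula for
  \<open>Z x + Z y + Z w - Z (x + y + w)\<close>; in the cleared form zeros do no harm. It is the
  first-order term of a one-parameter Weierstrass relation in which one product contains the factor
  \<open>t s\<close>.\<close>

lemma theta_deriv_sum:
  fixes x y w :: complex
  assumes l: "Re l < 0"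
  defines "t \<equiv> theta (exp l)"
  defines "t' \<equiv> deriv t"
  shows "t' x * t y * t w * t (x + y + w) + t x * t' y * t w * t (x + y + w)
       + t x * t y * t' w * t (x + y + w) - t x * t y * t w * t' (x + y + w)
       = t' 0 * t (x + y) * t (x + w) * t (y + w)"
proof -
  have q: "norm (exp l) < 1" using l by simp
  have D: "(t has_field_derivative t' z) (at z)" for z
    unfolding t'_def t_def by (rule theta_has_field_derivative[OF q])
  have odd: "t (- z) = - t z" for z by (simp add: t_def theta_minus)
  define F where "F s = t (x + 2 * s) * t y * (t w * t (x + y + w))
     - t (x + y + w + s) * t (w - s) * (t (y - s) * t (x + s))
     - t s * t (x + y + s) * (t (x + w + s) * t (y + w - s))" for s
  have F0: "F s = 0" for s
  proof -
    \<comment> \<open>The arguments are solved from \<open>a + b = x + 2 * s\<close>,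
      \<open>a - b = y\<close>, \<open>c + d = w\<close>, \<open>c - d = x + y + w\<close>; then
      \<open>a + d = s\<close>, so at \<open>s = 0\<close> the last product vanishes and the other
      two cancel.\<close>
    have "t (x + 2 * s) * t y * (t w * t (x + y + w))
     - t (x + y + w + s) * t (s - w) * (t (s - y) * t (x + s))
     + t s * t (x + y + s) * (t (x + w + s) * t (s - y - w)) = 0"
      using theta_weierstrass[OF l, of "(x + y) / 2 + s" "(x - y) / 2 + s" "(x + y) / 2 + w" "- (x + y) / 2"]
      unfolding t_def by (simp add: algebra_simps add_divide_distrib diff_divide_distrib)
    moreover have "t (s - w) = - t (w - s)" "t (s - y) = - t (y - s)" "t (s - y - w) = - t (y + w - s)"
      using odd[of "w - s"] odd[of "y - s"] odd[of "y + w - s"] by (simp_all add: algebra_simps)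
    ultimately show ?thesis unfolding F_def by simp
  qed
  have d: "((\<lambda>s. t (x + 2 * s)) has_field_derivative t' x * 2) (at 0)"
    "\<And>c. ((\<lambda>s. t (c + s)) has_field_derivative t' c) (at 0)"
    "\<And>c. ((\<lambda>s. t (c - s)) has_field_derivative - t' c) (at 0)"
    using has_field_derivative_affine[OF D, of x 2 0] has_field_derivative_affine[OF D, of _ 1 0]
      has_field_derivative_affine[OF D, of _ "- 1" 0] by simp_all
  have "(F has_field_derivative
      (2 * t' x * t y * (t w * t (x + y + w))
       - ((t' (x + y + w) * t w - t (x + y + w) * t' w) * (t y * t x)
         + t (x + y + w) * t w * (- t' y * t x + t y * t' x))
       - t' 0 * t (x + y) * (t (x + w) * t (y + w)))) (at 0)"
    unfolding F_def
    by (rule derivative_eq_intros d D refl)+ (simp add: t_def algebra_simps)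
  moreover have "(F has_field_derivative 0) (at 0)"
    unfolding F0[abs_def] by (rule DERIV_const)
  ultimately have "2 * t' x * t y * (t w * t (x + y + w))
       - ((t' (x + y + w) * t w - t (x + y + w) * t' w) * (t y * t x)
         + t (x + y + w) * t w * (- t' y * t x + t y * t' x))
       - t' 0 * t (x + y) * (t (x + w) * t (y + w)) = 0"
    by (rule DERIV_unique)
  then show ?thesis by (simp add: algebra_simps)
qed

text \<open>Divided by \<open>t a ^ 2 * t b ^ 2\<close>, this is the formula for
  \<open>Z' a - Z' b\<close>, the sigma-quotient formula for a difference of two values of the
  Weierstrass p-function. It is the second-order term in \<open>s\<close> of the relation with
  \<open>c = s\<close>, \<open>d = 0\<close>, where \<open>t s ^ 2\<close> leaves
  \<open>t' 0 ^ 2\<close>.\<close>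

lemma theta_deriv2_diff:
  fixes a b :: complex
  assumes l: "Re l < 0"
  defines "t \<equiv> theta (exp l)"
  defines "t' \<equiv> deriv t"
  defines "t'' \<equiv> deriv t'"
  shows "t (a + b) * t (a - b) * t' 0 ^ 2
       = t b ^ 2 * (t a * t'' a - t' a ^ 2) - t a ^ 2 * (t b * t'' b - t' b ^ 2)"
proof -
  have q: "norm (exp l) < 1" using l by simp
  have D: "(t has_field_derivative t' z) (at z)" for z
    unfolding t'_def t_def by (rule theta_has_field_derivative[OF q])
  have D2: "(t' has_field_derivative t'' z) (at z)" for z
    unfolding t''_def t'_def t_def by (rule deriv_theta_has_field_derivative[OF q])
  have p: "((\<lambda>s. t (c + s)) has_field_derivative t' (c + s)) (at s)"
    "((\<lambda>s. t (c - s)) has_field_derivative - t' (c - s)) (at s)"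
    "((\<lambda>s. t' (c + s)) has_field_derivative t'' (c + s)) (at s)"
    "((\<lambda>s. t' (c - s)) has_field_derivative - t'' (c - s)) (at s)" for c s
    using has_field_derivative_affine[OF D, of c 1 s] has_field_derivative_affine[OF D, of c "- 1" s]
      has_field_derivative_affine[OF D2, of c 1 s] has_field_derivative_affine[OF D2, of c "- 1" s]
    by simp_all
  define K where "K = t (a + b) * t (a - b)"
  define F where "F s = K * (t s * t s) - t (a + s) * t (a - s) * t b ^ 2 + t a ^ 2 * (t (b + s) * t (b - s))" for s
  define F' where "F' s = K * (t' s * t s + t s * t' s)
      - (t' (a + s) * t (a - s) - t (a + s) * t' (a - s)) * t b ^ 2
      + t a ^ 2 * (t' (b + s) * t (b - s) - t (b + s) * t' (b - s))" for s
  have F0: "F s = 0" for s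
    using theta_weierstrass[OF l, of a b s 0] unfolding F_def K_def t_def
    by (simp add: power2_eq_square mult_ac)
  have dF: "(F has_field_derivative F' s) (at s)" for s
    unfolding F_def F'_def by (rule derivative_eq_intros p D refl)+ (simp add: algebra_simps)
  have "(F has_field_derivative 0) (at s)" for s
    unfolding F0[abs_def] by (rule DERIV_const)
  then have F'0: "F' s = 0" for s using DERIV_unique[OF dF] by blast
  have "(F' has_field_derivative
      (K * (t'' 0 * t 0 + t' 0 * t' 0 + (t' 0 * t' 0 + t 0 * t'' 0))
      - (t'' a * t a - t' a * t' a - (t' a * t' a - t a * t'' a)) * t b ^ 2
      + t a ^ 2 * (t'' b * t b - t' b * t' b - (t' b * t' b - t b * t'' b)))) (at 0)"
    unfolding F'_def by (rule derivative_eq_intros p D D2 refl)+ (simp add: algebra_simps)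
  moreover have "(F' has_field_derivative 0) (at 0)"
    unfolding F'0[abs_def] by (rule DERIV_const)
  ultimately have "K * (t'' 0 * t 0 + t' 0 * t' 0 + (t' 0 * t' 0 + t 0 * t'' 0))
      - (t'' a * t a - t' a * t' a - (t' a * t' a - t a * t'' a)) * t b ^ 2
      + t a ^ 2 * (t'' b * t b - t' b * t' b - (t' b * t' b - t b * t'' b)) = 0"
    by (rule DERIV_unique)
  moreover have "t 0 = 0" by (simp add: t_def)
  ultimately have "2 * (K * t' 0 ^ 2) = 2 * (t b ^ 2 * (t a * t'' a - t' a ^ 2) - t a ^ 2 * (t b * t'' b - t' b ^ 2))"
    by (simp add: algebra_simps power2_eq_square)
  then show ?thesis unfolding K_def by (rule mult_left_cancel[THEN iffD1, rotated]) simp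
qed

lemma deriv_theta_0:
  assumes q: "norm q < 1"
  shows "deriv (theta q) 0 = qpoch_inf q q ^ 2"
proof (rule DERIV_imp_deriv)
  have D: "((\<lambda>x. qpoch_inf x q) has_field_derivative deriv (\<lambda>x. qpoch_inf x q) x) (at x)" for x
    by (rule holomorphic_derivI[OF holomorphic_qpoch_inf[OF q]]) auto
  have "((\<lambda>z. qpoch_inf (q * exp z) q * qpoch_inf (q * exp (- z)) q) has_field_derivative
      (deriv (\<lambda>x. qpoch_inf x q) (q * exp 0) * (q * exp 0) * qpoch_inf (q * exp (- 0)) q +
       deriv (\<lambda>x. qpoch_inf x q) (q * exp (- 0)) * (q * (exp (- 0) * - 1)) * qpoch_inf (q * exp 0) q)) (at 0)"
    by (intro DERIV_mult DERIV_chain2[OF D]) (auto intro!: derivative_eq_intros)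
  moreover have "((\<lambda>z::complex. exp (z / 2) - exp (- z / 2)) has_field_derivative 1) (at 0)"
    by (auto intro!: derivative_eq_intros)
  ultimately show "(theta q has_field_derivative qpoch_inf q q ^ 2) (at 0)"
    unfolding theta_def[abs_def] by (auto dest: DERIV_mult simp: power2_eq_square)
qed

subsection \<open>Lambert series and logarithmic derivatives\<close>

lemma norm_one_minus_power_ge:
  fixes q :: complex
  assumes "norm q < 1"
  shows "1 - norm q \<le> norm (1 - q ^ Suc n)"
proof -
  have "norm q ^ Suc n \<le> norm q ^ 1" using assms by (intro power_decreasing) auto
  then show ?thesis using norm_triangle_ineq2[of 1 "q ^ Suc n"] by (simp add: norm_power norm_mult)
qed

text \<open>Both sides are iterated sums of one double series, obtained by expanding
  \<open>1 / (1 - q ^ Suc m)\<close> geometrically; it converges absolutely since these denominators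
  are at least \<open>1 - norm q\<close> in norm.\<close>

lemma lambert_interchange:
  fixes a :: "nat \<Rightarrow> complex"
  assumes q: "norm q < 1" and x: "norm x < 1" and a: "summable (\<lambda>m. norm (a m) * norm x ^ Suc m)"
  shows "summable (\<lambda>m. a m * x ^ Suc m / (1 - q ^ Suc m))"
    and "(\<lambda>j. \<Sum>m. a m * (x * q ^ j) ^ Suc m) sums (\<Sum>m. a m * x ^ Suc m / (1 - q ^ Suc m))"
proof -
  let ?f = "\<lambda>(m, j). a m * x ^ Suc m * (q ^ Suc m) ^ j"
  let ?g = "\<lambda>m. a m * x ^ Suc m / (1 - q ^ Suc m)"
  have qm: "norm (q ^ Suc m) < 1" for m by (rule norm_power_less_one[OF q]) simp
  have geo: "((\<lambda>j. norm (q ^ Suc m) ^ j) has_sum (1 / (1 - norm q ^ Suc m))) UNIV" for m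
  proof (rule norm_summable_imp_has_sum)
    show "summable (\<lambda>j. norm (norm (q ^ Suc m) ^ j))" using qm[of m] by (simp add: summable_geometric)
    show "(\<lambda>j. norm (q ^ Suc m) ^ j) sums (1 / (1 - norm q ^ Suc m))"
      using geometric_sums[of "norm (q ^ Suc m)"] qm[of m] by (simp add: norm_power del: power_Suc)
  qed
  have "(\<lambda>p. norm (?f p)) summable_on UNIV \<times> UNIV"
  proof (subst Infinite_Sum.abs_summable_on_Sigma_iff, intro conjI ballI)
    have inner: "((\<lambda>j. norm (?f (m, j))) has_sum (norm (a m) * norm x ^ Suc m * (1 / (1 - norm q ^ Suc m)))) UNIV" for m
      using has_sum_cmult_right[OF geo, of "norm (a m) * norm x ^ Suc m" m]
      by (simp add: norm_mult norm_power del: power_Suc)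
    then show "(\<lambda>j. norm (?f (m, j))) summable_on UNIV" for m by (rule has_sum_imp_summable)
    have "(\<Sum>\<^sub>\<infinity>j. norm (?f (m, j))) = norm (a m) * norm x ^ Suc m * (1 / (1 - norm q ^ Suc m))" for m
      by (rule infsumI[OF inner])
    moreover have "(\<lambda>m. norm (norm (a m) * norm x ^ Suc m * (1 / (1 - norm q ^ Suc m)))) summable_on UNIV"
    proof (rule norm_summable_imp_summable_on, rule summable_comparison_test')
      show "summable (\<lambda>m. norm (a m) * norm x ^ Suc m * (1 / (1 - norm q)))"
        by (rule summable_mult2[OF a])
      fix m :: nat
      have "norm q ^ Suc m \<le> norm q ^ 1" using q by (intro power_decreasing) auto
      then have le: "1 / (1 - norm q ^ Suc m) \<le> 1 / (1 - norm q)" and ge: "0 \<le> 1 / (1 - norm q ^ Suc m)"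
        using q by (auto intro!: divide_left_mono mult_pos_pos simp del: power_Suc)
      have A: "0 \<le> norm (a m) * norm x ^ Suc m" by (intro mult_nonneg_nonneg zero_le_power norm_ge_zero)
      from mult_nonneg_nonneg[OF A ge] mult_left_mono[OF le A]
      show "norm (norm (norm (norm (a m) * norm x ^ Suc m * (1 / (1 - norm q ^ Suc m)))))
          \<le> norm (a m) * norm x ^ Suc m * (1 / (1 - norm q))"
        by (simp only: real_norm_def abs_of_nonneg abs_abs)
    qed
    ultimately show "(\<lambda>m. norm (\<Sum>\<^sub>\<infinity>j. norm (?f (m, j)))) summable_on UNIV" by (simp only:)
  qed
  then have summ: "?f summable_on UNIV \<times> UNIV" by (rule abs_summable_summable)
  then obtain S where S: "(?f has_sum S) (UNIV \<times> UNIV)" unfolding summable_on_def ..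
  have "(?g has_sum S) UNIV"
  proof (rule has_sum_SigmaD[OF S])
    show "((\<lambda>j. ?f (m, j)) has_sum ?g m) UNIV" for m
      using has_sum_cmult_right[OF has_sum_geometric_complex[OF qm], of "a m * x ^ Suc m" m] by simp
  qed
  then have g: "?g sums S" by (rule has_sum_imp_sums)
  then show "summable ?g" by (rule sums_summable)
  have "((\<lambda>j. \<Sum>m. a m * (x * q ^ j) ^ Suc m) has_sum S) UNIV"
  proof (rule has_sum_SigmaD)
    show "((\<lambda>(j, m). ?f (m, j)) has_sum S) (UNIV \<times> UNIV)"
      by (rule has_sum_swap[THEN iffD1, OF S])
    fix j :: nat
    have eq: "a m * x ^ Suc m * (q ^ Suc m) ^ j = a m * (x * q ^ j) ^ Suc m" for m
    proof -
      have "(q ^ Suc m) ^ j = (q ^ j) ^ Suc m" by (simp only: power_mult[symmetric] mult.commute)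
      then show ?thesis unfolding power_mult_distrib by (simp only: mult_ac)
    qed
    have "(\<lambda>m. ?f (m, j)) summable_on UNIV"
      by (rule summable_on_SigmaD1[OF summable_on_swap[THEN iffD1, OF summ]]) simp
    then have *: "((\<lambda>m. a m * (x * q ^ j) ^ Suc m) has_sum infsum (\<lambda>m. a m * (x * q ^ j) ^ Suc m) UNIV) UNIV"
      unfolding case_prod_conv eq by (rule has_sum_infsum)
    from sums_unique[OF has_sum_imp_sums[OF *]] *
    show "((\<lambda>m. case (j, m) of (j, m) \<Rightarrow> ?f (m, j)) has_sum (\<Sum>m. a m * (x * q ^ j) ^ Suc m)) UNIV"
      by (simp only: eq case_prod_conv)
  qed
  then have "(\<lambda>j. \<Sum>m. a m * (x * q ^ j) ^ Suc m) sums S" by (rule has_sum_imp_sums)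
  with sums_unique[OF g] show "(\<lambda>j. \<Sum>m. a m * (x * q ^ j) ^ Suc m) sums (\<Sum>m. ?g m)" by simp
qed

lemma summable_Suc_powser:
  fixes x :: real
  assumes "0 \<le> x" "x < 1"
  shows "summable (\<lambda>m. real (Suc m) * x ^ Suc m)"
proof -
  have "summable (\<lambda>n. real (Suc n) * x ^ n)"
    using geometric_deriv_sums[of x] assms by (auto intro: sums_summable)
  from summable_mult2[OF this, of x] show ?thesis by (simp add: mult_ac)
qed

text \<open>For \<open>norm x < 1\<close>, \<open>lambert1 q x\<close> is \<open>- x\<close> times
  the logarithmic derivative of \<open>qpoch_inf x q\<close> in \<open>x\<close>, and
  \<open>lambert2\<close> is the image of \<open>lambert1\<close> under \<open>x\<close> times
  d/dx.\<close>

definition lambert1 :: "complex \<Rightarrow> complex \<Rightarrow> complex" where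
  "lambert1 q x = (\<Sum>m. x ^ Suc m / (1 - q ^ Suc m))"

definition lambert2 :: "complex \<Rightarrow> complex \<Rightarrow> complex" where
  "lambert2 q x = (\<Sum>m. of_nat (Suc m) * x ^ Suc m / (1 - q ^ Suc m))"

lemma lambert1_sums:
  assumes q: "norm q < 1" and x: "norm x < 1"
  shows "(\<lambda>m. x ^ Suc m / (1 - q ^ Suc m)) sums lambert1 q x"
    and "(\<lambda>j. x * q ^ j / (1 - x * q ^ j)) sums lambert1 q x"
proof -
  have a: "summable (\<lambda>m. norm (1::complex) * norm x ^ Suc m)"
    using x by (simp add: summable_mult summable_geometric)
  note L = lambert_interchange[OF q x a]
  from L(1) show "(\<lambda>m. x ^ Suc m / (1 - q ^ Suc m)) sums lambert1 q x"
    unfolding lambert1_def by (simp add: summable_sums)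
  have "(\<Sum>m. 1 * (x * q ^ j) ^ Suc m) = x * q ^ j / (1 - x * q ^ j)" for j
  proof -
    have "norm q ^ j \<le> 1" using q by (simp add: power_le_one)
    then have y: "norm (x * q ^ j) < 1"
      using x mult_left_mono[of "norm q ^ j" 1 "norm x"] by (simp add: norm_mult norm_power)
    from sums_mult[OF geometric_sums[OF y], of "x * q ^ j"]
    show ?thesis by (simp add: sums_unique[symmetric])
  qed
  with L(2) show "(\<lambda>j. x * q ^ j / (1 - x * q ^ j)) sums lambert1 q x"
    unfolding lambert1_def by (simp only: mult_1)
qed

lemma lambert2_sums:
  assumes q: "norm q < 1" and x: "norm x < 1"
  shows "(\<lambda>m. of_nat (Suc m) * x ^ Suc m / (1 - q ^ Suc m)) sums lambert2 q x"
    and "(\<lambda>j. x * q ^ j / (1 - x * q ^ j) ^ 2) sums lambert2 q x"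
proof -
  have a: "summable (\<lambda>m. norm (of_nat (Suc m)::complex) * norm x ^ Suc m)"
    using summable_Suc_powser[of "norm x"] x by (simp only: norm_of_nat norm_ge_zero)
  note L = lambert_interchange[OF q x a]
  from L(1) show "(\<lambda>m. of_nat (Suc m) * x ^ Suc m / (1 - q ^ Suc m)) sums lambert2 q x"
    unfolding lambert2_def by (rule summable_sums)
  have "(\<Sum>m. of_nat (Suc m) * (x * q ^ j) ^ Suc m) = x * q ^ j / (1 - x * q ^ j) ^ 2" for j
  proof -
    have "norm q ^ j \<le> 1" using q by (simp add: power_le_one)
    then have y: "norm (x * q ^ j) < 1"
      using x mult_left_mono[of "norm q ^ j" 1 "norm x"] by (simp add: norm_mult norm_power)
    have "(\<lambda>m. of_nat (Suc m) * (x * q ^ j) ^ Suc m) sums (x * q ^ j * (1 / (1 - x * q ^ j) ^ 2))"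
      using sums_mult[OF geometric_deriv_sums[OF y], of "x * q ^ j"] by (simp only: power_Suc mult_ac)
    then show ?thesis by (simp add: sums_unique[symmetric])
  qed
  with L(2) show "(\<lambda>j. x * q ^ j / (1 - x * q ^ j) ^ 2) sums lambert2 q x"
    unfolding lambert2_def by (simp only:)
qed

lemma lambert1_step:
  assumes q: "norm q < 1" and x: "norm x < 1"
  shows "lambert1 q x = x / (1 - x) + lambert1 q (x * q)"
proof -
  have xq: "norm (x * q) < 1"
    using x q mult_strict_mono[of "norm x" 1 "norm q" 1] by (simp add: norm_mult)
  have "(\<lambda>j. x * q ^ Suc j / (1 - x * q ^ Suc j)) sums lambert1 q (x * q)"
    using lambert1_sums(2)[OF q xq] by (simp add: mult.assoc)
  from sums_Suc[OF this] show ?thesis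
    using lambert1_sums(2)[OF q x] by (simp add: sums_iff add.commute)
qed

lemma lambert2_step:
  assumes q: "norm q < 1" and x: "norm x < 1"
  shows "lambert2 q x = x / (1 - x) ^ 2 + lambert2 q (x * q)"
proof -
  have xq: "norm (x * q) < 1"
    using x q mult_strict_mono[of "norm x" 1 "norm q" 1] by (simp add: norm_mult)
  have "(\<lambda>j. x * q ^ Suc j / (1 - x * q ^ Suc j) ^ 2) sums lambert2 q (x * q)"
    using lambert2_sums(2)[OF q xq] by (simp add: mult.assoc)
  from sums_Suc[OF this] show ?thesis
    using lambert2_sums(2)[OF q x] by (simp add: sums_iff add.commute)
qed

lemma lambert1_has_field_derivative:
  assumes q: "norm q < 1" and x: "norm x < 1" "x \<noteq> 0"
  shows "(lambert1 q has_field_derivative lambert2 q x / x) (at x)"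
proof -
  \<comment> \<open>\<open>c 0 = 1 / 0 = 0\<close>, so the power series has no constant term\<close>
  define c where "c n = 1 / (1 - q ^ n)" for n
  have c: "(\<lambda>n. c n * y ^ n) sums lambert1 q y" if "norm y < 1" for y
    using sums_Suc[where f = "\<lambda>n. c n * y ^ n", of "lambert1 q y"] lambert1_sums(1)[OF q that]
    by (simp add: c_def)
  obtain K where K: "norm x < K" "K < 1" using dense x by blast
  then have Kpos: "0 < K" using norm_ge_zero[of x] by linarith
  have "((\<lambda>x. \<Sum>n. c n * x ^ n) has_field_derivative (\<Sum>n. diffs c n * x ^ n)) (at x)"
    using K Kpos sums_summable[OF c[of "of_real K"]] by (intro termdiffs_strong[of _ "of_real K"]) auto
  moreover have "(\<Sum>n. diffs c n * x ^ n) = lambert2 q x / x"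
  proof -
    have "(\<lambda>m. of_nat (Suc m) * x ^ Suc m / (1 - q ^ Suc m) / x) sums (lambert2 q x / x)"
      by (rule sums_divide[OF lambert2_sums(1)[OF q x(1)]])
    moreover have "of_nat (Suc m) * x ^ Suc m / (1 - q ^ Suc m) / x = diffs c m * x ^ m" for m
      using x(2) by (simp add: diffs_def c_def)
    ultimately show ?thesis by (simp add: sums_iff)
  qed
  ultimately have D: "((\<lambda>x. \<Sum>n. c n * x ^ n) has_field_derivative lambert2 q x / x) (at x)" by (simp only:)
  show ?thesis
  proof (rule has_field_derivative_transform_within_open[OF D])
    show "open (ball 0 1 :: complex set)" "x \<in> ball 0 1" using x by auto
    show "(\<Sum>n. c n * y ^ n) = lambert1 q y" if "y \<in> ball 0 1" for y
      using c[of y] that by (simp add: sums_iff)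
  qed
qed

section \<open>The logarithmic derivative of theta and its derivative\<close>

lemma qpoch_inf_deriv_lambert1:
  assumes q: "norm q < 1" and x: "norm x < 1"
  shows "deriv (\<lambda>x. qpoch_inf x q) x * x = - (qpoch_inf x q * lambert1 q x)"
proof -
  have nz: "qpoch_inf x q \<noteq> 0" by (rule qpoch_inf_nonzero'[OF q x])
  have "(\<lambda>j. - (x * (- (q ^ j / (1 - x * q ^ j))))) sums
      - (x * (deriv (\<lambda>x. qpoch_inf x q) x / qpoch_inf x q))"
    by (intro sums_minus sums_mult logderiv_qpoch_inf q nz)
  then have "lambert1 q x = - (x * (deriv (\<lambda>x. qpoch_inf x q) x / qpoch_inf x q))"
    using lambert1_sums(2)[OF q x] by (simp add: sums_iff)
  then show ?thesis using nz by (simp add: field_simps)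
qed

text \<open>A strip around the imaginary axis on which both Lambert series of
  \<open>theta_log_deriv\<close> converge, without the zeros of \<open>theta\<close>. It contains
  \<open>omega5\<close>, \<open>2 * omega5\<close> for nome \<open>q\<close> and \<open>l\<close>,
  \<open>2 * l\<close> for nome \<open>q ^ 5\<close>.\<close>

definition theta_domain :: "complex \<Rightarrow> complex set" where
  "theta_domain q = {z. norm (q * exp z) < 1 \<and> norm (q * exp (- z)) < 1 \<and> exp (z / 2) - exp (- z / 2) \<noteq> 0}"

lemma open_theta_domain: "open (theta_domain q)"
  unfolding theta_domain_def
  by (intro open_Collect_conj open_Collect_less open_Collect_neq continuous_intros) auto

lemma theta_nonzero:
  assumes "norm q < 1" "z \<in> theta_domain q"
  shows "theta q z \<noteq> 0"
  using assms qpoch_inf_nonzero'[OF assms(1)] by (simp add: theta_domain_def theta_def)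

text \<open>The function \<open>Z\<close> of the overview. The first term is coth(z/2)/2, from the
  elementary factor of \<open>theta\<close>.\<close>

definition theta_log_deriv :: "complex \<Rightarrow> complex \<Rightarrow> complex" where
  "theta_log_deriv q z = (exp (z / 2) + exp (- z / 2)) / (2 * (exp (z / 2) - exp (- z / 2)))
     - lambert1 q (q * exp z) + lambert1 q (q * exp (- z))"

definition theta_log_deriv2 :: "complex \<Rightarrow> complex \<Rightarrow> complex" where
  "theta_log_deriv2 q z = - 1 / (exp (z / 2) - exp (- z / 2)) ^ 2
     - lambert2 q (q * exp z) - lambert2 q (q * exp (- z))"

lemma deriv_theta:
  assumes q: "norm q < 1" and z: "z \<in> theta_domain q"
  shows "deriv (theta q) z = theta q z * theta_log_deriv q z"
proof (rule DERIV_imp_deriv)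
  define x y u where "x = q * exp z" and "y = q * exp (- z)" and "u = exp (z / 2) - exp (- z / 2)"
  have xy: "norm x < 1" "norm y < 1" and u: "u \<noteq> 0"
    using z by (auto simp: theta_domain_def x_def y_def u_def)
  let ?D = "deriv (\<lambda>x. qpoch_inf x q)"
  have D: "((\<lambda>x. qpoch_inf x q) has_field_derivative ?D x) (at x)" for x
    by (rule holomorphic_derivI[OF holomorphic_qpoch_inf[OF q]]) auto
  have V: "((\<lambda>z. qpoch_inf (q * exp z) q * qpoch_inf (q * exp (- z)) q) has_field_derivative
      (?D x * x * qpoch_inf y q + ?D y * (- y) * qpoch_inf x q)) (at z)"
    unfolding x_def y_def
    by (intro DERIV_mult DERIV_chain2[OF D]) (auto intro!: derivative_eq_intros)
  have U: "((\<lambda>z::complex. exp (z / 2) - exp (- z / 2)) has_field_derivative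
      (exp (z / 2) + exp (- z / 2)) / 2) (at z)"
    by (auto intro!: derivative_eq_intros simp: add_divide_distrib)
  have "(theta q has_field_derivative
      (exp (z / 2) + exp (- z / 2)) / 2 * (qpoch_inf x q * qpoch_inf y q) +
      (?D x * x * qpoch_inf y q + ?D y * (- y) * qpoch_inf x q) * u) (at z)"
    using DERIV_mult[OF U V] unfolding theta_def[abs_def] x_def y_def u_def .
  moreover have D_eq: "?D x * x * qpoch_inf y q + ?D y * (- y) * qpoch_inf x q
      = qpoch_inf x q * qpoch_inf y q * (lambert1 q y - lambert1 q x)"
    using qpoch_inf_deriv_lambert1[OF q xy(1)] qpoch_inf_deriv_lambert1[OF q xy(2)]
    by (simp add: algebra_simps)
  moreover have "(exp (z / 2) + exp (- z / 2)) / 2 * (qpoch_inf x q * qpoch_inf y q) +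
      qpoch_inf x q * qpoch_inf y q * (lambert1 q y - lambert1 q x) * u = theta q z * theta_log_deriv q z"
    unfolding theta_def theta_log_deriv_def x_def[symmetric] y_def[symmetric] u_def[symmetric]
    using u by (simp add: field_simps)
  ultimately show "(theta q has_field_derivative theta q z * theta_log_deriv q z) (at z)"
    by (simp only:)
qed

lemma theta_log_deriv_has_field_derivative:
  assumes q: "norm q < 1" "q \<noteq> 0" and z: "z \<in> theta_domain q"
  shows "(theta_log_deriv q has_field_derivative theta_log_deriv2 q z) (at z)"
proof -
  define x y u where "x = q * exp z" and "y = q * exp (- z)" and "u = exp (z / 2) - exp (- z / 2)"
  have xy: "norm x < 1" "norm y < 1" "x \<noteq> 0" "y \<noteq> 0" and u: "u \<noteq> 0"
    using z q by (auto simp: theta_domain_def x_def y_def u_def)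
  have 1: "((\<lambda>z. lambert1 q (q * exp z)) has_field_derivative lambert2 q x / x * x) (at z)"
    unfolding x_def using xy q
    by (intro DERIV_chain2[OF lambert1_has_field_derivative]) (auto simp: x_def intro!: derivative_eq_intros)
  have 2: "((\<lambda>z. lambert1 q (q * exp (- z))) has_field_derivative lambert2 q y / y * - y) (at z)"
    unfolding y_def using xy q
    by (intro DERIV_chain2[OF lambert1_has_field_derivative]) (auto simp: y_def intro!: derivative_eq_intros)
  define v where "v = exp (z / 2) + exp (- z / 2)"
  have vu: "v ^ 2 - u ^ 2 = 4"
    by (simp add: v_def u_def power2_eq_square algebra_simps flip: exp_add)
  have n: "((\<lambda>z::complex. exp (z / 2) + exp (- z / 2)) has_field_derivative u / 2) (at z)"
    unfolding u_def by (auto intro!: derivative_eq_intros simp: diff_divide_distrib)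
  have d: "((\<lambda>z::complex. 2 * (exp (z / 2) - exp (- z / 2))) has_field_derivative v) (at z)"
    unfolding v_def by (auto intro!: derivative_eq_intros simp: add_divide_distrib)
  have "((\<lambda>z::complex. (exp (z / 2) + exp (- z / 2)) / (2 * (exp (z / 2) - exp (- z / 2)))) has_field_derivative
      (u / 2 * (2 * u) - v * v) / ((2 * u) * (2 * u))) (at z)"
    using DERIV_divide[OF n d] u unfolding u_def v_def by simp
  also have "(u / 2 * (2 * u) - v * v) / ((2 * u) * (2 * u)) = - 1 / u ^ 2"
    using vu u by (simp add: field_simps power2_eq_square)
  finally have 3: "((\<lambda>z::complex. (exp (z / 2) + exp (- z / 2)) / (2 * (exp (z / 2) - exp (- z / 2))))
      has_field_derivative - 1 / u ^ 2) (at z)" .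
  have "(theta_log_deriv q has_field_derivative
      - 1 / u ^ 2 - lambert2 q x / x * x + lambert2 q y / y * - y) (at z)"
    unfolding theta_log_deriv_def[abs_def] by (intro DERIV_add DERIV_diff 1 2 3)
  then show ?thesis
    using xy unfolding theta_log_deriv2_def x_def[symmetric] y_def[symmetric] u_def[symmetric] by simp
qed

text \<open>Turns the right-hand side of \<open>theta_deriv2_diff\<close> into a difference of two
  values of \<open>Z'\<close>.\<close>

lemma deriv_deriv_theta:
  assumes q: "norm q < 1" "q \<noteq> 0" and z: "z \<in> theta_domain q"
  shows "theta q z * deriv (deriv (theta q)) z - deriv (theta q) z ^ 2 = theta q z ^ 2 * theta_log_deriv2 q z"
proof -
  have "((\<lambda>z. theta q z * theta_log_deriv q z) has_field_derivative
      deriv (theta q) z * theta_log_deriv q z + theta_log_deriv2 q z * theta q z) (at z)"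
    by (intro DERIV_mult theta_has_field_derivative theta_log_deriv_has_field_derivative q z)
  then have "(deriv (theta q) has_field_derivative
      deriv (theta q) z * theta_log_deriv q z + theta_log_deriv2 q z * theta q z) (at z)"
    by (rule has_field_derivative_transform_within_open[OF _ open_theta_domain z])
      (simp add: deriv_theta[OF q(1)])
  then have "deriv (deriv (theta q)) z = deriv (theta q) z * theta_log_deriv q z + theta_log_deriv2 q z * theta q z"
    by (rule DERIV_imp_deriv)
  then show ?thesis by (simp add: deriv_theta[OF q(1) z] power2_eq_square algebra_simps)
qed

subsection \<open>Fifth roots of unity\<close>

lemma deriv_theta_minus:
  assumes "norm q < 1"
  shows "deriv (theta q) (- z) = deriv (theta q) z"
proof -
  note D = theta_has_field_derivative[OF assms]
  have "((\<lambda>s. - theta q s) has_field_derivative - deriv (theta q) (- z)) (at z)"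
    using has_field_derivative_affine[OF D, of 0 "- 1" z] by (simp add: theta_minus)
  from DERIV_unique[OF this DERIV_minus[OF D]] show ?thesis by simp
qed

lemma deriv_theta_plus_2pi:
  assumes "norm q < 1"
  shows "deriv (theta q) (z + 2 * pi * \<i>) = - deriv (theta q) z"
proof -
  note D = theta_has_field_derivative[OF assms]
  have "((\<lambda>s. theta q (2 * pi * \<i> + 1 * s)) has_field_derivative deriv (theta q) (2 * pi * \<i> + 1 * z) * 1) (at z)"
    by (rule has_field_derivative_affine[OF D])
  moreover have "theta q (2 * pi * \<i> + 1 * s) = - theta q s" for s
    using theta_plus_2pi[of q s] by (simp add: add.commute)
  ultimately have "((\<lambda>s. - theta q s) has_field_derivative deriv (theta q) (2 * pi * \<i> + 1 * z) * 1) (at z)"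
    by (simp only:)
  from DERIV_unique[OF this DERIV_minus[OF D]] show ?thesis by (simp add: add.commute)
qed

lemma deriv_theta_plus_quasiperiod:
  assumes l: "Re l < 0"
  shows "deriv (theta (exp l)) (z + l) = - (exp (- l / 2 - z) * (deriv (theta (exp l)) z - theta (exp l) z))"
proof -
  have "norm (exp l) < 1" using l by simp
  note D = theta_has_field_derivative[OF this]
  let ?t = "theta (exp l)"
  have "((\<lambda>s. ?t (l + 1 * s)) has_field_derivative deriv ?t (l + 1 * z) * 1) (at z)"
    by (rule has_field_derivative_affine[OF D])
  moreover have "?t (l + 1 * s) = - (exp (- l / 2 - s) * ?t s)" for s
    using theta_plus_quasiperiod[OF l, of s] by (simp add: add.commute)
  ultimately have "((\<lambda>s. - (exp (- l / 2 - s) * ?t s)) has_field_derivative deriv ?t (l + 1 * z) * 1) (at z)"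
    by (simp only:)
  moreover have "((\<lambda>s. - (exp (- l / 2 - s) * ?t s)) has_field_derivative
     - (exp (- l / 2 - z) * (deriv ?t z - ?t z))) (at z)"
    by (rule derivative_eq_intros D refl)+ (simp add: algebra_simps)
  ultimately have "deriv ?t (l + 1 * z) * 1 = - (exp (- l / 2 - z) * (deriv ?t z - ?t z))"
    by (rule DERIV_unique)
  then show ?thesis by (simp add: add.commute)
qed

definition omega5 :: complex where "omega5 = 2 * pi * \<i> / 5"

definition zeta5 :: complex where "zeta5 = exp omega5"

text \<open>The quadratic Gauss sum modulo 5, a square root of 5.\<close>

definition gauss5 :: complex where "gauss5 = zeta5 + zeta5 ^ 4 - zeta5 ^ 2 - zeta5 ^ 3"

lemma five_omega5: "5 * omega5 = 2 * pi * \<i>" by (simp add: omega5_def)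

lemma zeta5_power: "zeta5 ^ k = exp (of_nat k * omega5)"
  by (simp add: zeta5_def exp_of_nat_mult)

lemma zeta5_power5: "zeta5 ^ 5 = 1"
  by (simp add: zeta5_power five_omega5 exp_eq_1)

lemma norm_zeta5 [simp]: "norm zeta5 = 1"
  by (simp add: zeta5_def omega5_def)

lemma zeta5_cyclotomic: "1 + zeta5 + zeta5 ^ 2 + zeta5 ^ 3 + zeta5 ^ 4 = 0"
proof -
  have "zeta5 \<noteq> 1"
  proof
    assume "zeta5 = 1"
    then obtain n :: int where "2 * pi / 5 = of_int (2 * n) * pi"
      unfolding zeta5_def exp_eq_1 omega5_def by auto
    then have "of_int (5 * n) = (1::real)" using pi_gt_zero by (simp add: field_simps)
    then have "5 * n = 1" by (simp only: of_int_eq_1_iff)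
    then show False by presburger
  qed
  moreover have "(zeta5 - 1) * (1 + zeta5 + zeta5 ^ 2 + zeta5 ^ 3 + zeta5 ^ 4) = zeta5 ^ 5 - 1"
    by (simp add: algebra_simps eval_nat_numeral)
  ultimately show ?thesis using zeta5_power5 by simp
qed

text \<open>\<open>r\<close> and \<open>p\<close> are the elementary factors of \<open>theta\<close>
  at \<open>omega5\<close> and at \<open>2 * omega5\<close>, in this crossed order because
  \<open>exp (omega5 / 2)\<close> is \<open>- (zeta5 ^ 3)\<close>. Their squares and product lie in
  the quadratic field generated by \<open>gauss5\<close>, so later computations reduce to that
  field.\<close>

lemma gauss5_relations:
  defines "p \<equiv> zeta5 - zeta5 ^ 4" and "r \<equiv> zeta5 ^ 2 - zeta5 ^ 3"
  shows "p * r = - gauss5" "2 * p ^ 2 = - 5 - gauss5" "2 * r ^ 2 = - 5 + gauss5" "gauss5 ^ 2 = 5"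
proof -
  let ?z = zeta5
  have z: "?z ^ 6 = ?z" "?z ^ 7 = ?z ^ 2" "?z ^ 8 = ?z ^ 3"
    using power_add[of ?z 5 1] power_add[of ?z 5 2] power_add[of ?z 5 3] by (simp_all add: zeta5_power5)
  have "p * r = ?z ^ 3 - ?z ^ 4 - ?z ^ 6 + ?z ^ 7"
    unfolding p_def r_def by (simp add: algebra_simps eval_nat_numeral)
  then show pr: "p * r = - gauss5" by (simp add: z gauss5_def)
  have "p ^ 2 = ?z ^ 2 - 2 * ?z ^ 5 + ?z ^ 8"
    unfolding p_def by (simp add: algebra_simps eval_nat_numeral)
  then have "2 * p ^ 2 + 5 + gauss5 = 1 + ?z + ?z ^ 2 + ?z ^ 3 + ?z ^ 4"
    by (simp add: z zeta5_power5 gauss5_def)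
  then show p2: "2 * p ^ 2 = - 5 - gauss5" unfolding zeta5_cyclotomic by (simp add: eq_neg_iff_add_eq_0 algebra_simps)
  have "r ^ 2 = ?z ^ 4 - 2 * ?z ^ 5 + ?z ^ 6"
    unfolding r_def by (simp add: algebra_simps eval_nat_numeral)
  then have "2 * r ^ 2 + 5 - gauss5 = 1 + ?z + ?z ^ 2 + ?z ^ 3 + ?z ^ 4"
    by (simp add: z zeta5_power5 gauss5_def)
  then show r2: "2 * r ^ 2 = - 5 + gauss5" unfolding zeta5_cyclotomic by (simp add: algebra_simps)
  have "4 * gauss5 ^ 2 = (2 * p ^ 2) * (2 * r ^ 2)"
    using arg_cong[OF pr, of "\<lambda>x. 4 * x ^ 2"] by (simp add: power_mult_distrib)
  also have "\<dots> = 25 - gauss5 ^ 2" unfolding p2 r2 by (simp add: algebra_simps power2_eq_square)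
  finally show "gauss5 ^ 2 = 5" by simp
qed

lemma gauss5_nonzero: "gauss5 \<noteq> 0"
  using gauss5_relations(4) by auto

text \<open>Half of \<open>omega5\<close> differs from \<open>3 * omega5\<close> by pi i, so even
  the half-arguments give powers of \<open>zeta5\<close>, at the cost of a sign.\<close>

lemma exp_omega5:
  "exp (omega5 / 2) = - (zeta5 ^ 3)" "exp (- omega5 / 2) = - (zeta5 ^ 2)"
  "exp (2 * omega5 / 2) = zeta5" "exp (- (2 * omega5) / 2) = zeta5 ^ 4"
  "exp omega5 = zeta5" "exp (- omega5) = zeta5 ^ 4"
  "exp (2 * omega5) = zeta5 ^ 2" "exp (- (2 * omega5)) = zeta5 ^ 3"
proof -
  have m: "exp (- (of_nat k * omega5)) = zeta5 ^ j" if "k + j = 5" for k j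
  proof -
    have "exp (of_nat k * omega5) * zeta5 ^ j = 1"
      using that zeta5_power5 by (simp add: zeta5_power[symmetric] power_add[symmetric])
    then show ?thesis by (simp add: exp_minus field_simps)
  qed
  have "of_nat 3 * omega5 = omega5 / 2 + \<i> * pi" by (simp add: omega5_def field_simps)
  then have "zeta5 ^ 3 = - exp (omega5 / 2)" unfolding zeta5_power by (simp only: exp_add) simp
  then show "exp (omega5 / 2) = - (zeta5 ^ 3)" by simp
  have "of_nat 2 * omega5 = - omega5 / 2 + \<i> * pi" by (simp add: omega5_def field_simps)
  then have "zeta5 ^ 2 = - exp (- omega5 / 2)" unfolding zeta5_power by (simp only: exp_add) simp
  then show "exp (- omega5 / 2) = - (zeta5 ^ 2)" by simp
  show "exp (2 * omega5 / 2) = zeta5" "exp omega5 = zeta5" by (simp_all add: zeta5_def)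
  show "exp (- (2 * omega5) / 2) = zeta5 ^ 4" "exp (- omega5) = zeta5 ^ 4" using m[of 1 4] by simp_all
  show "exp (2 * omega5) = zeta5 ^ 2" by (simp add: zeta5_power)
  show "exp (- (2 * omega5)) = zeta5 ^ 3" using m[of 2 3] by simp
qed

section \<open>Lambert series sorted by residues modulo 5\<close>

lemma sums_group5:
  fixes f :: "nat \<Rightarrow> complex"
  assumes "f sums s"
  shows "(\<lambda>n. f (5 * n) + f (5 * n + 1) + f (5 * n + 2) + f (5 * n + 3) + f (5 * n + 4)) sums s"
proof -
  have "(\<lambda>n. sum f {n * 5..<n * 5 + 5}) sums s" by (rule sums_group[OF assms]) simp
  moreover have "sum f {n * 5..<n * 5 + 5} = f (5 * n) + f (5 * n + 1) + f (5 * n + 2) + f (5 * n + 3) + f (5 * n + 4)" for n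
  proof -
    have "sum f {0 + n * 5..<5 + n * 5} = (\<Sum>i=0..<5. f (i + n * 5))" by (rule sum.shift_bounds_nat_ivl)
    also have "\<dots> = f (0 + n * 5) + f (1 + n * 5) + f (2 + n * 5) + f (3 + n * 5) + f (4 + n * 5)"
      by (simp add: eval_nat_numeral)
    finally show ?thesis by (simp add: add.commute mult.commute)
  qed
  ultimately show ?thesis by (simp only:)
qed

lemma Legendre_5:
  "Legendre (int n) 5 = (if n mod 5 = 0 then 0 else if n mod 5 = 1 \<or> n mod 5 = 4 then 1 else - 1)"
proof -
  have q: "QuadRes 5 (int n) \<longleftrightarrow> n mod 5 = 0 \<or> n mod 5 = 1 \<or> n mod 5 = 4"
  proof
    assume "QuadRes 5 (int n)"
    then obtain y where "[y ^ 2 = int n] (mod 5)" by (auto simp: QuadRes_def)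
    then have eq: "int (n mod 5) = (y mod 5) ^ 2 mod 5" by (simp add: cong_def power_mod zmod_int)
    have "y mod 5 \<in> {0, 1, 2, 3, 4}" by auto
    then show "n mod 5 = 0 \<or> n mod 5 = 1 \<or> n mod 5 = 4" using eq by auto
  next
    assume "n mod 5 = 0 \<or> n mod 5 = 1 \<or> n mod 5 = 4"
    then have "int n mod 5 = 0 ^ 2 mod 5 \<or> int n mod 5 = 1 ^ 2 mod 5 \<or> int n mod 5 = 2 ^ 2 mod 5"
      by (auto simp: zmod_int[of n 5, simplified, symmetric])
    then show "QuadRes 5 (int n)" unfolding QuadRes_def cong_def
      by (elim disjE) (rule exI, rule sym, assumption)+
  qed
  have "[int n = 0] (mod 5) \<longleftrightarrow> n mod 5 = 0"
    by (simp add: cong_def) presburger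
  then show ?thesis unfolding Legendre_def q by auto
qed

text \<open>The bridge between the nomes: \<open>x ^ n\<close> depends only on
  \<open>n mod 5\<close>, and the terms \<open>q ^ n / (1 - q ^ n)\<close> with \<open>n\<close> in
  the class of \<open>r\<close> add up to \<open>lambert1 (q ^ 5) (q ^ r)\<close>.\<close>

lemma lambert1_root_of_unity:
  assumes q: "norm q < 1" and x: "norm x = 1" "x ^ 5 = 1"
  shows "lambert1 q (q * x) = x * lambert1 (q ^ 5) q + x ^ 2 * lambert1 (q ^ 5) (q ^ 2)
     + x ^ 3 * lambert1 (q ^ 5) (q ^ 3) + x ^ 4 * lambert1 (q ^ 5) (q ^ 4) + lambert1 (q ^ 5) (q ^ 5)"
proof -
  define g where "g n = q ^ n / (1 - q ^ n)" for n
  have pw: "norm (q ^ m) < 1" if "m > 0" for m by (rule norm_power_less_one[OF q that])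
  have L: "(\<lambda>n. g (5 * n + r)) sums lambert1 (q ^ 5) (q ^ r)" if "r > 0" for r
    using lambert1_sums(2)[of "q ^ 5" "q ^ r"] pw[of 5] pw[OF that]
    by (simp add: g_def power_add power_mult mult.commute[of _ "q ^ r"])
  have "norm (q * x) < 1" using q x by (simp add: norm_mult)
  from lambert1_sums(1)[OF q this]
  have "(\<lambda>m. x ^ Suc m * g (Suc m)) sums lambert1 q (q * x)"
    by (simp add: g_def power_mult_distrib mult_ac)
  from sums_group5[OF this]
  have 1: "(\<lambda>n. x ^ Suc (5 * n) * g (Suc (5 * n)) + x ^ Suc (5 * n + 1) * g (Suc (5 * n + 1)) + x ^ Suc (5 * n + 2) * g (Suc (5 * n + 2))
     + x ^ Suc (5 * n + 3) * g (Suc (5 * n + 3)) + x ^ Suc (5 * n + 4) * g (Suc (5 * n + 4))) sums lambert1 q (q * x)" .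
  have xp: "x ^ (5 * n + r) = x ^ r" for n r by (simp add: power_add power_mult x)
  have e: "x ^ Suc (5 * n) * g (Suc (5 * n)) + x ^ Suc (5 * n + 1) * g (Suc (5 * n + 1)) + x ^ Suc (5 * n + 2) * g (Suc (5 * n + 2))
     + x ^ Suc (5 * n + 3) * g (Suc (5 * n + 3)) + x ^ Suc (5 * n + 4) * g (Suc (5 * n + 4))
     = x * g (5 * n + 1) + x ^ 2 * g (5 * n + 2) + x ^ 3 * g (5 * n + 3) + x ^ 4 * g (5 * n + 4) + 1 * g (5 * n + 5)" for n
  proof -
    have s: "Suc (5 * n) = 5 * n + 1" "Suc (5 * n + 1) = 5 * n + 2" "Suc (5 * n + 2) = 5 * n + 3"
      "Suc (5 * n + 3) = 5 * n + 4" "Suc (5 * n + 4) = 5 * n + 5" by simp_all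
    show ?thesis unfolding s xp x(2) by simp
  qed
  have "(\<lambda>n. x * g (5 * n + 1) + x ^ 2 * g (5 * n + 2) + x ^ 3 * g (5 * n + 3) + x ^ 4 * g (5 * n + 4) + 1 * g (5 * n + 5)) sums
     (x * lambert1 (q ^ 5) (q ^ 1) + x ^ 2 * lambert1 (q ^ 5) (q ^ 2)
     + x ^ 3 * lambert1 (q ^ 5) (q ^ 3) + x ^ 4 * lambert1 (q ^ 5) (q ^ 4) + 1 * lambert1 (q ^ 5) (q ^ 5))"
    by (intro sums_add sums_mult L) simp_all
  with 1 show ?thesis unfolding e by (simp add: sums_iff)
qed

lemma summable_legendre_lambert:
  fixes q :: complex
  assumes q: "norm q < 1"
  shows "summable (\<lambda>j. of_int (Legendre (int (Suc j)) 5) * (q ^ Suc j / (1 - q ^ Suc j) ^ 2))" (is "summable ?f")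
    and "summable (\<lambda>j. of_int (Legendre (int (Suc j)) 5) * (of_nat (Suc j) * q ^ Suc j / (1 - q ^ Suc j)))" (is "summable ?g")
proof -
  have leg: "norm (of_int (Legendre (int n) 5) :: complex) \<le> 1" for n
    unfolding Legendre_5 by simp
  have pos: "1 - norm q > 0" using q by simp
  show "summable ?f"
  proof (rule summable_comparison_test')
    show "summable (\<lambda>j. norm q ^ Suc j * (1 / (1 - norm q) ^ 2))"
      using q by (intro summable_mult2) (simp add: summable_mult summable_geometric)
    fix j :: nat
    have "norm (q ^ Suc j / (1 - q ^ Suc j) ^ 2) \<le> norm q ^ Suc j * (1 / (1 - norm q) ^ 2)"
    proof -
      have "(1 - norm q) ^ 2 \<le> norm (1 - q ^ Suc j) ^ 2"
        using pos norm_one_minus_power_ge[OF q, of j] by (intro power_mono) auto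
      then have "norm q ^ Suc j / norm (1 - q ^ Suc j) ^ 2 \<le> norm q ^ Suc j / (1 - norm q) ^ 2"
        using pos by (intro frac_le) auto
      then show ?thesis by (simp only: norm_divide norm_power) simp
    qed
    with mult_mono[OF leg[of "Suc j"] this] 
    show "norm (?f j) \<le> norm q ^ Suc j * (1 / (1 - norm q) ^ 2)"
      by (simp only: norm_mult mult_1 norm_ge_zero zero_le_one)
  qed
  show "summable ?g"
  proof (rule summable_comparison_test')
    show "summable (\<lambda>j. (real (Suc j) * norm q ^ Suc j) * (1 / (1 - norm q)))"
      using q by (intro summable_mult2 summable_Suc_powser) auto
    fix j :: nat
    have "norm (of_nat (Suc j) * q ^ Suc j / (1 - q ^ Suc j)) \<le> (real (Suc j) * norm q ^ Suc j) * (1 / (1 - norm q))"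
    proof -
      have "(real (Suc j) * norm q ^ Suc j) / norm (1 - q ^ Suc j) \<le> (real (Suc j) * norm q ^ Suc j) / (1 - norm q)"
        using pos norm_one_minus_power_ge[OF q, of j] by (intro frac_le) auto
      then show ?thesis by (simp only: norm_divide norm_power norm_mult norm_of_nat) simp
    qed
    with mult_mono[OF leg[of "Suc j"] this]
    show "norm (?g j) \<le> (real (Suc j) * norm q ^ Suc j) * (1 / (1 - norm q))"
      by (simp only: norm_mult[of "of_int _"] mult_1 norm_ge_zero zero_le_one)
  qed
qed

lemma legendre_lambert_eq_lambert2:
  fixes q :: complex
  assumes q: "norm q < 1"
  shows "(\<Sum>j. of_int (Legendre (int (Suc j)) 5) * (q ^ Suc j / (1 - q ^ Suc j) ^ 2))
     = lambert2 (q ^ 5) q - lambert2 (q ^ 5) (q ^ 2) - lambert2 (q ^ 5) (q ^ 3) + lambert2 (q ^ 5) (q ^ 4)"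
proof -
  define g where "g n = q ^ n / (1 - q ^ n) ^ 2" for n
  have pw: "norm (q ^ m) < 1" if "m > 0" for m by (rule norm_power_less_one[OF q that])
  have L: "(\<lambda>n. g (5 * n + r)) sums lambert2 (q ^ 5) (q ^ r)" if "r > 0" for r
    using lambert2_sums(2)[of "q ^ 5" "q ^ r"] pw[of 5] pw[OF that]
    by (simp add: g_def power_add power_mult mult.commute[of _ "q ^ r"])
  let ?S = "\<Sum>j. of_int (Legendre (int (Suc j)) 5) * (q ^ Suc j / (1 - q ^ Suc j) ^ 2)"
  have "(\<lambda>j. of_int (Legendre (int (Suc j)) 5) * g (Suc j)) sums ?S"
    unfolding g_def by (rule summable_sums[OF summable_legendre_lambert(1)[OF q]])
  from sums_group5[OF this]
  have 1: "(\<lambda>n. g (5 * n + 1) - g (5 * n + 2) - g (5 * n + 3) + g (5 * n + 4)) sums ?S"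
  proof (rule sums_cong[THEN iffD1, rotated])
    fix n
    have s: "Suc (5 * n) = 5 * n + 1" "Suc (5 * n + 1) = 5 * n + 2" "Suc (5 * n + 2) = 5 * n + 3"
      "Suc (5 * n + 3) = 5 * n + 4" "Suc (5 * n + 4) = 5 * n + 5" by simp_all
    have m: "(5 * n + 1) mod 5 = 1" "(5 * n + 2) mod 5 = 2" "(5 * n + 3) mod 5 = 3"
      "(5 * n + 4) mod 5 = 4" "(5 * n + 5) mod 5 = 0" by presburger+
    show "of_int (Legendre (int (Suc (5 * n))) 5) * g (Suc (5 * n)) +
        of_int (Legendre (int (Suc (5 * n + 1))) 5) * g (Suc (5 * n + 1)) +
        of_int (Legendre (int (Suc (5 * n + 2))) 5) * g (Suc (5 * n + 2)) +
        of_int (Legendre (int (Suc (5 * n + 3))) 5) * g (Suc (5 * n + 3)) +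
        of_int (Legendre (int (Suc (5 * n + 4))) 5) * g (Suc (5 * n + 4))
      = g (5 * n + 1) - g (5 * n + 2) - g (5 * n + 3) + g (5 * n + 4)"
      unfolding s Legendre_5 m by simp
  qed
  have "(\<lambda>n. g (5 * n + 1) - g (5 * n + 2) - g (5 * n + 3) + g (5 * n + 4)) sums
    (lambert2 (q ^ 5) (q ^ 1) - lambert2 (q ^ 5) (q ^ 2) - lambert2 (q ^ 5) (q ^ 3) + lambert2 (q ^ 5) (q ^ 4))"
    by (intro sums_add sums_diff L) simp_all
  from sums_unique2[OF 1 this] show ?thesis by simp
qed

text \<open>Multiplying the exponents by \<open>n\<close> permutes the squares 1, 4 and the
  nonsquares 2, 3 modulo 5 or exchanges the two pairs; for \<open>n\<close> divisible by 5 the four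
  terms cancel.\<close>

lemma gauss5_legendre:
  "zeta5 ^ n + (zeta5 ^ 4) ^ n - (zeta5 ^ 2) ^ n - (zeta5 ^ 3) ^ n = gauss5 * of_int (Legendre (int n) 5)"
proof -
  have r: "zeta5 ^ m = zeta5 ^ (m mod 5)" for m
  proof -
    have "zeta5 ^ m = zeta5 ^ (5 * (m div 5) + m mod 5)" by simp
    then show ?thesis unfolding power_add power_mult zeta5_power5 by simp
  qed
  have k: "(zeta5 ^ k) ^ n = zeta5 ^ (k * (n mod 5) mod 5)" for k
    using r[of "k * n"] by (simp add: power_mult[symmetric] mod_mult_right_eq)
  have "n mod 5 = 0 \<or> n mod 5 = 1 \<or> n mod 5 = 2 \<or> n mod 5 = 3 \<or> n mod 5 = 4" by presburger
  then show ?thesis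
    using k[of 1] unfolding k[of 2] k[of 3] k[of 4] Legendre_5 gauss5_def by (elim disjE) simp_all
qed

section \<open>Theta values at fifth roots of unity, nome q\<close>

locale quintic =
  fixes l q E1 E5 :: complex
  assumes Re_l: "Re l < 0" and q_eq: "q = exp l"
    and E1_eq: "E1 = qpoch_inf q q" and E5_eq: "E5 = qpoch_inf (q ^ 5) (q ^ 5)"
begin

lemma norm_q: "norm q < 1" and q_nonzero: "q \<noteq> 0"
  using Re_l by (simp_all add: q_eq)

lemma norm_q5: "norm (q ^ 5) < 1"
  using norm_q by (rule norm_power_less_one) simp

lemma q5_eq: "q ^ 5 = exp (5 * l)"
  by (simp add: q_eq exp_of_nat_mult[symmetric])

lemma Re_5l: "Re (5 * l) < 0" using Re_l by simp

lemma E1_nonzero: "E1 \<noteq> 0" and E5_nonzero: "E5 \<noteq> 0"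
  by (simp_all add: E1_eq E5_eq qpoch_inf_nonzero' norm_q norm_q5)

definition t1 where "t1 = theta q omega5"
definition t2 where "t2 = theta q (2 * omega5)"
definition Z1 where "Z1 = theta_log_deriv q omega5"
definition Z2 where "Z2 = theta_log_deriv q (2 * omega5)"

lemma omega5_domain: "omega5 \<in> theta_domain q" "2 * omega5 \<in> theta_domain q"
proof -
  have "zeta5 - zeta5 ^ 4 \<noteq> 0" "zeta5 ^ 2 - zeta5 ^ 3 \<noteq> 0"
    using gauss5_relations(1) gauss5_nonzero by auto
  then show "omega5 \<in> theta_domain q" "2 * omega5 \<in> theta_domain q"
    unfolding theta_domain_def mem_Collect_eq exp_omega5
    using norm_q by (auto simp: norm_mult norm_power)
qed

lemma deriv_t: "deriv (theta q) omega5 = t1 * Z1" "deriv (theta q) (2 * omega5) = t2 * Z2"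
  unfolding t1_def t2_def Z1_def Z2_def by (rule deriv_theta[OF norm_q omega5_domain(1)],
      rule deriv_theta[OF norm_q omega5_domain(2)])

lemma t_nonzero: "t1 \<noteq> 0" "t2 \<noteq> 0"
  unfolding t1_def t2_def by (rule theta_nonzero[OF norm_q omega5_domain(1)],
      rule theta_nonzero[OF norm_q omega5_domain(2)])

text \<open>Since \<open>5 * omega5\<close> is the period, the multiples 3, 4, 6 reduce to -2, -1,
  1; each reduction flips the sign of \<open>theta\<close>.\<close>

lemma theta_omega5:
  "theta q (3 * omega5) = t2" "theta q (4 * omega5) = t1" "theta q (6 * omega5) = - t1"
  "deriv (theta q) (3 * omega5) = - (t2 * Z2)" "deriv (theta q) (4 * omega5) = - (t1 * Z1)"
  "deriv (theta q) (6 * omega5) = - (t1 * Z1)"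
proof -
  have e: "3 * omega5 = - (2 * omega5) + 2 * pi * \<i>" "4 * omega5 = - omega5 + 2 * pi * \<i>"
    "6 * omega5 = omega5 + 2 * pi * \<i>"
    unfolding five_omega5[symmetric] by simp_all
  show "theta q (3 * omega5) = t2" "theta q (4 * omega5) = t1" "theta q (6 * omega5) = - t1"
    unfolding e theta_plus_2pi theta_minus t1_def t2_def by simp_all
  show "deriv (theta q) (3 * omega5) = - (t2 * Z2)" "deriv (theta q) (4 * omega5) = - (t1 * Z1)"
    "deriv (theta q) (6 * omega5) = - (t1 * Z1)"
    unfolding e deriv_theta_plus_2pi[OF norm_q] deriv_theta_minus[OF norm_q] deriv_t by simp_all
qed

lemma deriv_theta_0_E1: "deriv (theta q) 0 = E1 ^ 2"
  unfolding E1_eq by (rule deriv_theta_0[OF norm_q])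

text \<open>The product formula with three arguments \<open>omega5\<close>: the logarithmic
  derivative is odd and has period 2 pi i, so its value at \<open>3 * omega5\<close> is
  \<open>- Z2\<close>. In \<open>three_Z2_minus_Z1\<close> the point \<open>6 * omega5\<close>
  reduces to \<open>omega5\<close>.\<close>

lemma three_Z1_plus_Z2: "(3 * Z1 + Z2) * t1 ^ 3 = E1 ^ 2 * t2 ^ 2"
proof -
  have "omega5 + omega5 + omega5 = 3 * omega5" "omega5 + omega5 = 2 * omega5" by simp_all
  with theta_deriv_sum[OF Re_l, of omega5 omega5 omega5]
  have "t1 * Z1 * t1 * t1 * t2 + t1 * (t1 * Z1) * t1 * t2 + t1 * t1 * (t1 * Z1) * t2 - t1 * t1 * t1 * - (t2 * Z2)
     = E1 ^ 2 * t2 * t2 * t2"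
    by (simp only: q_eq[symmetric] theta_omega5 deriv_t deriv_theta_0_E1 t1_def[symmetric] t2_def[symmetric])
  then have "t2 * ((3 * Z1 + Z2) * t1 ^ 3) = t2 * (E1 ^ 2 * t2 ^ 2)"
    by (simp add: algebra_simps power2_eq_square power3_eq_cube)
  then show ?thesis using t_nonzero by simp
qed

lemma three_Z2_minus_Z1: "(3 * Z2 - Z1) * t2 ^ 3 = - (E1 ^ 2 * t1 ^ 2)"
proof -
  have "2 * omega5 + 2 * omega5 + 2 * omega5 = 6 * omega5" "2 * omega5 + 2 * omega5 = 4 * omega5" by simp_all
  with theta_deriv_sum[OF Re_l, of "2 * omega5" "2 * omega5" "2 * omega5"]
  have "t2 * Z2 * t2 * t2 * - t1 + t2 * (t2 * Z2) * t2 * - t1 + t2 * t2 * (t2 * Z2) * - t1 - t2 * t2 * t2 * - (t1 * Z1)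
     = E1 ^ 2 * t1 * t1 * t1"
    by (simp only: q_eq[symmetric] theta_omega5 deriv_t deriv_theta_0_E1 t1_def[symmetric] t2_def[symmetric])
  then have "t1 * ((3 * Z2 - Z1) * t2 ^ 3) = t1 * - (E1 ^ 2 * t1 ^ 2)"
    by (simp add: algebra_simps power2_eq_square power3_eq_cube)
  then show ?thesis using t_nonzero by (simp only: mult_cancel_left) simp
qed

text \<open>Together with \<open>E1\<close> the four infinite products run over all fifth roots of
  unity and collapse to \<open>E5\<close>; the elementary factors multiply to
  \<open>- gauss5\<close>.\<close>

lemma t1_t2: "t1 * t2 * E1 = - (gauss5 * E5)"
proof -
  have "(\<Prod>r<5. 1 - zeta5 ^ r * x) = 1 - x ^ 5" for x
  proof -
    let ?z = zeta5
    have z: "?z ^ 6 = ?z" "?z ^ 7 = ?z ^ 2"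
      using power_add[of ?z 5 1] power_add[of ?z 5 2] by (simp_all add: zeta5_power5)
    have "(1 - ?z * x) * (1 - ?z ^ 4 * x) = 1 - (?z + ?z ^ 4) * x + x ^ 2"
      using zeta5_power5 by (simp add: algebra_simps eval_nat_numeral)
    moreover have "(1 - ?z ^ 2 * x) * (1 - ?z ^ 3 * x) = 1 - (?z ^ 2 + ?z ^ 3) * x + x ^ 2"
      using zeta5_power5 by (simp add: algebra_simps eval_nat_numeral)
    moreover have "(?z + ?z ^ 4) = - 1 - (?z ^ 2 + ?z ^ 3)"
      using zeta5_cyclotomic by (simp add: algebra_simps eq_neg_iff_add_eq_0)
    moreover have "(?z + ?z ^ 4) * (?z ^ 2 + ?z ^ 3) = - 1"
    proof -
      have "(?z + ?z ^ 4) * (?z ^ 2 + ?z ^ 3) = ?z ^ 3 + ?z ^ 4 + ?z ^ 6 + ?z ^ 7"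
        by (simp add: algebra_simps eval_nat_numeral)
      then show ?thesis using zeta5_cyclotomic by (simp add: z algebra_simps eq_neg_iff_add_eq_0)
    qed
    \<comment> \<open>The conjugate pairs of roots give two real quadratics whose middle
      coefficients have sum and product -1.\<close>
    moreover have "(1 - x) * ((1 - a * x + x ^ 2) * (1 - b * x + x ^ 2)) = 1 - x ^ 5"
      if "a = - 1 - b" "a * b = - 1" for a b
    proof -
      have "(1 - a * x + x ^ 2) * (1 - b * x + x ^ 2) = 1 - (a + b) * x + (2 + a * b) * x ^ 2 - (a + b) * x ^ 3 + x ^ 4"
        by (simp add: algebra_simps eval_nat_numeral)
      also have "a + b = - 1" using that by simp
      finally have P: "(1 - a * x + x ^ 2) * (1 - b * x + x ^ 2)
          = 1 - - 1 * x + (2 + a * b) * x ^ 2 - - 1 * x ^ 3 + x ^ 4" .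
      show ?thesis unfolding P that(2) by (simp add: algebra_simps eval_nat_numeral)
    qed
    ultimately have "(1 - x) * (((1 - ?z * x) * (1 - ?z ^ 4 * x)) * ((1 - ?z ^ 2 * x) * (1 - ?z ^ 3 * x))) = 1 - x ^ 5"
      by (simp only:)
    then show ?thesis by (simp add: lessThan_Suc[of 4, simplified] prod.lessThan_Suc numeral_3_eq_3 numeral_2_eq_2 lessThan_nat_numeral mult_ac)
  qed
  from qpoch_inf_prod_eq[OF norm_q _ this, of q]
  have "(\<Prod>r<5. qpoch_inf (zeta5 ^ r * q) q) = E5" by (simp add: E5_eq)
  then have E: "E1 * (qpoch_inf (q * zeta5) q * qpoch_inf (q * zeta5 ^ 4) q *
      (qpoch_inf (q * zeta5 ^ 2) q * qpoch_inf (q * zeta5 ^ 3) q)) = E5"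
    by (simp add: E1_eq lessThan_nat_numeral mult_ac)
  have "t1 * t2 * E1 = (- (zeta5 ^ 3) - - (zeta5 ^ 2)) * (zeta5 - zeta5 ^ 4) *
     (E1 * (qpoch_inf (q * zeta5) q * qpoch_inf (q * zeta5 ^ 4) q *
      (qpoch_inf (q * zeta5 ^ 2) q * qpoch_inf (q * zeta5 ^ 3) q)))"
    unfolding t1_def t2_def theta_def exp_omega5 by (simp only: mult_ac)
  also have "(- (zeta5 ^ 3) - - (zeta5 ^ 2)) * (zeta5 - zeta5 ^ 4) = - gauss5"
    using gauss5_relations(1) by (simp add: algebra_simps)
  finally show ?thesis unfolding E by simp
qed

text \<open>Multiplying the two cubic relations leaves \<open>t1\<close> and \<open>t2\<close> only
  in the combination \<open>t1 * t2\<close>, which \<open>t1_t2\<close> evaluates.\<close>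

lemma E1_E5_quadratic: "gauss5 * E5 * ((3 * Z1 + Z2) * (3 * Z2 - Z1)) = E1 ^ 5"
proof -
  have "((3 * Z1 + Z2) * t1 ^ 3) * ((3 * Z2 - Z1) * t2 ^ 3) = (E1 ^ 2 * t2 ^ 2) * - (E1 ^ 2 * t1 ^ 2)"
    by (simp only: three_Z1_plus_Z2 three_Z2_minus_Z1)
  then have "(t1 * t2) ^ 2 * ((3 * Z1 + Z2) * (3 * Z2 - Z1) * (t1 * t2)) = (t1 * t2) ^ 2 * - (E1 ^ 4)"
    by (simp add: power_mult_distrib power2_eq_square power3_eq_cube power4_eq_xxxx algebra_simps)
  then have "(3 * Z1 + Z2) * (3 * Z2 - Z1) * (t1 * t2) = - (E1 ^ 4)"
    using t_nonzero by (simp only: mult_cancel_left) simp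
  then have "(3 * Z1 + Z2) * (3 * Z2 - Z1) * (t1 * t2 * E1) = - (E1 ^ 4 * E1)"
    by (metis mult.assoc mult_minus_left)
  also have "\<dots> = - (E1 ^ 5)" by (simp add: eval_nat_numeral)
  finally show ?thesis unfolding t1_t2 by (simp add: mult_ac)
qed

text \<open>This is \<open>sum_jacobi_prod_fifth_roots\<close> at \<open>z + \<i> * pi\<close>,
  multiplied by \<open>exp (5 * z / 2)\<close>. The alternating signs arise because the fifth power
  of \<open>exp (omega5 / 2)\<close> is -1.\<close>

lemma sum_theta_powers:
  "theta q z ^ 5 - theta q (z + omega5) ^ 5 + theta q (z + 2 * omega5) ^ 5 - theta q (z + 3 * omega5) ^ 5
     + theta q (z + 4 * omega5) ^ 5 = 5 * CPhi 5 q * (E5 * theta (q ^ 5) (5 * z))"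
proof -
  have C: "CPhi 5 q = charge_coeff 5 q 0"
    unfolding CPhi_def by (rule sums_unique[OF sums_cphi[OF norm_q], symmetric])
  have c: "cis (2 * pi / 5) = zeta5"
    by (simp add: zeta5_def omega5_def cis_conv_exp mult_ac)
  have J: "jacobi_prod q (- (zeta5 ^ r * exp (z + \<i> * pi))) = jacobi_prod q (exp (z + of_nat r * omega5))" for r
    by (simp add: zeta5_power exp_add mult_ac)
  have S: "(\<Sum>r<5. jacobi_prod q (exp (z + of_nat r * omega5)) ^ 5)
     = 5 * CPhi 5 q * (E5 * jacobi_prod (q ^ 5) (exp (5 * z)))"
  proof -
    have "exp (5 * (z + \<i> * pi)) = - exp (5 * z)"
    proof -
      have "5 * (z + \<i> * pi) = 5 * z + \<i> * pi + \<i> * (of_int 2 * (of_real pi * 2))"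
        by (simp add: algebra_simps)
      then have "exp (5 * (z + \<i> * pi)) = exp (5 * z + \<i> * pi)" by (simp only: exp_plus_2pin)
      then show ?thesis by (simp add: exp_add)
    qed
    then show ?thesis
      using sum_jacobi_prod_fifth_roots[OF Re_l, of "z + \<i> * pi"]
      by (simp only: q_eq[symmetric] c J C E5_eq minus_minus)
  qed
  have T: "theta q (z + of_nat r * omega5) ^ 5 = exp (5 * z / 2) * ((- 1) ^ r * jacobi_prod q (exp (z + of_nat r * omega5)) ^ 5)" for r
  proof -
    have "exp ((z + of_nat r * omega5) / 2) ^ 5 = exp (5 * z / 2 + of_nat r * (\<i> * pi))"
    proof -
      have "of_nat 5 * ((z + of_nat r * omega5) / 2) = 5 * z / 2 + of_nat r * (\<i> * pi)"
        by (simp add: omega5_def field_simps)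
      then show ?thesis by (simp only: exp_of_nat_mult[symmetric])
    qed
    also have "\<dots> = exp (5 * z / 2) * (- 1) ^ r"
      by (simp only: exp_add exp_of_nat_mult exp_pi_i')
    finally show ?thesis
      unfolding theta_eq_jacobi_prod[OF norm_q] power_mult_distrib by (simp only: mult.assoc)
  qed
  have R: "theta (q ^ 5) (5 * z) = exp (5 * z / 2) * jacobi_prod (q ^ 5) (exp (5 * z))"
    by (rule theta_eq_jacobi_prod[OF norm_q5])
  have "(\<Sum>r<5. (- 1) ^ r * theta q (z + of_nat r * omega5) ^ 5) = exp (5 * z / 2) * (\<Sum>r<5. jacobi_prod q (exp (z + of_nat r * omega5)) ^ 5)"
  proof -
    have "(- 1) ^ r * (e * ((- 1) ^ r * x)) = e * x" for r :: nat and e x :: complex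
      by (simp add: mult_ac flip: mult.assoc power_mult_distrib)
    then show ?thesis unfolding T sum_distrib_left by (simp only:)
  qed
  also have "\<dots> = 5 * CPhi 5 q * (E5 * theta (q ^ 5) (5 * z))"
    unfolding S R by (simp only: mult_ac)
  finally show ?thesis by (simp add: lessThan_nat_numeral algebra_simps)
qed

text \<open>At \<open>z = 0\<close> the unshifted term vanishes to order five and drops out of the
  derivative; the shifts 1, 4 and the shifts 2, 3 contribute equally, hence the factor 2.\<close>

lemma CPhi_theta: "5 * CPhi 5 q * E5 ^ 3 = 2 * (t2 ^ 5 * Z2 - t1 ^ 5 * Z1)"
proof -
  note D = theta_has_field_derivative[OF norm_q]
  have d: "((\<lambda>z. theta q (z + c) ^ 5) has_field_derivative 5 * theta q c ^ 4 * deriv (theta q) c) (at 0)" for c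
  proof -
    have "((\<lambda>z. theta q (c + 1 * z)) has_field_derivative deriv (theta q) (c + 1 * 0) * 1) (at 0)"
      by (rule has_field_derivative_affine[OF D])
    from DERIV_power[OF this, of 5] show ?thesis by (simp add: add.commute mult_ac)
  qed
  have "((\<lambda>z. theta q (z + 0) ^ 5 - theta q (z + omega5) ^ 5 + theta q (z + 2 * omega5) ^ 5 - theta q (z + 3 * omega5) ^ 5
     + theta q (z + 4 * omega5) ^ 5) has_field_derivative
      (5 * theta q 0 ^ 4 * deriv (theta q) 0 - 5 * theta q omega5 ^ 4 * deriv (theta q) omega5
       + 5 * theta q (2 * omega5) ^ 4 * deriv (theta q) (2 * omega5)
       - 5 * theta q (3 * omega5) ^ 4 * deriv (theta q) (3 * omega5)
       + 5 * theta q (4 * omega5) ^ 4 * deriv (theta q) (4 * omega5))) (at 0)"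
    by (intro DERIV_add DERIV_diff d)
  then have 1: "((\<lambda>z. 5 * CPhi 5 q * (E5 * theta (q ^ 5) (5 * z))) has_field_derivative
      (10 * (t2 ^ 5 * Z2 - t1 ^ 5 * Z1))) (at 0)"
    unfolding add_0_right sum_theta_powers theta_omega5 deriv_t t1_def[symmetric] t2_def[symmetric]
    by (rule DERIV_cong) (simp add: algebra_simps eval_nat_numeral)
  have "((\<lambda>z. theta (q ^ 5) (0 + 5 * z)) has_field_derivative deriv (theta (q ^ 5)) (0 + 5 * 0) * 5) (at 0)"
    by (rule has_field_derivative_affine[OF theta_has_field_derivative[OF norm_q5]])
  then have "((\<lambda>z. theta (q ^ 5) (5 * z)) has_field_derivative E5 ^ 2 * 5) (at 0)"
    by (simp add: deriv_theta_0[OF norm_q5] E5_eq)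
  then have 2: "((\<lambda>z. 5 * CPhi 5 q * (E5 * theta (q ^ 5) (5 * z))) has_field_derivative
      (5 * CPhi 5 q * (E5 * (E5 ^ 2 * 5)))) (at 0)"
    by (intro DERIV_cmult)
  from DERIV_unique[OF 1 2] have "5 * (5 * CPhi 5 q * E5 ^ 3) = 5 * (2 * (t2 ^ 5 * Z2 - t1 ^ 5 * Z1))"
    by (simp add: power3_eq_cube power2_eq_square)
  then show ?thesis by (simp only: mult_cancel_left) simp
qed

text \<open>The cubic relations trade \<open>E1 ^ 2 * t2 ^ 2\<close> for \<open>t1 ^ 3\<close> times
  a linear form in \<open>Z1\<close>, \<open>Z2\<close>, and symmetrically for \<open>t1\<close>.
  Each fifth power thus becomes a linear form times \<open>(t1 * t2) ^ 3\<close>.\<close>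

lemma CPhi_quadratic: "CPhi 5 q * E1 ^ 5 = - 2 * gauss5 * (6 * Z1 * Z2 + Z2 ^ 2 - Z1 ^ 2)"
proof -
  have t3: "(t1 * t2) ^ 3 * E1 ^ 3 = - (5 * gauss5 * E5 ^ 3)"
  proof -
    have "(t1 * t2) ^ 3 * E1 ^ 3 = (t1 * t2 * E1) ^ 3" by (simp only: power_mult_distrib)
    also have "\<dots> = - (gauss5 ^ 2 * gauss5 * E5 ^ 3)" unfolding t1_t2 by (simp add: power2_eq_square power3_eq_cube mult_ac)
    finally show ?thesis unfolding gauss5_relations(4) .
  qed
  have 1: "E1 ^ 5 * t2 ^ 5 = (3 * Z1 + Z2) * - (5 * gauss5 * E5 ^ 3)"
  proof -
    have "E1 ^ 5 * t2 ^ 5 = (E1 ^ 2 * t2 ^ 2) * t2 ^ 3 * E1 ^ 3" by (simp add: eval_nat_numeral mult_ac)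
    also have "\<dots> = (3 * Z1 + Z2) * ((t1 * t2) ^ 3 * E1 ^ 3)"
      unfolding three_Z1_plus_Z2[symmetric] by (simp add: power_mult_distrib mult_ac)
    finally show ?thesis unfolding t3 .
  qed
  have 2: "E1 ^ 5 * t1 ^ 5 = (3 * Z2 - Z1) * (5 * gauss5 * E5 ^ 3)"
  proof -
    have "E1 ^ 5 * t1 ^ 5 = - (- (E1 ^ 2 * t1 ^ 2) * t1 ^ 3 * E1 ^ 3)" by (simp add: eval_nat_numeral mult_ac)
    also have "\<dots> = - ((3 * Z2 - Z1) * ((t1 * t2) ^ 3 * E1 ^ 3))"
      unfolding three_Z2_minus_Z1[symmetric] by (simp add: power_mult_distrib mult_ac)
    finally show ?thesis unfolding t3 by simp
  qed
  have "(5 * E5 ^ 3) * (CPhi 5 q * E1 ^ 5) = E1 ^ 5 * (5 * CPhi 5 q * E5 ^ 3)" by (simp only: mult_ac)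
  also have "\<dots> = 2 * ((E1 ^ 5 * t2 ^ 5) * Z2 - (E1 ^ 5 * t1 ^ 5) * Z1)"
    unfolding CPhi_theta by (simp add: algebra_simps)
  also have "\<dots> = (5 * E5 ^ 3) * (- 2 * gauss5 * (6 * Z1 * Z2 + Z2 ^ 2 - Z1 ^ 2))"
    unfolding 1 2 by (simp add: algebra_simps power2_eq_square)
  finally show ?thesis using E5_nonzero by (simp only: mult_cancel_left) simp
qed

end

section \<open>Theta values at l and 2l, nome q^5\<close>

context quintic
begin

definition s1 where "s1 = theta (q ^ 5) l"
definition s2 where "s2 = theta (q ^ 5) (2 * l)"
definition Y1 where "Y1 = theta_log_deriv (q ^ 5) l"
definition Y2 where "Y2 = theta_log_deriv (q ^ 5) (2 * l)"
text \<open>A fixed square root of \<open>1 / q\<close>; it absorbs the half-integral powers of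
  \<open>q\<close> from the quasi-period factors.\<close>

definition e where "e = exp (- l / 2)"
text \<open>The sum of \<open>q ^ n / (1 - q ^ n)\<close> over \<open>n\<close> congruent to 1 minus
  that over \<open>n\<close> congruent to 4 modulo 5; \<open>\<beta>\<close> does the same for the
  classes 2 and 3.\<close>

definition \<alpha> where "\<alpha> = lambert1 (q ^ 5) q - lambert1 (q ^ 5) (q ^ 4)"
definition \<beta> where "\<beta> = lambert1 (q ^ 5) (q ^ 2) - lambert1 (q ^ 5) (q ^ 3)"

lemma e_nonzero: "e \<noteq> 0" by (simp add: e_def)

lemma e_power: "e ^ n = exp (- (of_nat n * l / 2))"
  by (simp add: e_def flip: exp_of_nat_mult)

lemma q_e2: "q * e ^ 2 = 1"
  by (simp add: e_power q_eq flip: exp_add)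

lemma norm_q_power: "n > 0 \<Longrightarrow> norm (q ^ n) < 1"
  using norm_q by (rule norm_power_less_one)

lemma exp_half_l:
  "exp (l / 2) - exp (- l / 2) = - (e * (1 - q))" "exp (l / 2) + exp (- l / 2) = e * (1 + q)"
  "exp (2 * l / 2) - exp (- (2 * l) / 2) = - (e ^ 2 * (1 - q ^ 2))"
  "exp (2 * l / 2) + exp (- (2 * l) / 2) = e ^ 2 * (1 + q ^ 2)"
proof -
  have 1: "exp (l / 2) = e * q" "exp (- l / 2) = e"
    by (simp_all add: e_def q_eq flip: exp_add)
  have 2: "exp (2 * l / 2) = e ^ 2 * q ^ 2" "exp (- (2 * l) / 2) = e ^ 2"
    by (simp_all add: e_power q_eq flip: exp_add exp_of_nat_mult)
  show "exp (l / 2) - exp (- l / 2) = - (e * (1 - q))" "exp (l / 2) + exp (- l / 2) = e * (1 + q)"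
    unfolding 1 by (simp_all add: algebra_simps)
  show "exp (2 * l / 2) - exp (- (2 * l) / 2) = - (e ^ 2 * (1 - q ^ 2))"
    "exp (2 * l / 2) + exp (- (2 * l) / 2) = e ^ 2 * (1 + q ^ 2)"
    unfolding 2 by (simp_all add: algebra_simps)
qed

lemma q5_exp_l:
  "q ^ 5 * exp l = q * q ^ 5" "q ^ 5 * exp (- l) = q ^ 4"
  "q ^ 5 * exp (2 * l) = q ^ 2 * q ^ 5" "q ^ 5 * exp (- (2 * l)) = q ^ 3"
proof -
  show "q ^ 5 * exp l = q * q ^ 5" by (simp add: q_eq)
  show "q ^ 5 * exp (- l) = q ^ 4" "q ^ 5 * exp (- (2 * l)) = q ^ 3" "q ^ 5 * exp (2 * l) = q ^ 2 * q ^ 5"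
    by (simp_all add: q_eq flip: exp_add exp_of_nat_mult)
qed

lemma one_minus_q: "1 - q \<noteq> 0" "1 - q ^ 2 \<noteq> 0"
  using norm_q norm_q_power[of 2] by auto

lemma l_domain: "l \<in> theta_domain (q ^ 5)" "2 * l \<in> theta_domain (q ^ 5)"
proof -
  have "norm (q * q ^ 5) < 1" "norm (q ^ 2 * q ^ 5) < 1"
    using norm_q_power[of 6] norm_q_power[of 7] by (simp_all add: eval_nat_numeral mult_ac)
  then show "l \<in> theta_domain (q ^ 5)" "2 * l \<in> theta_domain (q ^ 5)"
    unfolding theta_domain_def mem_Collect_eq exp_half_l q5_exp_l
    using norm_q_power[of 3] norm_q_power[of 4] e_nonzero one_minus_q by simp_all
qed

lemma deriv_s: "deriv (theta (q ^ 5)) l = s1 * Y1" "deriv (theta (q ^ 5)) (2 * l) = s2 * Y2"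
  unfolding s1_def s2_def Y1_def Y2_def by (rule deriv_theta[OF norm_q5 l_domain(1)],
      rule deriv_theta[OF norm_q5 l_domain(2)])

lemma s_nonzero: "s1 \<noteq> 0" "s2 \<noteq> 0"
  unfolding s1_def s2_def by (rule theta_nonzero[OF norm_q5 l_domain(1)],
      rule theta_nonzero[OF norm_q5 l_domain(2)])

text \<open>The counterpart of \<open>theta_omega5\<close> with the quasi-period
  \<open>5 * l\<close> of nome \<open>q ^ 5\<close> in place of 2 pi i; now each reduction also
  brings a power of \<open>e\<close>, whose derivative adds the extra terms.\<close>

lemma theta_l:
  "theta (q ^ 5) (3 * l) = e * s2" "theta (q ^ 5) (4 * l) = e ^ 3 * s1" "theta (q ^ 5) (6 * l) = - (e ^ 7 * s1)"
  "deriv (theta (q ^ 5)) (3 * l) = - (e * (s2 * Y2 + s2))"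
  "deriv (theta (q ^ 5)) (6 * l) = - (e ^ 7 * (s1 * Y1 - s1))"
proof -
  have x: "3 * l = - (2 * l) + 5 * l" "4 * l = - l + 5 * l" "6 * l = l + 5 * l" by simp_all
  have y: "exp (- (5 * l) / 2 - - (2 * l)) = e" "exp (- (5 * l) / 2 - - l) = e ^ 3" "exp (- (5 * l) / 2 - l) = e ^ 7"
  proof -
    have "- (5 * l) / 2 - - (2 * l) = - l / 2" "- (5 * l) / 2 - - l = - (of_nat 3 * l / 2)"
      "- (5 * l) / 2 - l = - (of_nat 7 * l / 2)" by (simp_all add: field_simps)
    then show "exp (- (5 * l) / 2 - - (2 * l)) = e" "exp (- (5 * l) / 2 - - l) = e ^ 3"
      "exp (- (5 * l) / 2 - l) = e ^ 7" unfolding e_power by (simp_all only: e_def)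
  qed
  note P = theta_plus_quasiperiod[OF Re_5l, folded q5_eq]
  note P' = deriv_theta_plus_quasiperiod[OF Re_5l, folded q5_eq]
  show "theta (q ^ 5) (3 * l) = e * s2" "theta (q ^ 5) (4 * l) = e ^ 3 * s1" "theta (q ^ 5) (6 * l) = - (e ^ 7 * s1)"
    unfolding x P y theta_minus s1_def s2_def by simp_all
  show "deriv (theta (q ^ 5)) (3 * l) = - (e * (s2 * Y2 + s2))"
    "deriv (theta (q ^ 5)) (6 * l) = - (e ^ 7 * (s1 * Y1 - s1))"
    unfolding x P' y theta_minus deriv_theta_minus[OF norm_q5] deriv_s s1_def[symmetric] s2_def[symmetric] by simp_all
qed

lemma deriv_theta_0_E5: "deriv (theta (q ^ 5)) 0 = E5 ^ 2"
  unfolding E5_eq by (rule deriv_theta_0[OF norm_q5])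

text \<open>The summand 1 appears because the logarithmic derivative drops by 1 under the
  quasi-period, so its value at \<open>3 * l\<close> is \<open>- Y2 - 1\<close>. The same drop from
  \<open>6 * l\<close> to \<open>l\<close> explains the 1 in
  \<open>three_Y2_minus_Y1\<close>.\<close>

lemma three_Y1_plus_Y2: "e * (3 * Y1 + Y2 + 1) * s1 ^ 3 = E5 ^ 2 * s2 ^ 2"
proof -
  have "l + l + l = 3 * l" "l + l = 2 * l" by simp_all
  with theta_deriv_sum[OF Re_5l, of l l l]
  have "s1 * Y1 * s1 * s1 * (e * s2) + s1 * (s1 * Y1) * s1 * (e * s2) + s1 * s1 * (s1 * Y1) * (e * s2)
      - s1 * s1 * s1 * - (e * (s2 * Y2 + s2)) = E5 ^ 2 * s2 * s2 * s2"
    by (simp only: q5_eq[symmetric] theta_l deriv_s deriv_theta_0_E5 s1_def[symmetric] s2_def[symmetric])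
  then have "s2 * (e * (3 * Y1 + Y2 + 1) * s1 ^ 3) = s2 * (E5 ^ 2 * s2 ^ 2)"
    by (simp add: algebra_simps power2_eq_square power3_eq_cube)
  then show ?thesis using s_nonzero by (simp only: mult_cancel_left) simp
qed

lemma three_Y2_minus_Y1: "(3 * Y2 - Y1 + 1) * s2 ^ 3 = - (E5 ^ 2 * e ^ 2 * s1 ^ 2)"
proof -
  have "2 * l + 2 * l + 2 * l = 6 * l" "2 * l + 2 * l = 4 * l" by simp_all
  with theta_deriv_sum[OF Re_5l, of "2 * l" "2 * l" "2 * l"]
  have "s2 * Y2 * s2 * s2 * - (e ^ 7 * s1) + s2 * (s2 * Y2) * s2 * - (e ^ 7 * s1) + s2 * s2 * (s2 * Y2) * - (e ^ 7 * s1)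
      - s2 * s2 * s2 * - (e ^ 7 * (s1 * Y1 - s1)) = E5 ^ 2 * (e ^ 3 * s1) * (e ^ 3 * s1) * (e ^ 3 * s1)"
    by (simp only: q5_eq[symmetric] theta_l deriv_s deriv_theta_0_E5 s1_def[symmetric] s2_def[symmetric])
  then have "(e ^ 7 * s1) * ((3 * Y2 - Y1 + 1) * s2 ^ 3) = (e ^ 7 * s1) * - (E5 ^ 2 * e ^ 2 * s1 ^ 2)"
    by (simp add: algebra_simps eval_nat_numeral)
  then show ?thesis using s_nonzero e_nonzero by (simp only: mult_cancel_left) simp
qed

text \<open>\<open>s1\<close> contains the factors of \<open>E1\<close> with exponents in the
  classes 1 and 4 modulo 5, \<open>s2\<close> those in 2 and 3, and \<open>E5\<close> the
  rest.\<close>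

lemma s1_s2: "s1 * s2 * E5 = e ^ 3 * E1"
proof -
  let ?Q = "q ^ 5"
  have 1: "(1 - q) * qpoch_inf (q * ?Q) ?Q = qpoch_inf q ?Q" "(1 - q ^ 2) * qpoch_inf (q ^ 2 * ?Q) ?Q = qpoch_inf (q ^ 2) ?Q"
    by (rule qpoch_inf_step[OF norm_q5, symmetric])+
  have E: "E1 = qpoch_inf q ?Q * qpoch_inf (q ^ 2) ?Q * qpoch_inf (q ^ 3) ?Q * qpoch_inf (q ^ 4) ?Q * E5"
    unfolding E1_eq E5_eq using qpoch_inf_split[OF norm_q, of 5 q]
    by (simp add: lessThan_nat_numeral eval_nat_numeral mult_ac)
  have "s1 = - (e * (((1 - q) * qpoch_inf (q * ?Q) ?Q) * qpoch_inf (q ^ 4) ?Q))"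
    unfolding s1_def theta_def exp_half_l q5_exp_l by (simp add: mult_ac)
  moreover have "s2 = - (e ^ 2 * (((1 - q ^ 2) * qpoch_inf (q ^ 2 * ?Q) ?Q) * qpoch_inf (q ^ 3) ?Q))"
    unfolding s2_def theta_def exp_half_l q5_exp_l by (simp add: mult_ac)
  ultimately show ?thesis unfolding 1 E by (simp add: eval_nat_numeral mult_ac)
qed

text \<open>The coth term equals \<open>- 1 / 2 - x / (1 - x)\<close> with \<open>x = q\<close> or
  \<open>x = q ^ 2\<close>; the fraction is the initial term missing from the Lambert series at
  \<open>x * q ^ 5\<close>.\<close>

lemma Y_eq: "Y1 = - 1 / 2 - \<alpha>" "Y2 = - 1 / 2 - \<beta>"
proof -
  have c: "e' * (1 + x) / (2 * - (e' * (1 - x))) = - 1 / 2 - x / (1 - x)" if "e' \<noteq> 0" "1 - x \<noteq> 0" for e' x :: complex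
    using that by (simp add: field_simps)
  have n: "norm q < 1" "norm (q ^ 2) < 1" using norm_q norm_q_power[of 2] by auto
  show "Y1 = - 1 / 2 - \<alpha>"
    unfolding Y1_def theta_log_deriv_def exp_half_l q5_exp_l c[OF e_nonzero one_minus_q(1)] \<alpha>_def
      lambert1_step[OF norm_q5 n(1)] by simp
  have "e ^ 2 \<noteq> 0" using e_nonzero by simp
  then show "Y2 = - 1 / 2 - \<beta>"
    unfolding Y2_def theta_log_deriv_def exp_half_l q5_exp_l c[OF \<open>e ^ 2 \<noteq> 0\<close> one_minus_q(2)] \<beta>_def
      lambert1_step[OF norm_q5 n(2)] by simp
qed

text \<open>Parallel to \<open>E1_E5_quadratic\<close>. The leftover \<open>e ^ 2\<close> is
  \<open>1 / q\<close>, which is where the factor \<open>q\<close> of the eta quotient comes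
  from.\<close>

lemma E5_E1_quadratic: "(1 + 3 * \<alpha> + \<beta>) * (\<alpha> - 3 * \<beta>) * E1 = q * E5 ^ 5"
proof -
  let ?K = "(3 * Y1 + Y2 + 1) * (3 * Y2 - Y1 + 1)"
  have "(e * (3 * Y1 + Y2 + 1) * s1 ^ 3) * ((3 * Y2 - Y1 + 1) * s2 ^ 3) = (E5 ^ 2 * s2 ^ 2) * - (E5 ^ 2 * e ^ 2 * s1 ^ 2)"
    by (simp only: three_Y1_plus_Y2 three_Y2_minus_Y1)
  then have "(e * (s1 * s2) ^ 2) * (?K * (s1 * s2)) = (e * (s1 * s2) ^ 2) * - (E5 ^ 4 * e)"
    by (simp add: power_mult_distrib power2_eq_square power3_eq_cube power4_eq_xxxx algebra_simps)
  then have "?K * (s1 * s2) = - (E5 ^ 4 * e)"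
    using s_nonzero e_nonzero by (simp only: mult_cancel_left) simp
  then have "?K * (s1 * s2) * E5 = - (E5 ^ 4 * e) * E5" by (simp only:)
  then have "?K * (s1 * s2 * E5) = - (E5 ^ 5 * e)"
    by (simp add: eval_nat_numeral mult_ac)
  then have "?K * (e ^ 3 * E1) = - (E5 ^ 5 * e)" unfolding s1_s2 .
  then have "e * (?K * E1 * e ^ 2) = e * - (E5 ^ 5)" by (simp add: power2_eq_square power3_eq_cube mult_ac)
  then have "?K * E1 * e ^ 2 = - (E5 ^ 5)" using e_nonzero by (simp only: mult_cancel_left) simp
  then have "?K * E1 * (q * e ^ 2) = - (q * E5 ^ 5)" by (simp add: mult_ac) (metis mult.left_commute mult_minus_right)
  then have "?K * E1 = - (q * E5 ^ 5)" unfolding q_e2 by simp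
  moreover have "?K = - ((1 + 3 * \<alpha> + \<beta>) * (\<alpha> - 3 * \<beta>))" unfolding Y_eq by (simp add: algebra_simps)
  ultimately show ?thesis by simp
qed

text \<open>The formula for \<open>Z' a - Z' b\<close> at \<open>a = l\<close>,
  \<open>b = 2 * l\<close>, where \<open>a + b\<close> and \<open>a - b\<close> reduce to the same
  two points. The exponential terms of \<open>Z'\<close> supply the initial terms of the classes 1
  and 2, and the difference gives the signs of the Legendre symbol.\<close>

lemma legendre_lambert_product:
  "(\<Sum>j. of_int (Legendre (int (Suc j)) 5) * (q ^ Suc j / (1 - q ^ Suc j) ^ 2)) * E1 = q * E5 ^ 5"
proof -
  let ?Y1 = "theta_log_deriv2 (q ^ 5) l" and ?Y2 = "theta_log_deriv2 (q ^ 5) (2 * l)"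
  have q5nz: "q ^ 5 \<noteq> 0" using q_nonzero by simp
  have a: "l + 2 * l = 3 * l" "l - 2 * l = - l" by simp_all
  have "e * s2 * - s1 * (E5 ^ 2) ^ 2 = s2 ^ 2 * (s1 ^ 2 * ?Y1) - s1 ^ 2 * (s2 ^ 2 * ?Y2)"
    using theta_deriv2_diff[OF Re_5l, of l "2 * l", folded q5_eq]
    unfolding deriv_deriv_theta[OF norm_q5 q5nz l_domain(1)] deriv_deriv_theta[OF norm_q5 q5nz l_domain(2)]
    unfolding a theta_l theta_minus deriv_theta_0_E5 s1_def[symmetric] s2_def[symmetric] .
  then have "(s1 * s2) * ((?Y1 - ?Y2) * (s1 * s2)) = (s1 * s2) * - (E5 ^ 4 * e)"
    by (simp add: algebra_simps eval_nat_numeral)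
  then have "(?Y1 - ?Y2) * (s1 * s2) = - (E5 ^ 4 * e)"
    using s_nonzero by (simp only: mult_cancel_left) simp
  then have "(?Y1 - ?Y2) * (s1 * s2) * E5 = - (E5 ^ 4 * e) * E5" by (simp only:)
  then have "(?Y1 - ?Y2) * (s1 * s2 * E5) = - (E5 ^ 5 * e)"
    by (simp add: eval_nat_numeral mult_ac)
  then have "(?Y1 - ?Y2) * (e ^ 3 * E1) = - (E5 ^ 5 * e)" unfolding s1_s2 .
  then have "e * ((?Y1 - ?Y2) * E1 * e ^ 2) = e * - (E5 ^ 5)" by (simp add: power2_eq_square power3_eq_cube mult_ac)
  then have "(?Y1 - ?Y2) * E1 * e ^ 2 = - (E5 ^ 5)" using e_nonzero by (simp only: mult_cancel_left) simp
  then have "q * ((?Y1 - ?Y2) * E1 * e ^ 2) = q * - (E5 ^ 5)" by (simp only:)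
  moreover have "q * ((?Y1 - ?Y2) * E1 * e ^ 2) = (?Y1 - ?Y2) * E1 * (q * e ^ 2)" by (simp only: mult_ac)
  ultimately have "(?Y1 - ?Y2) * E1 = - (q * E5 ^ 5)" unfolding q_e2 by simp
  moreover have "?Y1 - ?Y2 = - (lambert2 (q ^ 5) q - lambert2 (q ^ 5) (q ^ 2) - lambert2 (q ^ 5) (q ^ 3) + lambert2 (q ^ 5) (q ^ 4))"
  proof -
    have n: "norm q < 1" "norm (q ^ 2) < 1" using norm_q norm_q_power[of 2] by auto
    have "- 1 / (- (e * (1 - q))) ^ 2 = - (q * e ^ 2) / (e ^ 2 * (1 - q) ^ 2)"
      unfolding q_e2 by (simp add: power_mult_distrib)
    then have 1: "- 1 / (- (e * (1 - q))) ^ 2 = - (q / (1 - q) ^ 2)" using e_nonzero by simp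
    have "- 1 / (- (e ^ 2 * (1 - q ^ 2))) ^ 2 = - ((q * e ^ 2) ^ 2) / ((e ^ 2) ^ 2 * (1 - q ^ 2) ^ 2)"
      unfolding q_e2 by (simp add: power_mult_distrib)
    then have 2: "- 1 / (- (e ^ 2 * (1 - q ^ 2))) ^ 2 = - (q ^ 2 / (1 - q ^ 2) ^ 2)"
      using e_nonzero by (simp add: power_mult_distrib)
    show ?thesis
      unfolding theta_log_deriv2_def exp_half_l q5_exp_l 1 2 lambert2_step[OF norm_q5 n(1)]
        lambert2_step[OF norm_q5 n(2)] by simp
  qed
  ultimately have "- (lambert2 (q ^ 5) q - lambert2 (q ^ 5) (q ^ 2) - lambert2 (q ^ 5) (q ^ 3) + lambert2 (q ^ 5) (q ^ 4)) * E1
      = - (q * E5 ^ 5)" by (simp only:)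
  then show ?thesis
    unfolding legendre_lambert_eq_lambert2[OF norm_q] by (simp only: mult_minus_left neg_equal_iff_equal)
qed

text \<open>The same formula at \<open>omega5\<close> and \<open>2 * omega5\<close>; here the
  Legendre symbol comes from the roots of unity through \<open>gauss5_legendre\<close>.\<close>

lemma legendre_lambert2_product:
  "(1 - 5 * (\<Sum>j. of_int (Legendre (int (Suc j)) 5) * (of_nat (Suc j) * q ^ Suc j / (1 - q ^ Suc j)))) * E5 = E1 ^ 5"
proof -
  let ?Z1 = "theta_log_deriv2 q omega5" and ?Z2 = "theta_log_deriv2 q (2 * omega5)"
  let ?S = "\<Sum>j. of_int (Legendre (int (Suc j)) 5) * (of_nat (Suc j) * q ^ Suc j / (1 - q ^ Suc j))"
  have a: "omega5 + 2 * omega5 = 3 * omega5" "omega5 - 2 * omega5 = - omega5" by simp_all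
  have "t2 * - t1 * (E1 ^ 2) ^ 2 = t2 ^ 2 * (t1 ^ 2 * ?Z1) - t1 ^ 2 * (t2 ^ 2 * ?Z2)"
    using theta_deriv2_diff[OF Re_l, of omega5 "2 * omega5", folded q_eq]
    unfolding deriv_deriv_theta[OF norm_q q_nonzero omega5_domain(1)] deriv_deriv_theta[OF norm_q q_nonzero omega5_domain(2)]
    unfolding a theta_omega5 theta_minus deriv_theta_0_E1 t1_def[symmetric] t2_def[symmetric] .
  then have "(t1 * t2) * ((?Z1 - ?Z2) * (t1 * t2)) = (t1 * t2) * - (E1 ^ 4)"
    by (simp add: algebra_simps eval_nat_numeral)
  then have "(?Z1 - ?Z2) * (t1 * t2) = - (E1 ^ 4)"
    using t_nonzero by (simp only: mult_cancel_left) simp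
  then have "(?Z1 - ?Z2) * (t1 * t2) * E1 = - (E1 ^ 4) * E1" by (simp only:)
  then have "(?Z1 - ?Z2) * (t1 * t2 * E1) = - (E1 ^ 5)" by (simp add: eval_nat_numeral mult_ac)
  then have 1: "(?Z1 - ?Z2) * gauss5 * E5 = E1 ^ 5" unfolding t1_t2 by (simp add: mult_ac)
  \<comment> \<open>The constant \<open>1 / gauss5\<close> is the difference
    \<open>- 1 / r ^ 2 + 1 / p ^ 2\<close> of the elementary terms of \<open>Z'\<close>.\<close>
  have 2: "?Z1 - ?Z2 = 1 / gauss5 - gauss5 * ?S"
  proof -
    have nrm: "norm (q * x) < 1" if "norm x = 1" for x using norm_q that by (simp add: norm_mult)
    have nz: "norm (zeta5 ^ k) = 1" for k by (simp add: norm_power)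
    let ?L = "\<lambda>k. lambert2 q (q * zeta5 ^ k)"
    have "(\<lambda>m. of_nat (Suc m) * (q * zeta5 ^ k) ^ Suc m / (1 - q ^ Suc m)) sums ?L k" for k
      by (rule lambert2_sums(1)[OF norm_q nrm[OF nz]])
    then have "(\<lambda>m. of_nat (Suc m) * (q * zeta5 ^ 1) ^ Suc m / (1 - q ^ Suc m) + of_nat (Suc m) * (q * zeta5 ^ 4) ^ Suc m / (1 - q ^ Suc m)
       - of_nat (Suc m) * (q * zeta5 ^ 2) ^ Suc m / (1 - q ^ Suc m) - of_nat (Suc m) * (q * zeta5 ^ 3) ^ Suc m / (1 - q ^ Suc m))
       sums (?L 1 + ?L 4 - ?L 2 - ?L 3)"
      by (intro sums_add sums_diff)
    moreover have "of_nat (Suc m) * (q * zeta5 ^ 1) ^ Suc m / (1 - q ^ Suc m) + of_nat (Suc m) * (q * zeta5 ^ 4) ^ Suc m / (1 - q ^ Suc m)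
       - of_nat (Suc m) * (q * zeta5 ^ 2) ^ Suc m / (1 - q ^ Suc m) - of_nat (Suc m) * (q * zeta5 ^ 3) ^ Suc m / (1 - q ^ Suc m)
       = gauss5 * (of_int (Legendre (int (Suc m)) 5) * (of_nat (Suc m) * q ^ Suc m / (1 - q ^ Suc m)))" for m
    proof -
      have "of_nat (Suc m) * (q * zeta5 ^ 1) ^ Suc m / (1 - q ^ Suc m) + of_nat (Suc m) * (q * zeta5 ^ 4) ^ Suc m / (1 - q ^ Suc m)
         - of_nat (Suc m) * (q * zeta5 ^ 2) ^ Suc m / (1 - q ^ Suc m) - of_nat (Suc m) * (q * zeta5 ^ 3) ^ Suc m / (1 - q ^ Suc m)
         = (of_nat (Suc m) * q ^ Suc m / (1 - q ^ Suc m)) *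
           (zeta5 ^ Suc m + (zeta5 ^ 4) ^ Suc m - (zeta5 ^ 2) ^ Suc m - (zeta5 ^ 3) ^ Suc m)"
      proof -
        have "n * (Q * a) / d + n * (Q * b) / d - n * (Q * c) / d - n * (Q * f) / d = n * Q / d * (a + b - c - f)"
          for n Q a b c d f :: complex
          by (simp add: algebra_simps add_divide_distrib diff_divide_distrib)
        then show ?thesis unfolding power_mult_distrib power_one_right by (simp only:)
      qed
      then show ?thesis unfolding gauss5_legendre by (simp only: mult_ac)
    qed
    ultimately have "(\<lambda>m. gauss5 * (of_int (Legendre (int (Suc m)) 5) * (of_nat (Suc m) * q ^ Suc m / (1 - q ^ Suc m))))
        sums (?L 1 + ?L 4 - ?L 2 - ?L 3)" by (simp only:)
    moreover have "(\<lambda>m. gauss5 * (of_int (Legendre (int (Suc m)) 5) * (of_nat (Suc m) * q ^ Suc m / (1 - q ^ Suc m)))) sums (gauss5 * ?S)"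
      by (intro sums_mult summable_sums summable_legendre_lambert(2)[OF norm_q])
    ultimately have L: "?L 1 + ?L 4 - ?L 2 - ?L 3 = gauss5 * ?S" by (rule sums_unique2)
    define p r where "p = zeta5 - zeta5 ^ 4" and "r = zeta5 ^ 2 - zeta5 ^ 3"
    note rel = gauss5_relations[folded p_def r_def]
    have pr: "p \<noteq> 0" "r \<noteq> 0" using rel(1) gauss5_nonzero by auto
    have "2 * (r ^ 2 - p ^ 2) = 2 * gauss5" unfolding right_diff_distrib rel by simp
    then have "r ^ 2 - p ^ 2 = gauss5" by (simp only: mult_cancel_left) simp
    moreover have "- 1 / r ^ 2 + 1 / p ^ 2 = (r ^ 2 - p ^ 2) / (p * r) ^ 2"
      using pr by (simp add: field_simps)
    ultimately have "- 1 / r ^ 2 + 1 / p ^ 2 = 1 / gauss5"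
      unfolding rel by (simp add: power2_eq_square gauss5_nonzero)
    moreover have "- (zeta5 ^ 3) - - (zeta5 ^ 2) = r" by (simp add: r_def)
    ultimately show ?thesis
      unfolding theta_log_deriv2_def exp_omega5 L[symmetric] by (simp add: p_def[symmetric] algebra_simps)
  qed
  have "(1 / gauss5 - gauss5 * ?S) * gauss5 = 1 - gauss5 ^ 2 * ?S"
    using gauss5_nonzero by (simp add: field_simps power2_eq_square)
  then show ?thesis using 1 unfolding 2 gauss5_relations(4) by simp
qed

text \<open>After \<open>lambert1_root_of_unity\<close>, pairing a root with its inverse cancels the
  class of 0 and leaves only \<open>\<alpha>\<close> and \<open>\<beta>\<close>, the series already
  found in \<open>Y_eq\<close>.\<close>

lemma Z_eq:
  defines "p \<equiv> zeta5 - zeta5 ^ 4" and "r \<equiv> zeta5 ^ 2 - zeta5 ^ 3"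
  shows "Z1 = p * (- (gauss5 + 5) / 20 - \<alpha>) - r * \<beta>" "Z2 = r * ((gauss5 - 5) / 20 - \<alpha>) + p * \<beta>"
proof -
  let ?z = zeta5
  note rel = gauss5_relations[folded p_def r_def]
  have pr: "p \<noteq> 0" "r \<noteq> 0" using rel(1) gauss5_nonzero by auto
  have s: "2 * (?z ^ 2 + ?z ^ 3) = - 1 - gauss5" "2 * (?z + ?z ^ 4) = - 1 + gauss5"
    using zeta5_cyclotomic unfolding gauss5_def by (simp_all add: algebra_simps eq_neg_iff_add_eq_0)
  have G2: "gauss5 * gauss5 = 5" using rel(4) by (simp add: power2_eq_square)
  \<comment> \<open>The coth constant is rationalized by \<open>p * r = - gauss5\<close>, which
    moves \<open>r\<close> from the denominator to a numerator \<open>p\<close>; \<open>A2\<close>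
    is the conjugate computation.\<close>
  have A1: "(- (?z ^ 3) + - (?z ^ 2)) / (2 * r) = p * (- (gauss5 + 5) / 20)"
  proof -
    have "(- (?z ^ 3) + - (?z ^ 2)) * 20 = - 10 * (2 * (?z ^ 2 + ?z ^ 3))" by simp
    also have "\<dots> = 10 * (1 + gauss5)" unfolding s(1) by (simp add: algebra_simps)
    also have "\<dots> = 2 * ((- gauss5) * (- (gauss5 + 5)))" using G2 by (simp add: algebra_simps)
    also have "\<dots> = 2 * r * p * (- (gauss5 + 5))" unfolding rel(1)[symmetric] by (simp only: mult_ac)
    finally show ?thesis using pr by (simp add: field_simps)
  qed
  have A2: "(?z + ?z ^ 4) / (2 * p) = r * ((gauss5 - 5) / 20)"
  proof -
    have "(?z + ?z ^ 4) * 20 = 10 * (- 1 + gauss5)" unfolding s(2)[symmetric] by simp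
    also have "\<dots> = 2 * ((- gauss5) * (gauss5 - 5))" using G2 by (simp add: algebra_simps)
    also have "\<dots> = 2 * p * r * (gauss5 - 5)" unfolding rel(1)[symmetric] by (simp only: mult_ac)
    finally show ?thesis using pr by (simp add: field_simps)
  qed
  have z: "?z ^ 6 = ?z" "?z ^ 8 = ?z ^ 3" "?z ^ 9 = ?z ^ 4" "?z ^ 12 = ?z ^ 2" "?z ^ 16 = ?z"
  proof -
    have k: "?z ^ (5 * n + k) = ?z ^ k" for n k by (simp add: power_add power_mult zeta5_power5)
    show "?z ^ 6 = ?z" "?z ^ 8 = ?z ^ 3" "?z ^ 9 = ?z ^ 4" "?z ^ 12 = ?z ^ 2" "?z ^ 16 = ?z"
      using k[of 1 1] k[of 1 3] k[of 1 4] k[of 2 2] k[of 3 1] by simp_all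
  qed
  have n: "norm (?z ^ k) = 1" "(?z ^ k) ^ 5 = 1" for k
    by (simp add: norm_power) (metis power_mult mult.commute zeta5_power5 power_one)
  let ?L = "\<lambda>k. lambert1 (q ^ 5) (q ^ k)"
  have R: "lambert1 q (q * ?z) = ?z * lambert1 (q ^ 5) q + ?z ^ 2 * ?L 2 + ?z ^ 3 * ?L 3 + ?z ^ 4 * ?L 4 + ?L 5"
    "lambert1 q (q * ?z ^ 2) = ?z ^ 2 * lambert1 (q ^ 5) q + ?z ^ 4 * ?L 2 + ?z * ?L 3 + ?z ^ 3 * ?L 4 + ?L 5"
    "lambert1 q (q * ?z ^ 3) = ?z ^ 3 * lambert1 (q ^ 5) q + ?z * ?L 2 + ?z ^ 4 * ?L 3 + ?z ^ 2 * ?L 4 + ?L 5"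
    "lambert1 q (q * ?z ^ 4) = ?z ^ 4 * lambert1 (q ^ 5) q + ?z ^ 3 * ?L 2 + ?z ^ 2 * ?L 3 + ?z * ?L 4 + ?L 5"
    using lambert1_root_of_unity[OF norm_q n, of 1] lambert1_root_of_unity[OF norm_q n, of 2]
      lambert1_root_of_unity[OF norm_q n, of 3] lambert1_root_of_unity[OF norm_q n, of 4]
    by (simp_all add: z flip: power_mult)
  show "Z1 = p * (- (gauss5 + 5) / 20 - \<alpha>) - r * \<beta>"
  proof -
    have "Z1 = (- (?z ^ 3) + - (?z ^ 2)) / (2 * r) - lambert1 q (q * ?z) + lambert1 q (q * ?z ^ 4)"
      unfolding Z1_def theta_log_deriv_def exp_omega5 r_def by simp
    then show ?thesis
      unfolding A1 R unfolding p_def r_def \<alpha>_def \<beta>_def by (simp add: algebra_simps)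
  qed
  show "Z2 = r * ((gauss5 - 5) / 20 - \<alpha>) + p * \<beta>"
  proof -
    have "Z2 = (?z + ?z ^ 4) / (2 * p) - lambert1 q (q * ?z ^ 2) + lambert1 q (q * ?z ^ 3)"
      unfolding Z2_def theta_log_deriv_def exp_omega5 p_def by simp
    then show ?thesis
      unfolding A2 R unfolding p_def r_def \<alpha>_def \<beta>_def by (simp add: algebra_simps)
  qed
qed

text \<open>By \<open>CPhi_quadratic\<close> and \<open>E1_E5_quadratic\<close> the left side is
  \<open>CPhi 5 q * E1 ^ 5 - E1 ^ 5 / E5\<close>, since \<open>(3 * Z1 + Z2) * (3 * Z2 - Z1)\<close>
  equals \<open>8 * Z1 * Z2 + 3 * Z2 ^ 2 - 3 * Z1 ^ 2\<close>. The right side is 25 times the other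
  eta quotient.\<close>

lemma quadratic_relation:
  "- gauss5 * (20 * Z1 * Z2 + 5 * Z2 ^ 2 - 5 * Z1 ^ 2) = 25 * ((1 + 3 * \<alpha> + \<beta>) * (\<alpha> - 3 * \<beta>))"
proof -
  define p r where "p = zeta5 - zeta5 ^ 4" and "r = zeta5 ^ 2 - zeta5 ^ 3"
  note rel = gauss5_relations[folded p_def r_def]
  let ?G = gauss5
  define A B where "A = - (?G + 5) / 20 - \<alpha>" and "B = (?G - 5) / 20 - \<alpha>"
  have G2: "?G * ?G = 5" "?G * (?G * x) = 5 * x" for x
    using rel(4) by (simp_all add: power2_eq_square flip: mult.assoc)
  have Z: "Z1 = p * A - r * \<beta>" "Z2 = r * B + p * \<beta>"
    unfolding A_def B_def p_def r_def by (rule Z_eq)+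
  have p2: "p ^ 2 = (- 5 - ?G) / 2" and r2: "r ^ 2 = (- 5 + ?G) / 2" and pr: "p * r = - ?G"
    using rel by (simp_all add: field_simps)
  have "- ?G * (20 * Z1 * Z2 + 5 * Z2 ^ 2 - 5 * Z1 ^ 2)
     = - ?G * (20 * ((p * r) * A * B + p ^ 2 * A * \<beta> - r ^ 2 * B * \<beta> - (p * r) * \<beta> ^ 2)
       + 5 * (r ^ 2 * B ^ 2 + 2 * (p * r) * B * \<beta> + p ^ 2 * \<beta> ^ 2)
       - 5 * (p ^ 2 * A ^ 2 - 2 * (p * r) * A * \<beta> + r ^ 2 * \<beta> ^ 2))"
    unfolding Z by (simp add: algebra_simps power2_eq_square)
  also have "\<dots> = 25 * ((1 + 3 * \<alpha> + \<beta>) * (\<alpha> - 3 * \<beta>))"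
    unfolding p2 r2 pr A_def B_def
    by (simp add: field_simps power2_eq_square G2)
  finally show ?thesis .
qed

theorem CPhi_product: "CPhi 5 q * E1 ^ 5 = E1 ^ 5 / E5 + 25 * (q * E5 ^ 5 / E1)"
proof -
  have 1: "E1 ^ 5 / E5 = gauss5 * ((3 * Z1 + Z2) * (3 * Z2 - Z1))"
    using E1_E5_quadratic E5_nonzero by (simp add: field_simps)
  have 2: "q * E5 ^ 5 / E1 = (1 + 3 * \<alpha> + \<beta>) * (\<alpha> - 3 * \<beta>)"
    using E5_E1_quadratic E1_nonzero by (simp add: field_simps)
  show ?thesis
    unfolding 1 2 CPhi_quadratic quadratic_relation[symmetric] by (simp add: algebra_simps power2_eq_square)
qed

end

subsection \<open>Ramanujan's identity and the theorem\<close>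

lemma sum_zeta5_powers: "(\<Sum>k<5. (zeta5 ^ k) ^ n) = (if n mod 5 = 0 then 5 else 0)"
proof -
  have c: "cis (2 * pi / 5) = zeta5"
    by (simp add: zeta5_def omega5_def cis_conv_exp mult_ac)
  have "(\<Sum>k<5. (cis (2 * pi / real 5) ^ k) powi int n) = (if int 5 dvd int n then of_nat 5 else 0)"
    by (rule sum_roots_of_unity) simp
  moreover have "int 5 dvd int n \<longleftrightarrow> n mod 5 = 0" by presburger
  ultimately show ?thesis by (simp add: c)
qed

text \<open>The coefficient \<open>a n\<close> sits at exponent \<open>Suc n\<close>, so the
  surviving indices are \<open>5 * n + 4\<close>; this produces the arguments
  \<open>5 * j - 1\<close> of the partition numbers.\<close>

lemma sums_fifth_root_filter:
  fixes a :: "nat \<Rightarrow> complex"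
  assumes S: "\<And>k. (\<lambda>n. a n * (zeta5 ^ k) ^ Suc n) sums s k"
  shows "(\<lambda>n. 5 * a (5 * n + 4)) sums (\<Sum>k<5. s k)"
proof -
  have "(\<lambda>n. \<Sum>k<5. a n * (zeta5 ^ k) ^ Suc n) sums (\<Sum>k<5. s k)"
    by (rule sums_sum) (rule S)
  moreover have "(\<Sum>k<5. a n * (zeta5 ^ k) ^ Suc n) = a n * (if Suc n mod 5 = 0 then 5 else 0)" for n
    unfolding sum_distrib_left[symmetric] sum_zeta5_powers ..
  ultimately have "(\<lambda>n. a n * (if Suc n mod 5 = 0 then 5 else 0)) sums (\<Sum>k<5. s k)" by (simp only:)
  from sums_group5[OF this] show ?thesis
  proof (rule sums_cong[THEN iffD1, rotated])
    fix n
    have m: "Suc (5 * n) mod 5 = 1" "Suc (5 * n + 1) mod 5 = 2" "Suc (5 * n + 2) mod 5 = 3"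
      "Suc (5 * n + 3) mod 5 = 4" "Suc (5 * n + 4) mod 5 = 0" by presburger+
    show "a (5 * n) * (if Suc (5 * n) mod 5 = 0 then 5 else 0) + a (5 * n + 1) * (if Suc (5 * n + 1) mod 5 = 0 then 5 else 0)
      + a (5 * n + 2) * (if Suc (5 * n + 2) mod 5 = 0 then 5 else 0) + a (5 * n + 3) * (if Suc (5 * n + 3) mod 5 = 0 then 5 else 0)
      + a (5 * n + 4) * (if Suc (5 * n + 4) mod 5 = 0 then 5 else 0) = 5 * a (5 * n + 4)"
      unfolding m by simp
  qed
qed

text \<open>One factor 5 comes from the filter, the other from the coefficient \<open>5 * n\<close>
  of \<open>y ^ (5 * n)\<close>.\<close>

lemma sum_zeta5_geometric_deriv:
  assumes y: "norm y < 1"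
  shows "(\<Sum>k<5. (zeta5 ^ k * y) / (1 - zeta5 ^ k * y) ^ 2) = 25 * (y ^ 5 / (1 - y ^ 5) ^ 2)"
proof -
  have g: "(\<lambda>n. of_nat (Suc n) * x ^ Suc n) sums (x / (1 - x) ^ 2)" if "norm x < 1" for x :: complex
    using sums_mult[OF geometric_deriv_sums[OF that], of x] by (simp add: mult_ac)
  have "(\<lambda>n. (of_nat (Suc n) * y ^ Suc n) * (zeta5 ^ k) ^ Suc n) sums ((zeta5 ^ k * y) / (1 - zeta5 ^ k * y) ^ 2)" for k
    using g[of "zeta5 ^ k * y"] y by (simp add: norm_mult norm_power power_mult_distrib mult_ac)
  from sums_fifth_root_filter[OF this]
  have 1: "(\<lambda>n. 5 * (of_nat (Suc (5 * n + 4)) * y ^ Suc (5 * n + 4))) sums (\<Sum>k<5. (zeta5 ^ k * y) / (1 - zeta5 ^ k * y) ^ 2)" .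
  have "norm (y ^ 5) < 1" using y by (rule norm_power_less_one) simp
  from sums_mult[OF g[OF this], of 25]
  have "(\<lambda>n. 25 * (of_nat (Suc n) * (y ^ 5) ^ Suc n)) sums (25 * (y ^ 5 / (1 - y ^ 5) ^ 2))" .
  moreover have "5 * (of_nat (Suc (5 * n + 4)) * y ^ Suc (5 * n + 4)) = 25 * (of_nat (Suc n) * (y ^ 5) ^ Suc n)" for n
  proof -
    have "Suc (5 * n + 4) = 5 * Suc n" by simp
    then show ?thesis by (simp only: power_mult of_nat_mult) simp
  qed
  ultimately show ?thesis using 1 by (simp only: sums_unique2)
qed

abbreviation legendre_lambert :: "complex \<Rightarrow> complex" where
  "legendre_lambert q \<equiv> \<Sum>j. of_int (Legendre (int (Suc j)) 5) * (q ^ Suc j / (1 - q ^ Suc j) ^ 2)"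

text \<open>Terms with index divisible by 5 vanish on both sides by the Legendre symbol; for the
  others, \<open>zeta5 ^ (k * m)\<close> runs through all fifth roots of unity and
  \<open>sum_zeta5_geometric_deriv\<close> applies.\<close>

lemma sum_legendre_lambert_zeta5:
  assumes x: "norm x < 1"
  shows "(\<Sum>k<5. legendre_lambert (zeta5 ^ k * x)) = 25 * legendre_lambert (x ^ 5)"
proof -
  let ?h = "\<lambda>y::complex. y / (1 - y) ^ 2" and ?c = "\<lambda>n. of_int (Legendre (int n) 5) :: complex"
  have nk: "norm (zeta5 ^ k * x) < 1" for k using x by (simp add: norm_mult norm_power)
  have x5: "norm (x ^ 5) < 1" using x by (rule norm_power_less_one) simp
  have "(\<lambda>j. ?c (Suc j) * ?h ((zeta5 ^ k * x) ^ Suc j)) sums legendre_lambert (zeta5 ^ k * x)" for k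
    by (rule summable_sums[OF summable_legendre_lambert(1)[OF nk]])
  then have 1: "(\<lambda>j. \<Sum>k<5. ?c (Suc j) * ?h ((zeta5 ^ k * x) ^ Suc j)) sums (\<Sum>k<5. legendre_lambert (zeta5 ^ k * x))"
    by (rule sums_sum)
  have 2: "(\<lambda>j. 25 * (?c (Suc j) * ?h ((x ^ 5) ^ Suc j))) sums (25 * legendre_lambert (x ^ 5))"
    by (intro sums_mult summable_sums summable_legendre_lambert(1)[OF x5])
  have eq: "(\<Sum>k<5. ?c m * ?h ((zeta5 ^ k * x) ^ m)) = 25 * (?c m * ?h ((x ^ 5) ^ m))" if "m > 0" for m
  proof (cases "m mod 5 = 0")
    case True
    then show ?thesis by (simp add: Legendre_5)
  next
    case False
    define y where "y = x ^ m"
    have y: "norm y < 1" unfolding y_def by (rule norm_power_less_one[OF x that])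
    have z: "zeta5 ^ j = zeta5 ^ (j mod 5)" for j
    proof -
      have "zeta5 ^ j = zeta5 ^ (5 * (j div 5) + j mod 5)" by simp
      then show ?thesis unfolding power_add power_mult zeta5_power5 by simp
    qed
    have "(zeta5 ^ k * x) ^ m = zeta5 ^ (k * (m mod 5) mod 5) * y" for k
      using z[of "k * m"] by (simp add: power_mult_distrib y_def mod_mult_right_eq flip: power_mult)
    then have "(\<Sum>k<5. ?h ((zeta5 ^ k * x) ^ m)) = (\<Sum>k<5. ?h (zeta5 ^ (k * (m mod 5) mod 5) * y))" by (simp only:)
    also have "\<dots> = (\<Sum>k<5. ?h (zeta5 ^ k * y))"
    proof -
      have "m mod 5 = 1 \<or> m mod 5 = 2 \<or> m mod 5 = 3 \<or> m mod 5 = 4" using False by presburger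
      then show ?thesis by (elim disjE) (simp_all add: lessThan_nat_numeral)
    qed
    also have "\<dots> = 25 * ?h (y ^ 5)" by (rule sum_zeta5_geometric_deriv[OF y])
    also have "y ^ 5 = (x ^ 5) ^ m" unfolding y_def by (simp only: power_mult[symmetric] mult.commute)
    finally show ?thesis unfolding sum_distrib_left[symmetric] by simp
  qed
  from 1 have "(\<lambda>j. 25 * (?c (Suc j) * ?h ((x ^ 5) ^ Suc j))) sums (\<Sum>k<5. legendre_lambert (zeta5 ^ k * x))"
    by (simp only: eq[OF zero_less_Suc])
  from sums_unique2[OF this 2] show ?thesis .
qed

lemma legendre_lambert_product':
  assumes "norm q < 1" "q \<noteq> 0"
  shows "legendre_lambert q * qpoch_inf q q = q * qpoch_inf (q ^ 5) (q ^ 5) ^ 5"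
proof -
  interpret quintic "Ln q" q "qpoch_inf q q" "qpoch_inf (q ^ 5) (q ^ 5)"
    using assms by unfold_locales auto
  show ?thesis by (rule legendre_lambert_product)
qed

lemma ramanujan_partition_5:
  assumes q: "norm q < 1" "q \<noteq> 0"
  shows "(\<lambda>n. of_nat (partition_number (5 * Suc n - 1)) * q ^ Suc n) sums
     (5 * q * (qpoch_inf (q ^ 5) (q ^ 5) ^ 5 / qpoch_inf q q ^ 6))"
proof -
  \<comment> \<open>Exponents divisible by 5 are extracted in the variable \<open>x\<close>, a fifth
    root of \<open>q\<close>. All five points \<open>zeta5 ^ k * x\<close> have fifth power
    \<open>q\<close>, so the product identity at each of them contains the same constant
    \<open>E ^ 5\<close>.\<close>
  define x where "x = exp (Ln q / 5)"
  have xq: "x ^ 5 = q" using q by (simp add: x_def flip: exp_of_nat_mult)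
  have x0: "x \<noteq> 0" by (simp add: x_def)
  have x: "norm x < 1"
    using q(1) power_less_one_iff[of "norm x" 5] by (simp add: norm_power flip: xq)
  define E where "E = qpoch_inf q q"
  have E: "E \<noteq> 0" unfolding E_def by (rule qpoch_inf_nonzero'[OF q(1) q(1)])
  have z0: "zeta5 \<noteq> 0" by (simp add: zeta5_def)
  have P: "(\<lambda>n. (of_nat (partition_number n) * x ^ Suc n) * (zeta5 ^ k) ^ Suc n) sums (legendre_lambert (zeta5 ^ k * x) / E ^ 5)" for k
  proof -
    define y where "y = zeta5 ^ k * x"
    have y: "norm y < 1" "y \<noteq> 0" using x x0 z0 by (simp_all add: y_def norm_mult norm_power)
    have "(zeta5 ^ k) ^ 5 = 1" by (metis power_mult mult.commute zeta5_power5 power_one)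
    then have y5: "y ^ 5 = q" by (simp add: y_def power_mult_distrib xq)
    have "legendre_lambert y * qpoch_inf y y = y * E ^ 5"
      using legendre_lambert_product'[OF y] by (simp only: y5 E_def)
    then have "legendre_lambert y / E ^ 5 = y * (1 / qpoch_inf y y)"
      using E qpoch_inf_nonzero'[OF y(1) y(1)] by (simp add: field_simps)
    moreover have "(\<lambda>n. y * (of_nat (partition_number n) * y ^ n)) sums (y * (1 / qpoch_inf y y))"
      by (intro sums_mult partition_number_sums y)
    ultimately have "(\<lambda>n. y * (of_nat (partition_number n) * y ^ n)) sums (legendre_lambert y / E ^ 5)" by (simp only:)
    moreover have "y * (of_nat (partition_number n) * y ^ n) = (of_nat (partition_number n) * x ^ Suc n) * (zeta5 ^ k) ^ Suc n" for n
      unfolding y_def by (simp add: power_mult_distrib mult_ac)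
    ultimately show ?thesis by (simp only: y_def)
  qed
  have "(\<Sum>k<5. legendre_lambert (zeta5 ^ k * x) / E ^ 5) = 25 * legendre_lambert q / E ^ 5"
    unfolding sum_divide_distrib[symmetric] sum_legendre_lambert_zeta5[OF x] xq ..
  with sums_fifth_root_filter[OF P]
  have "(\<lambda>n. 5 * (of_nat (partition_number (5 * n + 4)) * x ^ Suc (5 * n + 4))) sums (25 * legendre_lambert q / E ^ 5)"
    by (simp only:)
  from sums_mult[OF this, of "1 / 5"]
  have S: "(\<lambda>n. 1 / 5 * (5 * (of_nat (partition_number (5 * n + 4)) * x ^ Suc (5 * n + 4)))) sums (1 / 5 * (25 * legendre_lambert q / E ^ 5))" .
  have 1: "1 / 5 * (5 * (of_nat (partition_number (5 * n + 4)) * x ^ Suc (5 * n + 4)))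
      = of_nat (partition_number (5 * Suc n - 1)) * q ^ Suc n" for n
  proof -
    have e: "Suc (5 * n + 4) = 5 * Suc n" "5 * Suc n - 1 = 5 * n + 4" by simp_all
    show ?thesis unfolding e power_mult xq by simp
  qed
  have "legendre_lambert q = q * qpoch_inf (q ^ 5) (q ^ 5) ^ 5 / E"
    using legendre_lambert_product'[OF q] E by (simp add: E_def field_simps)
  then have 2: "1 / 5 * (25 * legendre_lambert q / E ^ 5) = 5 * q * (qpoch_inf (q ^ 5) (q ^ 5) ^ 5 / E ^ 6)"
    by (simp add: eval_nat_numeral)
  show ?thesis using S unfolding 1 2 unfolding E_def .
qed

theorem theorem3p1:
  fixes q :: complex
  assumes "norm q < 1"
  shows
    "summable (\<lambda>n. of_nat (cphi 5 n) * q ^ n) \<and>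
     summable (\<lambda>j. of_int (Legendre (int (Suc j)) 5) * (q ^ Suc j / (1 - q ^ Suc j) ^ 2)) \<and>
     summable (\<lambda>j. of_int (Legendre (int (Suc j)) 5) *
                     (of_nat (Suc j) * q ^ Suc j / (1 - q ^ Suc j))) \<and>
     summable (\<lambda>j. of_nat (partition_number (5 * Suc j - 1)) * q ^ Suc j) \<and>
     CPhi 5 q =
       1 / qpoch_inf q q ^ 5 *
         (1 + 25 * (\<Sum>j. of_int (Legendre (int (Suc j)) 5) * (q ^ Suc j / (1 - q ^ Suc j) ^ 2))
            - 5 * (\<Sum>j. of_int (Legendre (int (Suc j)) 5) *
                     (of_nat (Suc j) * q ^ Suc j / (1 - q ^ Suc j)))) \<and>
     1 / qpoch_inf q q ^ 5 *
         (1 + 25 * (\<Sum>j. of_int (Legendre (int (Suc j)) 5) * (q ^ Suc j / (1 - q ^ Suc j) ^ 2))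
            - 5 * (\<Sum>j. of_int (Legendre (int (Suc j)) 5) *
                     (of_nat (Suc j) * q ^ Suc j / (1 - q ^ Suc j)))) =
       1 / qpoch_inf (q ^ 5) (q ^ 5) +
         25 * q * (qpoch_inf (q ^ 5) (q ^ 5) ^ 5 / qpoch_inf q q ^ 6) \<and>
     1 / qpoch_inf (q ^ 5) (q ^ 5) +
         25 * q * (qpoch_inf (q ^ 5) (q ^ 5) ^ 5 / qpoch_inf q q ^ 6) =
       1 / qpoch_inf (q ^ 5) (q ^ 5) +
         5 * (\<Sum>j. of_nat (partition_number (5 * Suc j - 1)) * q ^ Suc j)"
proof (cases "q = 0")
  \<comment> \<open>The point \<open>q = 0\<close> has no logarithm, so the locale does not apply;
    every series reduces to its constant term.\<close>
  case True
  have "qpoch_inf 0 0 = 1" by (simp add: qpoch_inf_def)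
  then show ?thesis using True sums_cphi[of 0 5]
    by (simp add: CPhi_def powser_zero cphi_0 sums_iff)
next
  case False
  define E1 E5 where "E1 = qpoch_inf q q" and "E5 = qpoch_inf (q ^ 5) (q ^ 5)"
  interpret quintic "Ln q" q E1 E5
    using assms False by unfold_locales (auto simp: E1_def E5_def)
  let ?L1 = "\<Sum>j. of_int (Legendre (int (Suc j)) 5) * (q ^ Suc j / (1 - q ^ Suc j) ^ 2)"
  let ?L2 = "\<Sum>j. of_int (Legendre (int (Suc j)) 5) * (of_nat (Suc j) * q ^ Suc j / (1 - q ^ Suc j))"
  have L1: "?L1 = q * E5 ^ 5 / E1"
    using legendre_lambert_product E1_nonzero by (simp add: field_simps)
  have L2: "1 - 5 * ?L2 = E1 ^ 5 / E5"
    using legendre_lambert2_product E5_nonzero by (simp add: field_simps)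
  have split: "1 + 25 * ?L1 - 5 * ?L2 = E1 ^ 5 / E5 + 25 * (q * E5 ^ 5 / E1)"
    unfolding L1[symmetric] L2[symmetric] by simp
  have P: "(\<lambda>n. of_nat (partition_number (5 * Suc n - 1)) * q ^ Suc n) sums (5 * q * (E5 ^ 5 / E1 ^ 6))"
    unfolding E1_def E5_def by (rule ramanujan_partition_5[OF assms False])
  have 1: "CPhi 5 q = 1 / E1 ^ 5 * (1 + 25 * ?L1 - 5 * ?L2)"
    unfolding split CPhi_product[symmetric] using E1_nonzero by simp
  have 2: "1 / E1 ^ 5 * (1 + 25 * ?L1 - 5 * ?L2) = 1 / E5 + 25 * q * (E5 ^ 5 / E1 ^ 6)"
    unfolding split using E1_nonzero E5_nonzero by (simp add: field_simps) (simp add: eval_nat_numeral)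
  have 3: "1 / E5 + 25 * q * (E5 ^ 5 / E1 ^ 6)
      = 1 / E5 + 5 * (\<Sum>j. of_nat (partition_number (5 * Suc j - 1)) * q ^ Suc j)"
    unfolding sums_unique[OF P, symmetric] by simp
  show ?thesis
    unfolding E1_def[symmetric] E5_def[symmetric]
    using sums_summable[OF sums_cphi[OF assms]] summable_legendre_lambert[OF assms] sums_summable[OF P] 1 2 3
    by (intro conjI)
qed

end
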